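(* Let $K$ be a field with $\mathrm{char}(K)\neq 2$. (1) If $d\in\{1,2\}$, then any two embeddings $\psi,\psi'\colon\mathbb{P}^1\hookrightarrow\mathbb{P}^3$ over $K$ of degree $d$ are algebraically isotopic. (2) The set of algebraic isotopy classes of embeddings $\mathbb{P}^1\hookrightarrow\mathbb{P}^3$ over $K$ of degree $3$ is in bijection with $K^\times/K^{\times 4}$. (3) Two embeddings $\psi,\psi'\colon\mathbb{P}^1\hookrightarrow\mathbb{P}^3$ over $K$ of degree $4$ are algebraically isotopic if and only if they have the same arithmetic writhe $\mathrm{w}([\psi])=\mathrm{w}([\psi'])$ in $\mathrm{GW}(K)\times_{K^\times/K^{\times 2}}(K^\times/K^{\times 12})$.
   Context: Embeddings are closed embeddings; $\psi$ has degree $d$ if $\psi^*\mathcal{O}_{\mathbb{P}^3}(1)\cong\mathcal{O}_{\mathbb{P}^1}(d)$. An algebraic isotopy between embeddings $\psi_0,\psi_1\colon X\hookrightarrow\mathbb{P}^r$ of a projective $K$-variety $X$ is a $K$-morphism $I\colon\mathbb{A}^1\times X\to\mathbb{P}^r$ such that for every point $t\in\mathbb{A}^1$ the induced morphism $I_t\colon X_{\kappa(t)}\to\mathbb{P}^r_{\kappa(t)}$ is a closed embedding and $I_i=\psi_i$ for $i=0,1$. Two embeddings are algebraically isotopic if they are connected by a finite chain of algebraic isotopies; the equivalence classes are the algebraic isotopy classes. $\mathrm{GW}(K)$ is the Grothendieck–Witt group of non-degenerate symmetric bilinear forms over $K$; the fiber product is taken over the discriminant map $\mathrm{GW}(K)\to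 K^\times/K^{\times2}$ and the natural map from $K^\times/K^{\times12}$. Arithmetic writhe of a degree-four embedding. Let $\psi=[s_0,s_1,s_2,s_3]$ with $s_i\in K[u,v]_4=H^0(\mathbb{P}^1,\mathcal{O}(4))$. Identify $\wedge^5K[u,v]_4=K$ (by $u^4\wedge u^3v\wedge u^2v^2\wedge uv^3\wedge v^4\mapsto1$) and let $x_i$ be the linear form $\theta\mapsto\theta\wedge(u^{4-i}v^i)$ on $\wedge^4K[u,v]_4$, $0\le i\le4$. Put $$\Lambda=\begin{pmatrix} x_0 & x_1 & x_2 \\ x_1 & x_2 & x_3 \\ x_2 & x_3 & x_4 \end{pmatrix}.$$ Since $\psi$ is an embedding, $\Lambda(s_0\wedge s_1\wedge s_2\wedge s_3)$ is non-singular, and $\mathrm{w}([\psi])$ is the pair consisting of its class in $\mathrm{GW}(K)$ and its determinant in $K^\times/K^{\times12}$. (This is independent of rescaling $(s_0,\dots,s_3)$ by a common factor. It is the case $C=\mathbb{P}^1$, $L=\mathcal{O}(4)$, theta characteristic $\mathcal{O}(-1)$ of the general arithmetic writhe of an embedding; the first component is the $\mathbb{A}^1$-degree counting secant lines of $\psi(\mathbb{P}^1)$ through a point.) *)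

theory Defs
  imports
    "HOL-Library.Numeral_Type"
    "HOL-Computational_Algebra.Computational_Algebra"
    "HOL-Algebra.Algebraic_Closure_Type"
    "HOL-Algebra.Coset"
    "HOL-Algebra.Generated_Rings"
    "HOL-Algebra.Generated_Fields"
    "Jordan_Normal_Form.Matrix"
    "Jordan_Normal_Form.Determinant"
begin

section \<open>Morphisms from the projective line to projective 3-space\<close>

text \<open>
  A polynomial in \<open>R[u,v]\<close> is represented as an element of \<open>R[u][v]\<close>: the coefficient of
  \<open>u\<^sup>i v\<^sup>j\<close> in \<open>p\<close> is \<open>coeff (coeff p j) i\<close>. Throughout, \<open>R\<close> is a subring (possibly all) of the
  ring formed by a type. The index type \<open>4\<close> has the elements 0, 1, 2, 3.
\<close>

definition bivariate :: "'r::comm_ring_1 set \<Rightarrow> 'r poly poly set" where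
  "bivariate R = {p. \<forall>i j. coeff (coeff p j) i \<in> R}"

definition forms :: "'r::comm_ring_1 set \<Rightarrow> nat \<Rightarrow> 'r poly poly set" where
  "forms R d = {p \<in> bivariate R. \<forall>i j. coeff (coeff p j) i \<noteq> 0 \<longrightarrow> i + j = d}"

text \<open>
  Four sections of \<open>\<O>(d)\<close> on the projective line over \<open>Spec R\<close> without common zeros: the open sets
  where one of the sections does not vanish cover the projective line iff the irrelevant ideal
  \<open>(u,v)\<close> is contained in the radical of \<open>(s\<^sub>0,s\<^sub>1,s\<^sub>2,s\<^sub>3)\<close>, i.e. iff all forms of some degree \<open>N\<close>
  are contained in \<open>(s\<^sub>0,s\<^sub>1,s\<^sub>2,s\<^sub>3)\<close>. If every line bundle on \<open>Spec R\<close> is trivial (below \<open>R\<close> is a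
  field or \<open>K[t]\<close>), then the pullback of \<open>\<O>(1)\<close> under a morphism from the projective line over
  \<open>Spec R\<close> to projective 3-space is some \<open>\<O>(d)\<close>, and the morphism amounts to such a quadruple up
  to a common unit of \<open>R\<close>.
\<close>

definition generating_sections ::
    "'r::comm_ring_1 set \<Rightarrow> nat \<Rightarrow> (4 \<Rightarrow> 'r poly poly) \<Rightarrow> bool" where
  "generating_sections R d s \<longleftrightarrow>
     (\<forall>i. s i \<in> forms R d) \<and>
     (\<exists>N. forms R N \<subseteq> {\<Sum>i\<in>UNIV. c i * s i | c. range c \<subseteq> bivariate R})"

text \<open>
  For a field \<open>F\<close> and a form \<open>f \<noteq> 0\<close> of degree \<open>d > 0\<close>: the coordinate ring of the affine open set
  \<open>f \<noteq> 0\<close> of the projective line, as a subring of the field \<open>F(u,v)\<close>.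
\<close>

definition chart_ring :: "'f::field set \<Rightarrow> nat \<Rightarrow> 'f poly poly \<Rightarrow> 'f poly poly fract set" where
  "chart_ring F d f = {Fract g (f ^ n) | g n. g \<in> forms F (n * d)}"

text \<open>
  The morphism \<open>[s\<^sub>0,s\<^sub>1,s\<^sub>2,s\<^sub>3]\<close> over the field \<open>F\<close> is a closed embedding iff the preimage of every
  standard affine chart \<open>x\<^sub>i \<noteq> 0\<close> is affine and the homomorphism from the coordinate ring
  \<open>F[x\<^sub>0/x\<^sub>i,\<dots>,x\<^sub>3/x\<^sub>i]\<close> of the chart to that of its preimage is surjective; its image is the ring
  generated by \<open>F\<close> and the \<open>s\<^sub>j/s\<^sub>i\<close>. The preimage is the open set \<open>s\<^sub>i \<noteq> 0\<close>, which for \<open>d > 0\<close> is affine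
  (and empty if \<open>s\<^sub>i = 0\<close>). For \<open>d = 0\<close> it can be the whole, non-affine, projective line; the morphism
  is then constant and no closed embedding.
\<close>

definition closed_embedding ::
    "'f::field set \<Rightarrow> nat \<Rightarrow> (4 \<Rightarrow> 'f poly poly) \<Rightarrow> bool" where
  "closed_embedding F d s \<longleftrightarrow>
     d > 0 \<and> generating_sections F d s \<and>
     (\<forall>i. s i \<noteq> 0 \<longrightarrow>
        chart_ring F d (s i) \<subseteq>
        generate_ring ring_of_type_algebra
          ((\<lambda>a. Fract [:[:a:]:] 1) ` F \<union> range (\<lambda>j. Fract (s j) (s i))))"

definition morphism_of :: "(4 \<Rightarrow> 'a::field poly poly) \<Rightarrow> (4 \<Rightarrow> 'a poly poly) set" where
  "morphism_of s = {\<lambda>i. smult [:c:] (s i) | c. c \<noteq> 0}"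

definition embeddings :: "nat \<Rightarrow> (4 \<Rightarrow> 'a::field poly poly) set set" where
  "embeddings d = {morphism_of s | s. closed_embedding UNIV d s}"


section \<open>Algebraic isotopy\<close>

definition base_change ::
    "('r::comm_ring_1 \<Rightarrow> 'r'::comm_ring_1) \<Rightarrow> (4 \<Rightarrow> 'r poly poly) \<Rightarrow> (4 \<Rightarrow> 'r' poly poly)" where
  "base_change h s = (\<lambda>i. map_poly (map_poly h) (s i))"

text \<open>
  The closed points of the affine line over \<open>K\<close> are the conjugacy classes of elements \<open>\<alpha>\<close> of the
  algebraic closure of \<open>K\<close>. The residue field is \<open>K(\<alpha>)\<close>, and the coordinate \<open>t\<close> is mapped to \<open>\<alpha>\<close>.
\<close>

definition residue_field :: "'a::field alg_closure \<Rightarrow> 'a alg_closure set" where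
  "residue_field \<alpha> = generate_field ring_of_type_algebra (insert \<alpha> (range to_ac))"

definition eval_ac :: "'a::field alg_closure \<Rightarrow> 'a poly \<Rightarrow> 'a alg_closure" where
  "eval_ac \<alpha> p = poly (map_poly to_ac p) \<alpha>"

text \<open>
  \<open>S\<close> consists of forms over \<open>K[t]\<close> and describes a morphism on the product of the affine and the
  projective line. The restriction to the fibre over each point of the affine line, i.e. over the
  closed points and over the generic point with residue field \<open>K(t)\<close>, has to be a closed embedding.
\<close>

definition isotopy :: "nat \<Rightarrow> (4 \<Rightarrow> 'a::field poly poly poly) \<Rightarrow> bool" where
  "isotopy d S \<longleftrightarrow>
     generating_sections UNIV d S \<and>
     (\<forall>\<alpha>. closed_embedding (residue_field \<alpha>) d (base_change (eval_ac \<alpha>) S)) \<and>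
     closed_embedding UNIV d (base_change to_fract S)"

definition isotopy_rel ::
    "((4 \<Rightarrow> 'a::field poly poly) set \<times> (4 \<Rightarrow> 'a poly poly) set) set" where
  "isotopy_rel =
     {(\<psi>\<^sub>0, \<psi>\<^sub>1). \<psi>\<^sub>0 \<in> (\<Union>d. embeddings d) \<and> \<psi>\<^sub>1 \<in> (\<Union>d. embeddings d) \<and>
       (\<exists>d S. isotopy d S \<and>
          \<psi>\<^sub>0 = morphism_of (base_change (\<lambda>p. poly p 0) S) \<and>
          \<psi>\<^sub>1 = morphism_of (base_change (\<lambda>p. poly p 1) S))}"

text \<open>
  Isotopies can be reversed by \<open>t \<mapsto> 1 - t\<close>, so finite chains are given by the reflexive transitive
  closure.
\<close>

definition isotopic_rel ::
    "((4 \<Rightarrow> 'a::field poly poly) set \<times> (4 \<Rightarrow> 'a poly poly) set) set" where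
  "isotopic_rel = isotopy_rel\<^sup>*"


section \<open>Classes modulo powers and the Grothendieck-Witt group\<close>

definition mult_group :: "'a::field monoid" where
  "mult_group = units_of ring_of_type_algebra"

definition nth_powers :: "nat \<Rightarrow> 'a::field set" where
  "nth_powers n = (\<lambda>x. x ^ n) ` carrier mult_group"

definition power_class :: "nat \<Rightarrow> 'a::field \<Rightarrow> 'a set" where
  "power_class n a = nth_powers n #>\<^bsub>mult_group\<^esub> a"

definition power_class_group :: "nat \<Rightarrow> 'a::field set monoid" where
  "power_class_group n = mult_group Mod nth_powers n"

text \<open>
  Non-degenerate symmetric bilinear forms are represented by their Gram matrices, including the
  \<open>0 \<times> 0\<close> matrix for the form on the zero space.
\<close>

definition symmetric_forms :: "'a::field mat set" where
  "symmetric_forms = {A. square_mat A \<and> A\<^sup>T = A \<and> det A \<noteq> 0}"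

definition isometric :: "'a::field mat \<Rightarrow> 'a mat \<Rightarrow> bool" where
  "isometric A B \<longleftrightarrow>
     (\<exists>P \<in> carrier_mat (dim_row A) (dim_row A). invertible_mat P \<and> B = P\<^sup>T * A * P)"

text \<open>
  The Grothendieck group of the monoid of isometry classes under the orthogonal sum. The pair
  \<open>(A, B)\<close> stands for the formal difference \<open>[A] - [B]\<close>.
\<close>

definition gw_rel :: "(('a::field mat \<times> 'a mat) \<times> ('a mat \<times> 'a mat)) set" where
  "gw_rel =
     {((A, B), (A', B')).
       A \<in> symmetric_forms \<and> B \<in> symmetric_forms \<and> A' \<in> symmetric_forms \<and> B' \<in> symmetric_forms \<and>
       (\<exists>C \<in> symmetric_forms. isometric (diag_block_mat [A, B', C]) (diag_block_mat [A', B, C]))}"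

definition GW :: "('a::field mat \<times> 'a mat) set monoid" where
  "GW = \<lparr>
     carrier = (symmetric_forms \<times> symmetric_forms) // gw_rel,
     monoid.mult = (\<lambda>x y. \<Union>(A, B)\<in>x. \<Union>(C, D)\<in>y.
       gw_rel `` {(diag_block_mat [A, C], diag_block_mat [B, D])}),
     one = gw_rel `` {(0\<^sub>m 0 0, 0\<^sub>m 0 0)}\<rparr>"

definition gw_class :: "'a::field mat \<Rightarrow> ('a mat \<times> 'a mat) set" where
  "gw_class A = gw_rel `` {(A, 0\<^sub>m 0 0)}"

text \<open>
  The discriminant is the determinant modulo squares, without sign. The union is over the
  representatives of the class, and all of them give the same coset.
\<close>

definition gw_disc :: "('a::field mat \<times> 'a mat) set \<Rightarrow> 'a set" where
  "gw_disc x = (\<Union>(A, B)\<in>x. power_class 2 (det A / det B))"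

text \<open>
  The natural map from classes modulo \<open>n\<close>-th powers to classes modulo squares, for even \<open>n\<close>, sends a
  coset \<open>c\<close> to the coset \<open>(K\<^sup>\<times>)\<^sup>2 c\<close>.
\<close>

definition to_square_class :: "'a::field set \<Rightarrow> 'a set" where
  "to_square_class c = nth_powers 2 <#>\<^bsub>mult_group\<^esub> c"

definition writhe_group :: "(('a::field mat \<times> 'a mat) set \<times> 'a set) set" where
  "writhe_group =
     {(x, c) \<in> carrier GW \<times> carrier (power_class_group 12). gw_disc x = to_square_class c}"


section \<open>The arithmetic writhe of an embedding of degree four\<close>

text \<open>
  The value of the linear form \<open>x\<^sub>i\<close> at \<open>s\<^sub>0 \<and> s\<^sub>1 \<and> s\<^sub>2 \<and> s\<^sub>3\<close>. Under the identification of the fifth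
  exterior power with \<open>K\<close> that maps the wedge product of the basis \<open>u\<^sup>4, u\<^sup>3v, u\<^sup>2v\<^sup>2, uv\<^sup>3, v\<^sup>4\<close> to 1,
  the element \<open>s\<^sub>0 \<and> s\<^sub>1 \<and> s\<^sub>2 \<and> s\<^sub>3 \<and> u\<^bsup>4-i\<^esup>v\<^sup>i\<close> is the determinant of the matrix whose rows are the
  coordinates of the five factors.
\<close>

definition writhe_coord :: "(4 \<Rightarrow> 'a::field poly poly) \<Rightarrow> nat \<Rightarrow> 'a" where
  "writhe_coord s i =
     det (mat 5 5 (\<lambda>(r, c).
       if r < 4 then coeff (coeff (s (of_nat r)) c) (4 - c)
       else if c = i then 1 else 0))"

definition writhe_matrix :: "(4 \<Rightarrow> 'a::field poly poly) \<Rightarrow> 'a mat" where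
  "writhe_matrix s = mat 3 3 (\<lambda>(i, j). writhe_coord s (i + j))"

definition sections_writhe ::
    "(4 \<Rightarrow> 'a::field poly poly) \<Rightarrow> ('a mat \<times> 'a mat) set \<times> 'a set" where
  "sections_writhe s =
     (gw_class (writhe_matrix s), power_class 12 (det (writhe_matrix s)))"

text \<open>
  Replacing \<open>s\<close> by \<open>c s\<close> multiplies the matrix by the square \<open>c\<^sup>4\<close> and its determinant by \<open>c\<^bsup>12\<^esup>\<close>,
  so all representatives of a morphism have the same writhe.
\<close>

definition writhe ::
    "(4 \<Rightarrow> 'a::field poly poly) set \<Rightarrow> ('a mat \<times> 'a mat) set \<times> 'a set" where
  "writhe \<psi> = the_elem (sections_writhe ` \<psi>)"

end

theory Submission
  imports Defs "Jordan_Normal_Form.Char_Poly"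
begin

text \<open>
  If the \<open>k\<close>-fold products of the four sections span all forms of degree \<open>k d\<close>, then the sections
  define a closed embedding, and this condition is preserved by base change. Hence elementary row
  operations, with the parameter multiplied by \<open>t\<close>, are isotopies.

  Conversely, a linear functional on forms of degree \<open>d\<close> that kills the sections of a closed embedding
  is not annihilated by a quadratic form, since otherwise the image would have a node or a cusp.
  For \<open>d \<le> 3\<close> every functional has such a quadratic form, so the sections span all forms of
  degree \<open>d\<close>. This gives a normal form for row operations, and for \<open>d = 3\<close> the determinant of the
  sections remains; along an isotopy it is a polynomial in \<open>t\<close> without zeros, hence constant.

  For \<open>d = 4\<close> the exterior product of the sections is a quartic functional whose Hankel matrix is
  non-singular, and it determines the sections up to row operations. Along an isotopy the Hankel
  matrix has constant determinant, and Hermite reduction over \<open>K[t]\<close> makes it congruent to a constant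
  matrix, so the isometry class is constant. If two Hankel matrices of the same determinant are
  isometric, then both are connected to diagonal normal forms by polynomial paths of Hankel matrices
  with constant determinant, and the normal forms of isometric forms are connected by changing two
  diagonal entries at a time. Witt cancellation translates equality in the Grothendieck-Witt group
  into isometry.
\<close>

section \<open>Spans of products of sections\<close>

text \<open>Isotopy is defined fibre by fibre; the span condition replaces it by identities over
  K[t], which pass to all fibres at once. Up to degree 3 an embedding uses all forms, so single
  sections span. A quartic embedding is a projection of the rational normal curve from one point:
  its sections form the kernel of a functional, and products of two sections are the first that can
  span.

  The obstruction is a subscheme of length two, cut out by a quadric; congruences modulo the quadric
  treat nodes, conjugate nodes and cusps alike.

  Invertible row operations along the affine line have constant determinant, since the units of K[t]
  are constants. A determinant therefore survives, up to the common factor c of the sections: c^4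
  for cubics, and for quartics c^4 in each Hankel entry, hence c^12 in the determinant.

  Hankel matrices are not stable under general congruence, so the classical moves between isometric
  diagonal forms are rebuilt as paths inside them.\<close>

definition cst :: "'r::comm_ring_1 \<Rightarrow> 'r poly poly" where
  "cst a = [:[:a:]:]"

definition fmono :: "nat \<Rightarrow> nat \<Rightarrow> 'r::comm_ring_1 poly poly" where
  "fmono i j = monom (monom 1 i) j"

text \<open>Indexed by the exponent of v. For \<open>j > d\<close> the truncated exponent
  \<open>d - j\<close> is 0, and that coefficient of a form of degree \<open>d\<close> is
  zero.\<close>

definition form_coeff :: "nat \<Rightarrow> 'r::comm_ring_1 poly poly \<Rightarrow> nat \<Rightarrow> 'r" where
  "form_coeff d f j = coeff (coeff f j) (d - j)"

definition form_of :: "nat \<Rightarrow> (nat \<Rightarrow> 'r::comm_ring_1) \<Rightarrow> 'r poly poly" where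
  "form_of d c = (\<Sum>j\<le>d. cst (c j) * fmono (d - j) j)"

text \<open>Sums and products of coefficients are all that spans require. Both \<open>UNIV\<close>
  and the residue fields, which are sets inside the algebraic closure, fit.\<close>

definition semiring_set :: "'r::comm_ring_1 set \<Rightarrow> bool" where
  "semiring_set R \<longleftrightarrow> 0 \<in> R \<and> 1 \<in> R \<and> (\<forall>a\<in>R. \<forall>b\<in>R. a + b \<in> R \<and> a * b \<in> R)"

lemma semiring_set_UNIV [simp]: "semiring_set UNIV"
  by (simp add: semiring_set_def)

lemma cst_0 [simp]: "cst 0 = 0" and cst_1 [simp]: "cst 1 = 1"
  and cst_add: "cst (a + b) = cst a + cst b" and cst_mult: "cst (a * b) = cst a * cst b"
  and cst_minus: "cst (- a) = - cst a" and cst_diff: "cst (a - b) = cst a - cst b"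
  by (simp_all add: cst_def one_pCons)

lemma cst_eq_iff [simp]: "cst a = cst b \<longleftrightarrow> a = b" and cst_eq_0_iff [simp]: "cst a = 0 \<longleftrightarrow> a = 0"
  by (simp_all add: cst_def)

lemma coeff_cst_mult [simp]: "coeff (coeff (cst a * p) j) i = a * coeff (coeff p j) i"
  by (simp add: cst_def)

lemma smult_const_eq_cst: "smult [:c:] p = cst c * p"
  by (simp add: cst_def)

lemma fmono_mult: "fmono i j * fmono k l = fmono (i + k) (j + l)"
  by (simp add: fmono_def mult_monom)

lemma fmono_0_0 [simp]: "fmono 0 0 = 1"
  by (simp add: fmono_def)

lemma coeff_fmono: "coeff (coeff (fmono i j) l) k = (if k = i \<and> l = j then 1 else 0)"
  by (simp add: fmono_def)

lemma form_coeff_simps [simp]: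
  "form_coeff d (f + g) j = form_coeff d f j + form_coeff d g j"
  "form_coeff d (f - g) j = form_coeff d f j - form_coeff d g j"
  "form_coeff d (cst a * f) j = a * form_coeff d f j"
  "form_coeff d 0 j = 0"
  by (simp_all add: form_coeff_def)

lemma form_coeff_sum: "form_coeff d (sum f A) j = (\<Sum>x\<in>A. form_coeff d (f x) j)"
  by (induction A rule: infinite_finite_induct) simp_all

lemma form_coeff_fmono: "form_coeff d (fmono i j) l = (if i = d - l \<and> j = l then 1 else 0)"
  by (auto simp: form_coeff_def coeff_fmono)

lemma form_coeff_form_of:
  assumes "l \<le> d"
  shows "form_coeff d (form_of d c) l = c l"
proof -
  have "form_coeff d (form_of d c) l = (\<Sum>j\<le>d. if j = l then c l else 0)"
    unfolding form_of_def form_coeff_sum by (rule sum.cong) (auto simp: form_coeff_fmono)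
  thus ?thesis using assms by simp
qed

lemma form_of_coeff:
  assumes "f \<in> forms R d"
  shows "form_of d (form_coeff d f) = f"
proof (intro poly_eqI)
  fix j i
  have z: "coeff (coeff f j) i \<noteq> 0 \<Longrightarrow> i + j = d"
    using assms by (auto simp: forms_def)
  have "coeff (coeff (form_of d (form_coeff d f)) j) i =
     (\<Sum>l\<le>d. if l = j then (if i = d - j then form_coeff d f j else 0) else 0)"
    unfolding form_of_def coeff_sum by (rule sum.cong) (auto simp: coeff_fmono)
  also have "\<dots> = coeff (coeff f j) i"
  proof (cases "i + j = d")
    case False
    hence "coeff (coeff f j) i = 0" using z by blast
    thus ?thesis using False by (auto simp: form_coeff_def)
  qed (auto simp: form_coeff_def)
  finally show "coeff (coeff (form_of d (form_coeff d f)) j) i = coeff (coeff f j) i" .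
qed

lemma form_coeff_in: "f \<in> forms R d \<Longrightarrow> form_coeff d f j \<in> R"
  by (auto simp: forms_def bivariate_def form_coeff_def)

lemma forms_eqI:
  assumes "f \<in> forms R d" "g \<in> forms R' d" "\<And>j. j \<le> d \<Longrightarrow> form_coeff d f j = form_coeff d g j"
  shows "f = g"
proof -
  have "form_of d (form_coeff d f) = form_of d (form_coeff d g)"
    unfolding form_of_def using assms(3) by (intro sum.cong) auto
  thus ?thesis using assms(1,2) by (simp add: form_of_coeff)
qed

lemma forms_add: "semiring_set R \<Longrightarrow> f \<in> forms R d \<Longrightarrow> g \<in> forms R d \<Longrightarrow> f + g \<in> forms R d"
  unfolding forms_def bivariate_def semiring_set_def mem_Collect_eq coeff_add
  by (metis add.right_neutral)

lemma forms_0: "semiring_set R \<Longrightarrow> 0 \<in> forms R d"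
  by (auto simp: forms_def bivariate_def semiring_set_def)

lemma forms_cst_mult: "semiring_set R \<Longrightarrow> a \<in> R \<Longrightarrow> f \<in> forms R d \<Longrightarrow> cst a * f \<in> forms R d"
  by (auto simp: forms_def bivariate_def semiring_set_def) (metis mult_zero_right)

lemma forms_sum:
  "semiring_set R \<Longrightarrow> (\<And>x. x \<in> A \<Longrightarrow> f x \<in> forms R d) \<Longrightarrow> sum f A \<in> forms R d"
  by (induction A rule: infinite_finite_induct) (auto intro: forms_add forms_0)

lemma forms_fmono: "semiring_set R \<Longrightarrow> fmono i j \<in> forms R (i + j)"
  by (auto simp: forms_def bivariate_def semiring_set_def coeff_fmono split: if_splits)

lemma forms_fmono': "semiring_set R \<Longrightarrow> i + j = d \<Longrightarrow> fmono i j \<in> forms R d"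
  using forms_fmono by blast

lemma forms_form_of: "semiring_set R \<Longrightarrow> (\<And>j. j \<le> d \<Longrightarrow> c j \<in> R) \<Longrightarrow> form_of d c \<in> forms R d"
  unfolding form_of_def by (intro forms_sum forms_cst_mult forms_fmono') auto

lemma forms_mult:
  assumes "semiring_set R" "f \<in> forms R d" "g \<in> forms R e"
  shows "f * g \<in> forms R (d + e)"
proof -
  have "form_of d (form_coeff d f) * form_of e (form_coeff e g) \<in> forms R (d + e)"
    unfolding form_of_def sum_product
  proof (intro forms_sum assms)
    fix j l assume "j \<in> {..d}" "l \<in> {..e}"
    have "cst (form_coeff d f j) * fmono (d - j) j * (cst (form_coeff e g l) * fmono (e - l) l)
       = cst (form_coeff d f j * form_coeff e g l) * fmono (d - j + (e - l)) (j + l)"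
      by (simp add: cst_mult fmono_mult[symmetric] algebra_simps)
    moreover have "\<dots> \<in> forms R (d + e)"
      using \<open>j \<in> _\<close> \<open>l \<in> _\<close> assms(1) form_coeff_in[OF assms(2), of j] form_coeff_in[OF assms(3), of l]
      by (intro forms_cst_mult forms_fmono') (auto simp: semiring_set_def)
    ultimately show "cst (form_coeff d f j) * fmono (d - j) j * (cst (form_coeff e g l) * fmono (e - l) l)
      \<in> forms R (d + e)" by simp
  qed
  thus ?thesis using assms by (simp add: form_of_coeff)
qed

lemma forms_1: "semiring_set R \<Longrightarrow> 1 \<in> forms R 0"
  using forms_fmono[of R 0 0] by simp

lemma forms_power: "semiring_set R \<Longrightarrow> f \<in> forms R d \<Longrightarrow> f ^ n \<in> forms R (n * d)"
  by (induction n) (auto intro: forms_mult forms_1)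

text \<open>The part of degree \<open>k\<close> of the subalgebra generated by the sections over
  \<open>R\<close>, presented by generators so that inclusions follow by induction.\<close>

inductive prod_span ::
    "'r::comm_ring_1 set \<Rightarrow> (4 \<Rightarrow> 'r poly poly) \<Rightarrow> nat \<Rightarrow> 'r poly poly \<Rightarrow> bool" for R s where
  const: "a \<in> R \<Longrightarrow> prod_span R s 0 (cst a)"
| mult: "prod_span R s k p \<Longrightarrow> prod_span R s (Suc k) (p * s i)"
| add: "prod_span R s k p \<Longrightarrow> prod_span R s k q \<Longrightarrow> prod_span R s k (p + q)"

lemma prod_span_scale:
  assumes "semiring_set R" "a \<in> R"
  shows "prod_span R s k p \<Longrightarrow> prod_span R s k (cst a * p)"
proof (induction rule: prod_span.induct)
  case (const b)
  thus ?case using assms prod_span.const[of "a * b" R s] by (simp add: cst_mult semiring_set_def)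
next
  case (mult k p i)
  thus ?case using prod_span.mult[of R s k "cst a * p" i] by (simp add: mult.assoc)
next
  case (add k p q)
  thus ?case by (simp add: distrib_left prod_span.add)
qed

lemma prod_span_0: "semiring_set R \<Longrightarrow> prod_span R s k 0"
proof (induction k)
  case 0 thus ?case using prod_span.const[of 0 R s] by (simp add: semiring_set_def)
next
  case (Suc k) thus ?case using prod_span.mult[of R s k 0 0] by simp
qed

lemma prod_span_sum:
  "semiring_set R \<Longrightarrow> (\<And>x. x \<in> A \<Longrightarrow> prod_span R s k (f x)) \<Longrightarrow> prod_span R s k (sum f A)"
  by (induction A rule: infinite_finite_induct) (auto intro: prod_span.add prod_span_0)

lemma prod_span_mult:
  assumes "semiring_set R" "prod_span R s k p"
  shows "prod_span R s l q \<Longrightarrow> prod_span R s (k + l) (p * q)"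
proof (induction rule: prod_span.induct)
  case (const b)
  thus ?case using prod_span_scale[OF assms(1) _ assms(2), of b] by (simp add: mult.commute)
next
  case (mult l q i)
  thus ?case using prod_span.mult[of R s "k + l" "p * q" i] by (simp add: mult.assoc)
next
  case (add l q q')
  thus ?case by (simp add: distrib_left prod_span.add)
qed

lemma prod_span_section: "semiring_set R \<Longrightarrow> prod_span R s 1 (s i)"
  using prod_span.mult[OF prod_span.const[of 1 R s], of i] by (simp add: semiring_set_def)

lemma prod_span_comb:
  "semiring_set R \<Longrightarrow> range c \<subseteq> R \<Longrightarrow> prod_span R s 1 (\<Sum>i\<in>A. cst (c i) * s i)"
  by (intro prod_span_sum prod_span_scale prod_span_section) auto

lemma prod_span_trans:
  assumes "semiring_set R" "\<And>i. prod_span R s 1 (t i)"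
  shows "prod_span R t k p \<Longrightarrow> prod_span R s k p"
proof (induction rule: prod_span.induct)
  case (mult k p i)
  thus ?case using prod_span_mult[OF assms(1) mult.IH assms(2), of i] by simp
qed (auto intro: prod_span.intros)

lemma map_cst: "h 0 = 0 \<Longrightarrow> map_poly (map_poly h) (cst a) = cst (h a)"
  by (intro poly_eqI) (simp add: cst_def coeff_map_poly coeff_pCons split: nat.splits)

lemma map_fmono: "h 0 = 0 \<Longrightarrow> h 1 = 1 \<Longrightarrow> map_poly (map_poly h) (fmono i j) = fmono i j"
  by (simp add: fmono_def map_poly_monom)

text \<open>Membership is witnessed by an identity between polynomials, which every ring
  homomorphism preserves. This is the reason for working with spans instead of chart rings.\<close>

lemma prod_span_base_change:
  assumes "comm_ring_hom h" "h ` R \<subseteq> R'" "prod_span R s k p"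
  shows "prod_span R' (base_change h s) k (map_poly (map_poly h) p)"
proof -
  interpret h: comm_ring_hom h by fact
  interpret hp: map_poly_comm_ring_hom h ..
  interpret hpp: map_poly_comm_ring_hom "map_poly h" ..
  show ?thesis using assms(3)
  proof (induction rule: prod_span.induct)
    case (const a)
    have "prod_span R' (base_change h s) 0 (cst (h a))"
      using const assms(2) by (intro prod_span.const) auto
    thus ?case by (simp add: map_cst)
  next
    case (mult k p i)
    show ?case using prod_span.mult[OF mult.IH, of i] by (simp only: hpp.hom_mult base_change_def)
  next
    case (add k p q)
    show ?case using prod_span.add[OF add.IH] by (simp only: hpp.hom_add)
  qed
qed

text \<open>\<open>k = 1\<close> serves in degrees up to 3 and \<open>k = 2\<close> in degree 4. The
  value \<open>k = 0\<close> has to be excluded, as it would be satisfied by all sections.\<close>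

definition generically_spanning :: "'r::comm_ring_1 set \<Rightarrow> nat \<Rightarrow> (4 \<Rightarrow> 'r poly poly) \<Rightarrow> bool" where
  "generically_spanning R d s \<longleftrightarrow> (\<forall>i. s i \<in> forms R d) \<and>
     (\<exists>k\<ge>1. \<forall>i j. i + j = k * d \<longrightarrow> prod_span R s k (fmono i j))"

lemma forms_base_change:
  assumes "comm_ring_hom h" "h ` R \<subseteq> R'" "f \<in> forms R d"
  shows "map_poly (map_poly h) f \<in> forms R' d"
proof -
  interpret h: comm_ring_hom h by fact
  have "coeff (coeff (map_poly (map_poly h) f) j) i = h (coeff (coeff f j) i)" for i j
    by (simp add: coeff_map_poly)
  moreover have "h x \<noteq> 0 \<Longrightarrow> x \<noteq> 0" for x by auto
  ultimately show ?thesis using assms(2,3) unfolding forms_def bivariate_def by auto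
qed

lemma generically_spanning_base_change:
  assumes "generically_spanning R d s" "comm_ring_hom h" "h ` R \<subseteq> R'"
  shows "generically_spanning R' d (base_change h s)"
proof -
  interpret h: comm_ring_hom h by fact
  obtain k where k: "k \<ge> 1" "\<And>i j. i + j = k * d \<Longrightarrow> prod_span R s k (fmono i j)"
    using assms(1) by (auto simp: generically_spanning_def)
  have "prod_span R' (base_change h s) k (fmono i j)" if "i + j = k * d" for i j
    using prod_span_base_change[OF assms(2,3) k(2)[OF that]] by (simp add: map_fmono)
  moreover have "base_change h s i \<in> forms R' d" for i
    using assms(1) forms_base_change[OF assms(2,3), of "s i" d]
    by (simp add: generically_spanning_def base_change_def)
  ultimately show ?thesis using k(1) unfolding generically_spanning_def by blast
qed

lemma prod_span_fmono_power:
  assumes "semiring_set R" "\<And>i j. i + j = D \<Longrightarrow> prod_span R s k (fmono i j)"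
  shows "i + j = n * D \<Longrightarrow> prod_span R s (n * k) (fmono i j)"
proof (induction n arbitrary: i j)
  case 0
  thus ?case using assms(1) prod_span.const[of 1 R s] by (simp add: semiring_set_def)
next
  case (Suc n)
  \<comment> \<open>Greedy splitting: the first factor takes as many u as fit into degree
    \<open>D\<close>.\<close>
  define a where "a = min i D"
  have ij: "i = a + (i - a)" "j = (D - a) + (j - (D - a))" "a + (D - a) = D"
    "(i - a) + (j - (D - a)) = n * D"
    using Suc.prems by (auto simp: a_def min_def)
  have "prod_span R s (k + n * k) (fmono a (D - a) * fmono (i - a) (j - (D - a)))"
    by (intro prod_span_mult assms Suc.IH) (use ij in auto)
  thus ?case using ij by (simp add: fmono_mult)
qed

lemma prod_span_forms:
  assumes "semiring_set R" "\<And>i j. i + j = D \<Longrightarrow> prod_span R s k (fmono i j)" "f \<in> forms R D"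
  shows "prod_span R s k f"
proof -
  have "prod_span R s k (form_of D (form_coeff D f))"
    unfolding form_of_def
    by (intro prod_span_sum prod_span_scale assms) (use assms(3) in \<open>auto intro: form_coeff_in\<close>)
  thus ?thesis using assms(3) by (simp add: form_of_coeff)
qed

lemma bivariate_add: "semiring_set R \<Longrightarrow> p \<in> bivariate R \<Longrightarrow> q \<in> bivariate R \<Longrightarrow> p + q \<in> bivariate R"
  by (auto simp: bivariate_def semiring_set_def)

lemma semiring_set_sum: "semiring_set R \<Longrightarrow> (\<And>x. x \<in> A \<Longrightarrow> f x \<in> R) \<Longrightarrow> sum f A \<in> R"
  by (induction A rule: infinite_finite_induct) (auto simp: semiring_set_def)

lemma bivariate_mult: "semiring_set R \<Longrightarrow> p \<in> bivariate R \<Longrightarrow> q \<in> bivariate R \<Longrightarrow> p * q \<in> bivariate R"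
  unfolding bivariate_def mem_Collect_eq coeff_mult coeff_sum
  by (intro allI semiring_set_sum) (auto simp: coeff_mult semiring_set_def intro!: semiring_set_sum)

lemma prod_span_bivariate:
  assumes "semiring_set R" "\<And>i. s i \<in> bivariate R"
  shows "prod_span R s k p \<Longrightarrow> p \<in> bivariate R"
proof (induction rule: prod_span.induct)
  case (const a)
  thus ?case using assms(1) by (auto simp: bivariate_def cst_def semiring_set_def coeff_pCons split: nat.splits)
qed (auto intro: bivariate_add bivariate_mult assms)

lemma prod_span_ideal:
  assumes "semiring_set R" "\<And>i. s i \<in> bivariate R"
  shows "prod_span R s k p \<Longrightarrow> k \<ge> 1 \<Longrightarrow> p \<in> {\<Sum>i\<in>UNIV. c i * s i | c. range c \<subseteq> bivariate R}"
proof (induction rule: prod_span.induct)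
  case (mult k p i)
  have 0: "0 \<in> bivariate R" using assms(1) by (auto simp: bivariate_def semiring_set_def)
  have "p * s i = (\<Sum>j\<in>UNIV. (if j = i then p else 0) * s j)"
    by (simp add: if_distrib if_distribR cong: if_cong)
  moreover have "range (\<lambda>j. if j = i then p else 0) \<subseteq> bivariate R"
    using prod_span_bivariate[OF assms mult(1)] 0 by auto
  ultimately show ?case by (intro CollectI exI conjI)
next
  case (add k p q)
  then obtain c c' where c: "p = (\<Sum>i\<in>UNIV. c i * s i)" "range c \<subseteq> bivariate R"
    "q = (\<Sum>i\<in>UNIV. c' i * s i)" "range c' \<subseteq> bivariate R" by auto
  have "p + q = (\<Sum>i\<in>UNIV. (c i + c' i) * s i)"
    using c by (simp add: sum.distrib distrib_right)
  moreover have "range (\<lambda>i. c i + c' i) \<subseteq> bivariate R"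
    using c assms(1) by (auto intro!: bivariate_add)
  ultimately show ?case by (intro CollectI exI conjI)
qed simp

lemma generically_spanning_generating:
  assumes "semiring_set R" "generically_spanning R d s"
  shows "generating_sections R d s"
proof -
  obtain k where k: "k \<ge> 1" "\<And>i j. i + j = k * d \<Longrightarrow> prod_span R s k (fmono i j)"
    and s: "\<And>i. s i \<in> forms R d"
    using assms(2) by (auto simp: generically_spanning_def)
  have "forms R (k * d) \<subseteq> {\<Sum>i\<in>UNIV. c i * s i | c. range c \<subseteq> bivariate R}"
  proof
    fix f assume "f \<in> forms R (k * d)"
    hence "prod_span R s k f" by (intro prod_span_forms[OF assms(1) k(2)])
    thus "f \<in> {\<Sum>i\<in>UNIV. c i * s i | c. range c \<subseteq> bivariate R}"
      by (rule prod_span_ideal[OF assms(1) _ _ k(1), rotated]) (use s in \<open>auto simp: forms_def\<close>)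
  qed
  thus ?thesis using s by (auto simp: generating_sections_def)
qed

section \<open>Surjectivity onto the chart rings\<close>

lemma generate_ring_type_simps:
  "1 \<in> generate_ring ring_of_type_algebra H"
  "h \<in> H \<Longrightarrow> h \<in> generate_ring ring_of_type_algebra H"
  "x \<in> generate_ring ring_of_type_algebra H \<Longrightarrow> y \<in> generate_ring ring_of_type_algebra H \<Longrightarrow>
    x + y \<in> generate_ring ring_of_type_algebra H"
  "x \<in> generate_ring ring_of_type_algebra H \<Longrightarrow> y \<in> generate_ring ring_of_type_algebra H \<Longrightarrow>
    x * y \<in> generate_ring ring_of_type_algebra H"
  using generate_ring.intros[where R = ring_of_type_algebra and H = H] by (auto simp: ring_of_type_algebra_def)

lemma prod_span_generate:
  fixes s :: "4 \<Rightarrow> 'f::field poly poly" and F :: "'f set"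
  assumes "s i \<noteq> 0"
  defines "H \<equiv> (\<lambda>a. Fract [:[:a:]:] 1) ` F \<union> range (\<lambda>j. Fract (s j) (s i))"
  shows "prod_span F s k p \<Longrightarrow> Fract p (s i ^ k) \<in> generate_ring ring_of_type_algebra H"
proof (induction rule: prod_span.induct)
  case (const a)
  thus ?case by (auto simp: H_def cst_def intro!: generate_ring_type_simps(2))
next
  case (mult k p j)
  have "Fract (p * s j) (s i ^ Suc k) = Fract p (s i ^ k) * Fract (s j) (s i)"
    by (simp add: mult.commute)
  also have "\<dots> \<in> generate_ring ring_of_type_algebra H"
    by (intro generate_ring_type_simps(4) mult.IH generate_ring_type_simps(2)) (auto simp: H_def)
  finally show ?case .
next
  case (add k p q)
  have "Fract (p + q) (s i ^ k) = Fract p (s i ^ k) + Fract q (s i ^ k)"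
    using assms(1) by (simp add: eq_fract algebra_simps)
  thus ?case using generate_ring_type_simps(3)[OF add.IH] by simp
qed

text \<open>A fraction g / s_i^n is expanded by s_i^m with n + m = n k, so that its numerator has
  degree n k d. There all forms are sums of n k-fold products of sections, and division by s_i^(n k)
  turns these into products of ratios.\<close>

lemma generically_spanning_closed_embedding:
  fixes s :: "4 \<Rightarrow> 'f::field poly poly"
  assumes "semiring_set F" "d > 0" "generically_spanning F d s"
  shows "closed_embedding F d s"
proof -
  obtain k where k: "k \<ge> 1" "\<And>i j. i + j = k * d \<Longrightarrow> prod_span F s k (fmono i j)"
    and s: "\<And>i. s i \<in> forms F d"
    using assms(3) by (auto simp: generically_spanning_def)
  have "chart_ring F d (s i) \<subseteq> generate_ring ring_of_type_algebra
          ((\<lambda>a. Fract [:[:a:]:] 1) ` F \<union> range (\<lambda>j. Fract (s j) (s i)))" if i: "s i \<noteq> 0" for i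
  proof
    fix x assume "x \<in> chart_ring F d (s i)"
    then obtain g n where g: "g \<in> forms F (n * d)" "x = Fract g (s i ^ n)"
      by (auto simp: chart_ring_def)
    define m where "m = n * (k - 1)"
    have nk: "n * k = n + m" using k(1) by (cases k) (auto simp: m_def)
    have "g * s i ^ m \<in> forms F (n * d + m * d)"
      by (intro forms_mult forms_power g s assms)
    hence "g * s i ^ m \<in> forms F (n * (k * d))"
      using nk by (simp add: algebra_simps flip: distrib_left)
    hence "prod_span F s (n * k) (g * s i ^ m)"
      by (rule prod_span_forms[OF assms(1), rotated])
         (rule prod_span_fmono_power[OF assms(1) k(2)])
    note prod_span_generate[OF i this]
    moreover have "Fract (g * s i ^ m) (s i ^ (n * k)) = x"
      using i by (simp add: g(2) eq_fract nk power_add)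
    ultimately show "x \<in> generate_ring ring_of_type_algebra
          ((\<lambda>a. Fract [:[:a:]:] 1) ` F \<union> range (\<lambda>j. Fract (s j) (s i)))" by simp
  qed
  thus ?thesis using assms generically_spanning_generating by (auto simp: closed_embedding_def)
qed

section \<open>Fibres over the points of the affine line\<close>

lemma residue_field_mem:
  "to_ac a \<in> residue_field \<alpha>" "\<alpha> \<in> residue_field \<alpha>"
  by (auto simp: residue_field_def intro!: generate_field.incl)

lemma semiring_set_residue_field: "semiring_set (residue_field \<alpha>)"
proof -
  have "x + y \<in> residue_field \<alpha>" "x * y \<in> residue_field \<alpha>"
    if "x \<in> residue_field \<alpha>" "y \<in> residue_field \<alpha>" for x y
    using generate_field.eng_add[of x ring_of_type_algebra "insert \<alpha> (range to_ac)" y]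
      generate_field.eng_mult[of x ring_of_type_algebra "insert \<alpha> (range to_ac)" y] that
    by (simp_all add: residue_field_def ring_of_type_algebra_def)
  thus ?thesis using residue_field_mem(1)[of 0 \<alpha>] residue_field_mem(1)[of 1 \<alpha>]
    by (auto simp: semiring_set_def)
qed

lemma comm_ring_hom_to_ac: "comm_ring_hom to_ac"
  by unfold_locales simp_all

lemma comm_ring_hom_poly: "comm_ring_hom (\<lambda>p. poly p (a::'r::comm_ring_1))"
  by unfold_locales simp_all

lemma comm_ring_hom_eval_ac: "comm_ring_hom (eval_ac \<alpha>)"
proof -
  interpret h: comm_ring_hom "to_ac :: 'a \<Rightarrow> _" by (rule comm_ring_hom_to_ac)
  interpret hp: map_poly_comm_ring_hom "to_ac :: 'a \<Rightarrow> _" ..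
  show ?thesis by unfold_locales (simp_all add: eval_ac_def hp.hom_add hp.hom_mult)
qed

lemma comm_ring_hom_to_fract: "comm_ring_hom to_fract"
  by unfold_locales (simp_all add: to_fract_def Zero_fract_def One_fract_def)

lemma eval_ac_in_residue_field: "eval_ac \<alpha> p \<in> residue_field \<alpha>"
proof (induction p)
  case 0
  thus ?case using residue_field_mem(1)[of 0 \<alpha>] by (simp add: eval_ac_def)
next
  case (pCons a p)
  have "eval_ac \<alpha> (pCons a p) = to_ac a + \<alpha> * eval_ac \<alpha> p"
    by (simp add: eval_ac_def Polynomial.map_poly_pCons)
  moreover have "\<alpha> * eval_ac \<alpha> p \<in> residue_field \<alpha>"
    using pCons.IH residue_field_mem(2)[of \<alpha>] semiring_set_residue_field[of \<alpha>]
    by (simp add: semiring_set_def)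
  ultimately show ?case using residue_field_mem(1)[of a \<alpha>] semiring_set_residue_field[of \<alpha>]
    by (simp add: semiring_set_def)
qed

text \<open>Evaluation at \<alpha> and the inclusion of K[t] into K(t) are ring homomorphisms, so
  base change settles the closed fibres and the generic fibre in the same way.\<close>

lemma isotopy_if_generically_spanning:
  fixes S :: "4 \<Rightarrow> 'a::field poly poly poly"
  assumes "d > 0" "generically_spanning UNIV d S"
  shows "isotopy d S"
proof -
  have "closed_embedding (residue_field \<alpha>) d (base_change (eval_ac \<alpha>) S)" for \<alpha>
    by (intro generically_spanning_closed_embedding semiring_set_residue_field assms
        generically_spanning_base_change[OF assms(2) comm_ring_hom_eval_ac])
       (auto simp: eval_ac_in_residue_field)
  moreover have "closed_embedding UNIV d (base_change to_fract S)"
    by (intro generically_spanning_closed_embedding assms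
        generically_spanning_base_change[OF assms(2) comm_ring_hom_to_fract]) auto
  ultimately show ?thesis
    using generically_spanning_generating[OF _ assms(2)] by (simp add: isotopy_def)
qed

lemma isotopy_rel_if_generically_spanning:
  fixes S :: "4 \<Rightarrow> 'a::field poly poly poly"
  assumes "d > 0" "generically_spanning UNIV d S"
  shows "(morphism_of (base_change (\<lambda>p. poly p 0) S), morphism_of (base_change (\<lambda>p. poly p 1) S))
    \<in> isotopy_rel"
proof -
  have "morphism_of (base_change (\<lambda>p. poly p a) S) \<in> embeddings d" for a
    unfolding embeddings_def
    using generically_spanning_closed_embedding[OF _ assms(1)
        generically_spanning_base_change[OF assms(2) comm_ring_hom_poly, of a UNIV]] by auto
  hence "morphism_of (base_change (\<lambda>p. poly p a) S) \<in> (\<Union>d. embeddings d)" for a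
    by blast
  thus ?thesis
    unfolding isotopy_rel_def using isotopy_if_generically_spanning[OF assms]
    by (intro CollectI case_prodI conjI exI[of _ d] exI[of _ S] refl) auto
qed

section \<open>Row operations\<close>

definition row_add :: "'r::comm_ring_1 \<Rightarrow> 4 \<Rightarrow> 4 \<Rightarrow> (4 \<Rightarrow> 'r poly poly) \<Rightarrow> 4 \<Rightarrow> 'r poly poly" where
  "row_add c i j s = s(i := s i + cst c * s j)"

text \<open>Transvections only: over a field they generate SL_4, and each is the end of a path of
  invertible matrices over K[t] that starts at the identity. Scaling a single row by a factor other
  than 1 is not, because the determinant of such a path is constant.\<close>

definition row_step :: "((4 \<Rightarrow> 'r::comm_ring_1 poly poly) \<times> (4 \<Rightarrow> 'r poly poly)) set" where
  "row_step = {(s, row_add c i j s) | s c i j. i \<noteq> j}"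

lemma row_stepI: "i \<noteq> j \<Longrightarrow> (s, row_add c i j s) \<in> row_step"
  by (auto simp: row_step_def)

lemma base_change_comp:
  assumes "comm_ring_hom h" "comm_ring_hom g"
  shows "base_change h (base_change g s) = base_change (\<lambda>x. h (g x)) s"
proof -
  interpret h: comm_ring_hom h by fact
  interpret g: comm_ring_hom g by fact
  show ?thesis
    by (auto simp: base_change_def fun_eq_iff poly_eq_iff coeff_map_poly)
qed

lemma base_change_id: "base_change (\<lambda>x. x) s = s"
  by (auto simp: base_change_def fun_eq_iff poly_eq_iff coeff_map_poly)

lemma base_change_row_add:
  assumes "comm_ring_hom h"
  shows "base_change h (row_add c i j s) = row_add (h c) i j (base_change h s)"
proof -
  interpret h: comm_ring_hom h by fact
  interpret hp: map_poly_comm_ring_hom h ..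
  interpret hpp: map_poly_comm_ring_hom "map_poly h" ..
  have "map_poly (map_poly h) (x + cst c * y) =
      map_poly (map_poly h) x + cst (h c) * map_poly (map_poly h) y" for x y
    by (simp only: hpp.hom_add hpp.hom_mult map_cst[where h = h, OF h.hom_zero])
  thus ?thesis by (auto simp: base_change_def row_add_def fun_eq_iff)
qed

lemma prod_span_row_add:
  assumes "i \<noteq> j"
  shows "prod_span UNIV (row_add c i j s) 1 (s k)"
proof -
  let ?t = "row_add c i j s"
  have "prod_span UNIV ?t 1 (?t i + cst (- c) * ?t j)"
    by (intro prod_span.add prod_span_scale prod_span_section) auto
  moreover have "?t i + cst (- c) * ?t j = s i"
    using assms by (simp add: row_add_def cst_minus)
  moreover have "k \<noteq> i \<Longrightarrow> ?t k = s k" by (simp add: row_add_def)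
  ultimately show ?thesis
    using prod_span_section[of UNIV ?t k] by (cases "k = i") auto
qed

lemma generically_spanning_row_add:
  assumes "generically_spanning UNIV d s" "i \<noteq> j"
  shows "generically_spanning UNIV d (row_add c i j s)"
proof -
  obtain k where k: "k \<ge> 1" "\<And>i j. i + j = k * d \<Longrightarrow> prod_span UNIV s k (fmono i j)"
    and s: "\<And>i. s i \<in> forms UNIV d"
    using assms(1) by (auto simp: generically_spanning_def)
  have "prod_span UNIV (row_add c i j s) k (fmono a b)" if "a + b = k * d" for a b
    using prod_span_trans[OF _ prod_span_row_add[OF assms(2)] k(2)[OF that]] by simp
  moreover have "row_add c i j s l \<in> forms UNIV d" for l
    using s by (auto simp: row_add_def intro!: forms_add forms_cst_mult)
  ultimately show ?thesis using k(1) by (auto simp: generically_spanning_def)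
qed

lemma comm_ring_hom_const_poly: "comm_ring_hom (\<lambda>a::'r::comm_ring_1. [:a:])"
  by unfold_locales (simp_all add: one_pCons)

lemma base_change_const_poly_eval:
  "base_change (\<lambda>p. poly p a) (base_change (\<lambda>a. [:a:]) s) = s"
  using base_change_comp[OF comm_ring_hom_poly[of a] comm_ring_hom_const_poly]
  by (simp add: base_change_id)

lemma row_add_isotopy:
  fixes s :: "4 \<Rightarrow> 'a::field poly poly"
  assumes "d > 0" "generically_spanning UNIV d s" "i \<noteq> j"
  shows "(morphism_of s, morphism_of (row_add c i j s)) \<in> isotopy_rel"
proof -
  define S where "S = row_add [:0, c:] i j (base_change (\<lambda>a. [:a:]) s)"
  have "generically_spanning UNIV d (base_change (\<lambda>a. [:a:]) s)"
    using generically_spanning_base_change[OF assms(2) comm_ring_hom_const_poly] by simp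
  hence "generically_spanning UNIV d S"
    unfolding S_def by (rule generically_spanning_row_add) fact
  from isotopy_rel_if_generically_spanning[OF assms(1) this]
  show ?thesis
    by (simp add: S_def base_change_row_add comm_ring_hom_poly base_change_const_poly_eval)
       (simp add: row_add_def)
qed

lemma row_steps_isotopic:
  fixes s :: "4 \<Rightarrow> 'a::field poly poly"
  assumes "(s, t) \<in> row_step\<^sup>*" "d > 0" "generically_spanning UNIV d s"
  shows "generically_spanning UNIV d t \<and> (morphism_of s, morphism_of t) \<in> isotopic_rel"
  using assms(1)
proof (induction rule: rtrancl_induct)
  case base
  thus ?case using assms by (simp add: isotopic_rel_def)
next
  case (step t u)
  from step(2) obtain c i j where u: "u = row_add c i j t" "i \<noteq> j"
    by (auto simp: row_step_def)
  have "(morphism_of t, morphism_of u) \<in> isotopy_rel"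
    unfolding u(1) using row_add_isotopy assms(2) step.IH u(2) by blast
  thus ?case
    using step.IH generically_spanning_row_add u by (auto simp: isotopic_rel_def)
qed

text \<open>Both degrees share one induction, since a product in degree 1 rests on the shape of its
  factor in degree 0.\<close>

lemma prod_span_cases:
  assumes "prod_span UNIV s k p"
  shows "(k = 0 \<longrightarrow> (\<exists>a. p = cst a)) \<and> (k = 1 \<longrightarrow> (\<exists>c. p = (\<Sum>i\<in>UNIV. cst (c i) * s i)))"
  using assms
proof (induction rule: prod_span.induct)
  case (const a)
  thus ?case by auto
next
  case (mult k p i)
  have "\<exists>c. p * s i = (\<Sum>j\<in>UNIV. cst (c j) * s j)" if k0: "k = 0"
  proof -
    obtain a where "p = cst a" using mult.IH k0 by blast
    hence "p * s i = (\<Sum>j\<in>UNIV. cst (if j = i then a else 0) * s j)"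
      by (simp add: if_distrib if_distribR cong: if_cong)
    thus ?thesis by (rule exI[of _ "\<lambda>j. if j = i then a else 0"])
  qed
  thus ?case by simp
next
  case (add k p q)
  show ?case
  proof (intro conjI impI)
    assume "k = 0"
    with add.IH obtain a b where "p = cst a" "q = cst b" by auto
    thus "\<exists>a. p + q = cst a" by (auto intro!: exI[of _ "a + b"] simp: cst_add)
  next
    assume "k = 1"
    with add.IH obtain c e where "p = (\<Sum>i\<in>UNIV. cst (c i) * s i)" "q = (\<Sum>i\<in>UNIV. cst (e i) * s i)"
      by auto
    hence "p + q = (\<Sum>i\<in>UNIV. cst (c i + e i) * s i)"
      by (simp add: cst_add distrib_right sum.distrib)
    thus "\<exists>c. p + q = (\<Sum>i\<in>UNIV. cst (c i) * s i)" by (rule exI[of _ "\<lambda>i. c i + e i"])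
  qed
qed

lemma prod_span_1E:
  assumes "prod_span UNIV s 1 p"
  obtains c where "p = (\<Sum>i\<in>UNIV. cst (c i) * s i)"
  using prod_span_cases[OF assms] by auto

lemma row_steps_span:
  assumes "(s, t) \<in> row_step\<^sup>*" "prod_span UNIV s 1 p"
  shows "prod_span UNIV t 1 p"
  using assms(1)
proof (induction rule: rtrancl_induct)
  case (step t u)
  from step(2) obtain c i j where u: "u = row_add c i j t" "i \<noteq> j"
    by (auto simp: row_step_def)
  show ?case
    using prod_span_trans[OF _ prod_span_row_add[OF u(2), of c t] step.IH] u(1) by simp
qed (fact assms(2))

lemma row_steps_add:
  assumes "i \<notin> A"
  shows "(s, s(i := s i + (\<Sum>k\<in>A. cst (c k) * s k))) \<in> row_step\<^sup>*"
proof -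
  have "finite A" by simp
  thus ?thesis using assms
  proof (induction A)
    case (insert x A)
    let ?t = "s(i := s i + (\<Sum>k\<in>A. cst (c k) * s k))"
    have "(?t, row_add (c x) i x ?t) \<in> row_step"
      using insert.prems by (intro row_stepI) auto
    also have "row_add (c x) i x ?t = s(i := s i + (\<Sum>k\<in>insert x A. cst (c k) * s k))"
      using insert by (auto simp: row_add_def add_ac)
    finally show ?case using insert by (auto intro: rtrancl_into_rtrancl)
  qed simp
qed

lemma row_steps_clear:
  fixes s :: "4 \<Rightarrow> 'a::comm_ring_1 poly poly"
  assumes "s i = (\<Sum>k\<in>A. cst (c k) * s k)" "i \<notin> A"
  shows "(s, s(i := 0)) \<in> row_step\<^sup>*"
proof -
  have "s i + (\<Sum>k\<in>A. cst (- c k) * s k) = 0"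
    by (simp add: assms(1) cst_minus sum_negf)
  thus ?thesis using row_steps_add[OF assms(2), of s "\<lambda>k. - c k"] by simp
qed

text \<open>The coefficient of row i in w may differ from 1. Row j, whose coefficient is nonzero,
  first absorbs a multiple of row i that makes up the difference; then w arises in row i by
  additions alone.\<close>

lemma row_steps_put:
  fixes s :: "4 \<Rightarrow> 'a::field poly poly"
  assumes w: "w = (\<Sum>k\<in>UNIV. cst (c k) * s k)" and "c j \<noteq> 0" "j \<noteq> i"
  shows "\<exists>t. (s, t) \<in> row_step\<^sup>* \<and> t i = w \<and> (\<forall>k. k \<noteq> i \<longrightarrow> k \<noteq> j \<longrightarrow> t k = s k)"
proof -
  define s1 where "s1 = row_add ((c i - 1) / c j) j i s"
  define t where "t = s1(i := s1 i + (\<Sum>k\<in>UNIV - {i}. cst (c k) * s1 k))"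
  have "(s, s1) \<in> row_step\<^sup>*" unfolding s1_def using assms row_stepI by blast
  moreover have "(s1, t) \<in> row_step\<^sup>*" unfolding t_def by (rule row_steps_add) simp
  ultimately have "(s, t) \<in> row_step\<^sup>*" by (rule rtrancl_trans)
  moreover have "t i = w"
  proof -
    let ?R = "\<Sum>k\<in>UNIV - {i} - {j}. cst (c k) * s k"
    have j: "j \<in> UNIV - {i}" using assms by simp
    have R: "(\<Sum>k\<in>UNIV - {i} - {j}. cst (c k) * s1 k) = ?R"
      by (rule sum.cong) (auto simp: s1_def row_add_def)
    have s1: "s1 i = s i" "s1 j = s j + cst ((c i - 1) / c j) * s i"
      using assms by (auto simp: s1_def row_add_def)
    have "cst (c j) * cst ((c i - 1) / c j) = cst (c i) - 1"
      using assms(2) by (simp flip: cst_mult cst_diff cst_1)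
    hence e: "cst (c j) * (cst ((c i - 1) / c j) * x) = (cst (c i) - 1) * x" for x
      by (metis mult.assoc)
    have "t i = s1 i + (cst (c j) * s1 j + (\<Sum>k\<in>UNIV - {i} - {j}. cst (c k) * s1 k))"
      by (simp add: t_def sum.remove[OF _ j, of "\<lambda>k. cst (c k) * s1 k"])
    also have "\<dots> = cst (c i) * s i + (cst (c j) * s j + ?R)"
      unfolding R s1 distrib_left e by (simp add: algebra_simps)
    also have "\<dots> = w"
      by (simp add: w sum.remove[of UNIV i] sum.remove[OF _ j, of "\<lambda>k. cst (c k) * s k"])
    finally show ?thesis .
  qed
  moreover have "t k = s k" if "k \<noteq> i" "k \<noteq> j" for k
    using that by (auto simp: t_def s1_def row_add_def)
  ultimately show ?thesis by blast
qed

text \<open>The rows in \<open>J\<close> are already final. Independence forces a nonzero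
  coefficient outside \<open>J\<close>; if the only one belongs to row i itself, the spare row j has
  to be mixed in. This works as long as a row is spare.\<close>

lemma row_steps_extend:
  fixes s :: "4 \<Rightarrow> 'a::field poly poly"
  assumes span: "prod_span UNIV s 1 (w i)" and J: "\<And>k. k \<in> J \<Longrightarrow> s k = w k"
    and i: "i \<notin> J" and j: "j \<noteq> i" "j \<notin> J"
    and indep: "\<And>c. w i \<noteq> (\<Sum>k\<in>J. cst (c k) * w k)"
  shows "\<exists>t. (s, t) \<in> row_step\<^sup>* \<and> (\<forall>k\<in>insert i J. t k = w k)"
proof -
  obtain c where c: "w i = (\<Sum>k\<in>UNIV. cst (c k) * s k)" by (rule prod_span_1E[OF span])
  show ?thesis
  proof (cases "\<exists>l. l \<notin> J \<and> l \<noteq> i \<and> c l \<noteq> 0")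
    case True
    then obtain l where l: "l \<notin> J" "l \<noteq> i" "c l \<noteq> 0" by blast
    from row_steps_put[OF c l(3,2)] obtain t where
      "(s, t) \<in> row_step\<^sup>*" "t i = w i" "\<And>k. k \<noteq> i \<Longrightarrow> k \<noteq> l \<Longrightarrow> t k = s k" by blast
    moreover have "t k = w k" if "k \<in> J" for k
    proof -
      have "k \<noteq> i" "k \<noteq> l" using that i l(1) by auto
      thus ?thesis using calculation(3)[of k] J[OF that] by simp
    qed
    ultimately show ?thesis by (intro exI[of _ t]) auto
  next
    case False
    have sub: "(\<Sum>k\<in>UNIV. cst (c k) * s k) = (\<Sum>k\<in>insert i J. cst (c k) * s k)"
      by (rule sum.mono_neutral_right) (use False in auto)
    have J': "(\<Sum>k\<in>J. cst (c k) * s k) = (\<Sum>k\<in>J. cst (c k) * w k)"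
      using J by (intro sum.cong) auto
    have ci: "c i \<noteq> 0"
    proof
      assume "c i = 0"
      hence "w i = (\<Sum>k\<in>J. cst (c k) * w k)" using c sub i J' by simp
      thus False using indep by blast
    qed
    \<comment> \<open>Row j is added to row i and subtracted again in the combination, which gives
      it the nonzero coefficient \<open>- c i\<close>.\<close>
    define s1 where "s1 = row_add 1 i j s"
    define c1 where "c1 = c(j := - c i)"
    have "(\<Sum>k\<in>UNIV. cst (c1 k) * s1 k) = (\<Sum>k\<in>insert j (insert i J). cst (c1 k) * s1 k)"
      by (rule sum.mono_neutral_right) (use False in \<open>auto simp: c1_def\<close>)
    also have "\<dots> = cst (c1 j) * s1 j + (cst (c1 i) * s1 i + (\<Sum>k\<in>J. cst (c1 k) * s1 k))"
      using i j by simp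
    also have "(\<Sum>k\<in>J. cst (c1 k) * s1 k) = (\<Sum>k\<in>J. cst (c k) * s k)"
      using i j by (intro sum.cong) (auto simp: c1_def s1_def row_add_def)
    also have "cst (c1 j) * s1 j + (cst (c1 i) * s1 i + (\<Sum>k\<in>J. cst (c k) * s k)) =
      cst (c i) * s i + (\<Sum>k\<in>J. cst (c k) * s k)"
      using j(1) by (simp add: c1_def s1_def row_add_def cst_minus algebra_simps)
    also have "\<dots> = w i" using c sub i by simp
    finally have w: "w i = (\<Sum>k\<in>UNIV. cst (c1 k) * s1 k)" ..
    have "c1 j \<noteq> 0" using ci by (simp add: c1_def)
    from row_steps_put[OF w this j(1)] obtain t where
      t: "(s1, t) \<in> row_step\<^sup>*" "t i = w i" "\<And>k. k \<noteq> i \<Longrightarrow> k \<noteq> j \<Longrightarrow> t k = s1 k" by blast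
    have "(s, s1) \<in> row_step" unfolding s1_def by (rule row_stepI) (use j in blast)
    from converse_rtrancl_into_rtrancl[OF this t(1)] have "(s, t) \<in> row_step\<^sup>*" .
    moreover have "t k = w k" if "k \<in> J" for k
    proof -
      have "k \<noteq> i" "k \<noteq> j" using that i j by auto
      thus ?thesis using t(3)[of k] J[OF that] by (simp add: s1_def row_add_def)
    qed
    ultimately show ?thesis using t(2) by (intro exI[of _ t]) auto
  qed
qed

lemma UNIV_4: "(UNIV :: 4 set) = {0, 1, 2, 3}"
proof -
  have "x \<in> {0, 1, 2, 3}" for x :: 4
  proof (induct x)
    case (of_int z)
    hence "z = 0 \<or> z = 1 \<or> z = 2 \<or> z = 3" by simp arith
    thus ?case by auto
  qed
  thus ?thesis by blast
qed

text \<open>Three rows can be brought to w in turn. No spare row remains for the fourth, which is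
  reached only up to a scalar: transvections preserve the determinant, and the scalar records
  it.\<close>

lemma row_steps_basis:
  fixes s :: "4 \<Rightarrow> 'a::field poly poly"
  assumes span: "\<And>i. prod_span UNIV s 1 (w i)"
    and indep: "\<And>c. (\<Sum>k\<in>UNIV. cst (c k) * w k) = 0 \<Longrightarrow> \<forall>k. c k = 0"
  shows "\<exists>a. a \<noteq> 0 \<and> (s, w(3 := cst a * w 3)) \<in> row_step\<^sup>*"
proof -
  have ind: "w i \<noteq> (\<Sum>k\<in>J. cst (c k) * w k)" if "i \<notin> J" for i J c
  proof
    assume *: "w i = (\<Sum>k\<in>J. cst (c k) * w k)"
    define e where "e = (\<lambda>k. if k = i then -1 else if k \<in> J then c k else 0)"
    have "(\<Sum>k\<in>UNIV. cst (e k) * w k) = (\<Sum>k\<in>insert i J. cst (e k) * w k)"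
      by (rule sum.mono_neutral_right) (auto simp: e_def)
    also have "\<dots> = cst (e i) * w i + (\<Sum>k\<in>J. cst (e k) * w k)" using that by simp
    also have "(\<Sum>k\<in>J. cst (e k) * w k) = (\<Sum>k\<in>J. cst (c k) * w k)"
      using that by (intro sum.cong) (auto simp: e_def)
    also have "cst (e i) * w i + \<dots> = 0" using * by (simp add: e_def cst_minus)
    finally have "\<forall>k. e k = 0" by (rule indep)
    hence "e i = 0" by blast
    thus False by (simp add: e_def)
  qed

  obtain s0 where s0: "(s, s0) \<in> row_step\<^sup>*" "\<forall>k\<in>insert 0 {}. s0 k = w k"
  proof -
    have "\<exists>t. (s, t) \<in> row_step\<^sup>* \<and> (\<forall>k\<in>insert 0 {}. t k = w k)"
      by (rule row_steps_extend[where j = 1, OF span _ _ _ _ ind]) simp_all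
    thus ?thesis using that by blast
  qed
  obtain s1 where s1: "(s0, s1) \<in> row_step\<^sup>*" "\<forall>k\<in>insert 1 {0}. s1 k = w k"
  proof -
    have "\<exists>t. (s0, t) \<in> row_step\<^sup>* \<and> (\<forall>k\<in>insert 1 {0}. t k = w k)"
      by (rule row_steps_extend[where j = 2, OF row_steps_span[OF s0(1) span] _ _ _ _ ind])
         (use s0(2) in simp_all)
    thus ?thesis using that by blast
  qed
  obtain s2 where s2: "(s1, s2) \<in> row_step\<^sup>*" "\<forall>k\<in>insert 2 {0, 1}. s2 k = w k"
  proof -
    have "\<exists>t. (s1, t) \<in> row_step\<^sup>* \<and> (\<forall>k\<in>insert 2 {0, 1}. t k = w k)"
      by (rule row_steps_extend[where j = 3,
            OF row_steps_span[OF s1(1) row_steps_span[OF s0(1) span]] _ _ _ _ ind])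
         (use s1(2) in auto)
    thus ?thesis using that by blast
  qed
  have s: "(s, s2) \<in> row_step\<^sup>*" by (rule rtrancl_trans[OF s0(1) rtrancl_trans[OF s1(1) s2(1)]])
  obtain c where c: "w 3 = (\<Sum>k\<in>UNIV. cst (c k) * s2 k)"
    by (rule prod_span_1E[OF row_steps_span[OF s span[of 3]]])
  have UN: "UNIV - {3::4} = {0, 1, 2}" unfolding UNIV_4 by (simp add: insert_Diff_if)
  have c': "w 3 = cst (c 3) * s2 3 + (\<Sum>k\<in>{0, 1, 2}. cst (c k) * w k)"
  proof -
    have "(\<Sum>k\<in>UNIV. cst (c k) * s2 k) = cst (c 3) * s2 3 + (\<Sum>k\<in>UNIV - {3}. cst (c k) * s2 k)"
      by (rule sum.remove) simp_all
    also have "(\<Sum>k\<in>UNIV - {3}. cst (c k) * s2 k) = (\<Sum>k\<in>{0, 1, 2}. cst (c k) * w k)"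
      unfolding UN by (rule sum.cong) (use s2(2) in auto)
    finally show ?thesis using c by simp
  qed
  have c3: "c 3 \<noteq> 0"
  proof
    assume "c 3 = 0"
    hence "w 3 = (\<Sum>k\<in>{0, 1, 2}. cst (c k) * w k)" using c' by simp
    thus False using ind[of 3 "{0, 1, 2}" c] by simp
  qed
  have cc: "cst a * (cst b * x) = cst (a * b) * x" for a b :: 'a and x
    by (simp add: cst_mult mult.assoc)
  have i3: "cst (1 / c 3) * (cst (c 3) * x) = x" for x
    using c3 by (simp add: cc)
  have "s2 3 + (\<Sum>k\<in>{0,1,2}. cst (c k / c 3) * s2 k) = cst (1 / c 3) * w 3"
    using c3 s2(2) by (simp add: c' distrib_left cc)
  moreover have "s2(3 := x) = w(3 := x)" for x
  proof
    fix k :: 4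
    have "k \<in> {0, 1, 2, 3}" using UNIV_4 by blast
    thus "(s2(3 := x)) k = (w(3 := x)) k" using s2(2) by auto
  qed
  moreover have "(s2, s2(3 := s2 3 + (\<Sum>k\<in>{0,1,2}. cst (c k / c 3) * s2 k))) \<in> row_step\<^sup>*"
    by (rule row_steps_add) auto
  ultimately have "(s2, w(3 := cst (1 / c 3) * w 3)) \<in> row_step\<^sup>*" by simp
  hence "(s, w(3 := cst (1 / c 3) * w 3)) \<in> row_step\<^sup>*" using s by (rule rtrancl_trans[rotated])
  thus ?thesis using c3 by (intro exI[of _ "1 / c 3"]) auto
qed

section \<open>Nodes and cusps obstruct embeddings\<close>

text \<open>The substitution u = A, v = B after extension of the coefficients. Values are
  polynomials rather than scalars so that forms can be restricted to a subscheme of length two by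
  reducing modulo a quadratic polynomial.\<close>

definition eval_form ::
    "('f::comm_ring_1 \<Rightarrow> 'l::comm_ring_1) \<Rightarrow> 'l poly \<Rightarrow> 'l poly \<Rightarrow> 'f poly poly \<Rightarrow> 'l poly" where
  "eval_form h A B p = poly (map_poly (\<lambda>c. poly (map_poly (\<lambda>a. [:h a:]) c) A) p) B"

lemma comm_ring_hom_poly_map:
  assumes "comm_ring_hom (h :: 'f::comm_ring_1 \<Rightarrow> 'l::comm_ring_1)"
  shows "comm_ring_hom (\<lambda>c. poly (map_poly h c) A)"
proof -
  interpret h: comm_ring_hom h by fact
  interpret hp: map_poly_comm_ring_hom h ..
  show ?thesis by unfold_locales (simp_all add: hp.hom_add hp.hom_mult)
qed

lemma comm_ring_hom_eval_form:
  assumes "comm_ring_hom h"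
  shows "comm_ring_hom (eval_form h A B)"
proof -
  interpret h: comm_ring_hom h by fact
  have "comm_ring_hom (\<lambda>a. [:h a:])"
    by unfold_locales (simp_all add: one_pCons h.hom_add h.hom_mult)
  hence "comm_ring_hom (\<lambda>c. poly (map_poly (\<lambda>a. [:h a:]) c) A)"
    by (rule comm_ring_hom_poly_map)
  hence "comm_ring_hom (\<lambda>p. poly (map_poly (\<lambda>c. poly (map_poly (\<lambda>a. [:h a:]) c) A) p) B)"
    by (rule comm_ring_hom_poly_map)
  thus ?thesis unfolding eval_form_def[abs_def] .
qed

lemma eval_form_cst:
  assumes "comm_ring_hom h"
  shows "eval_form h A B (cst a) = [:h a:]"
proof -
  interpret h: comm_ring_hom h by fact
  show ?thesis by (simp add: eval_form_def cst_def Polynomial.map_poly_pCons)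
qed

lemma eval_form_fmono:
  assumes "comm_ring_hom h"
  shows "eval_form h A B (fmono i j) = A ^ i * B ^ j"
proof -
  interpret h: comm_ring_hom h by fact
  show ?thesis by (simp add: eval_form_def fmono_def map_poly_monom poly_monom one_pCons[symmetric])
qed

lemma eval_form_forms:
  assumes "comm_ring_hom h" "f \<in> forms R d"
  shows "eval_form h A B f = (\<Sum>j\<le>d. [:h (form_coeff d f j):] * (A ^ (d - j) * B ^ j))"
proof -
  interpret e: comm_ring_hom "eval_form h A B" by (rule comm_ring_hom_eval_form) fact
  have "eval_form h A B (form_of d (form_coeff d f)) =
      (\<Sum>j\<le>d. [:h (form_coeff d f j):] * (A ^ (d - j) * B ^ j))"
    unfolding form_of_def e.hom_sum e.hom_mult eval_form_cst[OF assms(1)] eval_form_fmono[OF assms(1)] ..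
  thus ?thesis using form_of_coeff[OF assms(2)] by simp
qed

text \<open>
  If all sections are proportional modulo \<open>Q\<close>, then so are all elements of the chart rings, which
  is impossible because \<open>1\<close> and \<open>X\<close> are not.
\<close>
lemma closed_embedding_not_proportional:
  fixes s :: "4 \<Rightarrow> 'f::field poly poly" and e :: "'f poly poly \<Rightarrow> 'l::field_gcd poly"
  assumes emb: "closed_embedding F d s" and F: "semiring_set F"
    and hom: "comm_ring_hom e" and e_cst: "\<And>a. \<exists>b. e (cst a) = [:b:]"
    and e_fmono: "\<And>i j. e (fmono i j) = A ^ i * B ^ j"
    and Q: "degree Q = 2" and propor: "\<And>j. \<exists>c. Q dvd e (s j) - smult c E"
    and one: "smult a0 A + smult b0 B = 1" and X: "smult a1 A + smult b1 B = [:0, 1:]"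
  shows False
proof -
  interpret e: comm_ring_hom e by (rule hom)
  have d: "d > 0" and gen: "generating_sections F d s"
    using emb by (auto simp: closed_embedding_def)
  obtain N where N: "forms F N \<subseteq> {\<Sum>i\<in>UNIV. c i * s i | c. range c \<subseteq> bivariate F}"
    using gen by (auto simp: generating_sections_def)
  have AB: "coprime A B"
  proof (rule coprimeI)
    fix c assume "c dvd A" "c dvd B"
    hence "c dvd smult a0 A + smult b0 B" by (intro dvd_add dvd_smult)
    thus "c dvd 1" using one by simp
  qed
  \<comment> \<open>The sections generate all forms of degree \<open>N\<close>, in particular u^N
    and v^N, whose values A^N and B^N are coprime: no common zero appears after the
    substitution.\<close>
  have unit: "c dvd 1" if c: "\<And>j. c dvd e (s j)" for c
  proof -
    have cf: "c dvd e f" if f: "f \<in> forms F N" for f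
    proof -
      obtain g where "f = (\<Sum>i\<in>UNIV. g i * s i)" using N f by blast
      thus ?thesis using c by (auto simp: e.hom_sum e.hom_mult intro!: dvd_sum)
    qed
    have "c dvd e (fmono N 0)" "c dvd e (fmono 0 N)"
      using cf[of "fmono N 0"] cf[of "fmono 0 N"] forms_fmono'[OF F, of N 0 N] forms_fmono'[OF F, of 0 N N]
      by simp_all
    hence "c dvd A ^ N" "c dvd B ^ N" by (simp_all add: e_fmono)
    moreover have "coprime (A ^ N) (B ^ N)" using AB by simp
    ultimately show ?thesis using coprime_common_divisor by blast
  qed
  have nQ: "\<not> Q dvd 1" using Q by (auto simp: is_unit_iff_degree)
  obtain c where c: "\<And>j. Q dvd e (s j) - smult (c j) E" using propor by metis
  have copE: "coprime Q E"
  proof (rule coprimeI)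
    fix g assume g: "g dvd Q" "g dvd E"
    have "g dvd e (s j)" for j
      using dvd_add[OF dvd_trans[OF g(1) c[of j]] dvd_smult[OF g(2), of "c j"]] by simp
    thus "g dvd 1" by (rule unit)
  qed
  have "\<exists>i. c i \<noteq> 0"
  proof (rule ccontr)
    assume "\<nexists>i. c i \<noteq> 0"
    hence "Q dvd e (s j)" for j using c[of j] by simp
    thus False using unit nQ by blast
  qed
  then obtain i where ci: "c i \<noteq> 0" by blast
  define f where "f = s i"
  define g where "g = e f"
  have Qg: "Q dvd g - smult (c i) E" using c[of i] by (simp add: g_def f_def)
  have cop: "coprime Q g"
  proof (rule coprimeI)
    fix p assume p: "p dvd Q" "p dvd g"
    have "p dvd smult (c i) E"
      using dvd_diff[OF p(2) dvd_trans[OF p(1) Qg]] by simp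
    hence "p dvd E" using ci by (simp add: dvd_smult_iff)
    thus "p dvd 1" using copE p(1) coprime_common_divisor by blast
  qed
  have f0: "f \<noteq> 0"
  proof
    assume "f = 0"
    hence "coprime Q 0" using cop by (simp add: g_def)
    thus False using nQ by simp
  qed
  \<comment> \<open>Fractions that are constant on the subscheme Q = 0, which makes sense because g
    is prime to Q. They form a ring, and it contains the generators since the sections are
    proportional there.\<close>
  define G where "G = {Fract p (f ^ n) | p n. \<exists>a. Q dvd e p - smult a (g ^ n)}"
  have GI: "Fract p (f ^ n) \<in> G" if "Q dvd e p - smult a (g ^ n)" for p n a
    using that by (auto simp: G_def)
  let ?H = "(\<lambda>a. Fract [:[:a:]:] 1) ` F \<union> range (\<lambda>j. Fract (s j) (s i))"
  have sub: "generate_ring ring_of_type_algebra ?H \<subseteq> G"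
  proof
    fix x assume "x \<in> generate_ring ring_of_type_algebra ?H"
    thus "x \<in> G"
    proof (induction rule: generate_ring.induct)
      case one
      show ?case using GI[of 1 1 0] by (simp add: ring_of_type_algebra_def One_fract_def pCons_one)
    next
      case (incl x)
      then consider a where "x = Fract (cst a) 1" | j where "x = Fract (s j) f"
        by (auto simp: cst_def f_def)
      thus ?case
      proof cases
        case 1
        obtain b where "e (cst a) = [:b:]" using e_cst by blast
        thus ?thesis using GI[of "cst a" b 0] 1 by (simp add: smult_one)
      next
        case 2
        have "e (s j) - smult (c j / c i) g =
          (e (s j) - smult (c j) E) - smult (c j / c i) (g - smult (c i) E)"
          using ci by (simp add: smult_diff_right)
        hence "Q dvd e (s j) - smult (c j / c i) g"
          using dvd_diff[OF c[of j] dvd_smult[OF Qg, of "c j / c i"]] by (simp only:)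
        thus ?thesis using GI[of "s j" _ 1] 2 by simp
      qed
    next
      case (a_inv x)
      then obtain p n a where x: "x = Fract p (f ^ n)" "Q dvd e p - smult a (g ^ n)"
        by (auto simp: G_def)
      have "Q dvd e (- p) - smult (- a) (g ^ n)"
        using x(2) by (simp add: e.hom_uminus dvd_diff_commute)
      moreover have "\<ominus>\<^bsub>ring_of_type_algebra\<^esub> x = - x"
      proof -
        interpret R: cring "ring_of_type_algebra :: 'f poly poly fract ring" by (rule cring_from_type_algebra)
        have "x \<oplus>\<^bsub>ring_of_type_algebra\<^esub> (- x) = \<zero>\<^bsub>ring_of_type_algebra\<^esub>"
          by (simp add: ring_of_type_algebra_def)
        thus ?thesis
          using R.minus_equality[of "- x" x] by (simp add: ring_of_type_algebra_def)
      qed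
      ultimately show ?case using GI[of "- p" "- a" n] x(1) by simp
    next
      case (eng_add x y)
      then obtain p n a q m b where x: "x = Fract p (f ^ n)" "Q dvd e p - smult a (g ^ n)"
        and y: "y = Fract q (f ^ m)" "Q dvd e q - smult b (g ^ m)"
        by (auto simp: G_def)
      have "e (p * f ^ m + q * f ^ n) - smult (a + b) (g ^ (n + m)) =
        (e p - smult a (g ^ n)) * g ^ m + (e q - smult b (g ^ m)) * g ^ n"
        by (simp add: e.hom_add e.hom_mult e.hom_power g_def[symmetric] power_add smult_add_left
            algebra_simps)
      hence "Q dvd e (p * f ^ m + q * f ^ n) - smult (a + b) (g ^ (n + m))"
        using x y by simp
      from GI[OF this] show ?case
        using f0 x y by (simp add: ring_of_type_algebra_def power_add)
    next
      case (eng_mult x y)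
      then obtain p n a q m b where x: "x = Fract p (f ^ n)" "Q dvd e p - smult a (g ^ n)"
        and y: "y = Fract q (f ^ m)" "Q dvd e q - smult b (g ^ m)"
        by (auto simp: G_def)
      have "e (p * q) - smult (a * b) (g ^ (n + m)) =
        (e p - smult a (g ^ n)) * e q + smult a (g ^ n) * (e q - smult b (g ^ m))"
        by (simp add: e.hom_mult power_add algebra_simps)
      moreover have "Q dvd \<dots>" using x y by (intro dvd_add dvd_mult dvd_mult2) auto
      ultimately have "Q dvd e (p * q) - smult (a * b) (g ^ (n + m))" by (simp only:)
      from GI[OF this] show ?case
        using f0 x y by (simp add: ring_of_type_algebra_def power_add)
    qed
  qed
  have chart: "chart_ring F d f \<subseteq> generate_ring ring_of_type_algebra ?H"
    using emb f0 by (auto simp: closed_embedding_def f_def)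
  \<comment> \<open>Polynomials that agree on Q = 0 with a constant multiple of g. A monomial of
    degree \<open>d\<close> divided by f lies in the chart ring, hence in \<open>G\<close>, so the
    monomials of degree \<open>d\<close> belong here.\<close>
  define M where "M = {p. \<exists>c. Q dvd p - smult c g}"
  have M_mono: "A ^ k * B ^ l \<in> M" if "k + l = d" for k l
  proof -
    have "Fract (fmono k l) (f ^ 1) \<in> chart_ring F d f"
      using forms_fmono'[OF F that] unfolding chart_ring_def by fastforce
    hence "Fract (fmono k l) f \<in> G" using chart sub by auto
    then obtain p n a where p: "Fract (fmono k l) f = Fract p (f ^ n)" "Q dvd e p - smult a (g ^ n)"
      by (auto simp: G_def)
    have "fmono k l * f ^ n = p * f" using p(1) f0 by (simp add: eq_fract)
    hence "e (fmono k l) * g ^ n = e p * g"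
      by (metis e.hom_mult e.hom_power g_def)
    hence "g ^ n * (e (fmono k l) - smult a g) = (e p - smult a (g ^ n)) * g"
      by (simp add: algebra_simps)
    hence "Q dvd g ^ n * (e (fmono k l) - smult a g)" using p(2) by simp
    hence "Q dvd e (fmono k l) - smult a g"
      using cop by (simp add: coprime_dvd_mult_right_iff)
    thus ?thesis by (auto simp: M_def e_fmono)
  qed
  have M_add: "p + q \<in> M" if pq: "p \<in> M" "q \<in> M" for p q
  proof -
    obtain a b where "Q dvd p - smult a g" "Q dvd q - smult b g" using pq by (auto simp: M_def)
    from dvd_add[OF this] have "Q dvd (p + q) - smult (a + b) g"
      by (simp add: smult_add_left algebra_simps)
    thus ?thesis by (auto simp: M_def)
  qed
  have M_smult: "smult b p \<in> M" if p: "p \<in> M" for p b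
  proof -
    obtain a where "Q dvd p - smult a g" using p by (auto simp: M_def)
    from dvd_smult[OF this, of b] have "Q dvd smult b p - smult (b * a) g"
      by (simp add: smult_diff_right)
    thus ?thesis by (auto simp: M_def)
  qed
  \<comment> \<open>Because of \<open>one\<close>, a monomial is a combination of monomials of one
    degree more; \<open>n\<close> is the degree still missing to \<open>d\<close>.\<close>
  have M: "A ^ k * B ^ l \<in> M" if "k + l + n = d" for k l n
    using that
  proof (induction n arbitrary: k l)
    case 0
    thus ?case using M_mono by simp
  next
    case (Suc n)
    have "smult a0 (A ^ Suc k * B ^ l) + smult b0 (A ^ k * B ^ Suc l) \<in> M"
      using Suc.prems by (intro M_add M_smult Suc.IH) auto
    moreover have "smult a0 (A ^ Suc k * B ^ l) + smult b0 (A ^ k * B ^ Suc l) =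
        A ^ k * B ^ l * (smult a0 A + smult b0 B)"
      by (simp add: algebra_simps)
    ultimately show ?case using one by simp
  qed
  have "A ^ 0 * B ^ 0 \<in> M" by (rule M[of 0 0 d]) simp
  then obtain c0 where c0: "Q dvd 1 - smult c0 g" by (auto simp: M_def)
  have "A ^ 1 * B ^ 0 \<in> M" "A ^ 0 * B ^ 1 \<in> M"
    using d by (intro M[of _ _ "d - 1"]; simp)+
  hence "smult a1 A + smult b1 B \<in> M" by (intro M_add M_smult) auto
  then obtain c1 where c1: "Q dvd [:0, 1:] - smult c1 g" using X by (auto simp: M_def)
  \<comment> \<open>Elimination of g leaves a polynomial of degree at most 1 that is divisible by Q,
    hence zero.\<close>
  have "Q dvd smult c0 ([:0, 1:] - smult c1 g) - smult c1 (1 - smult c0 g)"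
    by (intro dvd_diff dvd_smult c0 c1)
  also have "smult c0 ([:0, 1:] - smult c1 g) - smult c1 (1 - smult c0 g) = [:- c1, c0:]"
    by (simp add: smult_diff_right one_pCons mult.commute)
  finally have "[:- c1, c0:] = 0"
    using Q by (intro ccontr[of "[:- c1, c0:] = 0"]) (auto dest!: dvd_imp_degree_le split: if_splits)
  hence "c0 = 0" by simp
  thus False using c0 nQ by simp
qed

text \<open>The recurrence says that the functional sending X^j to x_j kills the multiples of
  \<open>Q\<close>, so it can be computed from the residue a + b X of X^j. Residue and value are
  tracked with the same a and b.\<close>

lemma X_power_mod_quadratic:
  fixes x :: "nat \<Rightarrow> 'l::field" and q0 q1 q2 :: 'l
  defines "Q \<equiv> [:q0, q1, q2:]"
  assumes rec: "\<And>i. i + 2 \<le> d \<Longrightarrow> q0 * x i + q1 * x (i + 1) + q2 * x (i + 2) = 0" and q2: "q2 \<noteq> 0"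
  shows "j \<le> d \<Longrightarrow> \<exists>a b. Q dvd [:0, 1:] ^ j - [:a, b:] \<and> x j = a * x 0 + b * x 1"
proof (induction j rule: less_induct)
  case (less j)
  consider "j = 0" | "j = 1" | i where "j = i + 2"
  proof -
    have "j = 0 \<or> j = 1 \<or> j = (j - 2) + 2" by arith
    thus ?thesis using that by blast
  qed
  thus ?case
  proof cases
    case 1
    thus ?thesis by (intro exI[of _ 1] exI[of _ 0]) (simp add: pCons_one)
  next
    case 2
    thus ?thesis by (intro exI[of _ 0] exI[of _ 1]) simp
  next
    case (3 i)
    obtain a b where ab: "Q dvd [:0, 1:] ^ i - [:a, b:]" "x i = a * x 0 + b * x 1"
      using less.IH[of i] less.prems 3 by auto
    obtain a' b' where ab': "Q dvd [:0, 1:] ^ (i + 1) - [:a', b':]" "x (i + 1) = a' * x 0 + b' * x 1"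
      using less.IH[of "i + 1"] less.prems 3 by auto
    define A where "A = - (q0 * a + q1 * a') / q2"
    define B where "B = - (q0 * b + q1 * b') / q2"
    have "x j = - (q0 * x i + q1 * x (i + 1)) / q2"
      using rec[of i] less.prems 3 q2 by (simp add: field_simps eq_neg_iff_add_eq_0)
    hence "q2 * x j = - (q0 * (a * x 0 + b * x 1) + q1 * (a' * x 0 + b' * x 1))"
      unfolding ab(2) ab'(2) using q2 by simp
    also have "\<dots> = (q2 * A) * x 0 + (q2 * B) * x 1"
    proof -
      have AB: "q2 * A = - (q0 * a + q1 * a')" "q2 * B = - (q0 * b + q1 * b')"
        using q2 by (simp_all add: A_def B_def)
      show ?thesis unfolding AB by (simp add: algebra_simps)
    qed
    also have "\<dots> = q2 * (A * x 0 + B * x 1)" by (simp add: algebra_simps)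
    finally have "x j = A * x 0 + B * x 1" using q2 by simp
    moreover have "Q dvd [:0, 1:] ^ j - [:A, B:]"
    proof -
      have X2: "[:0, 1:] ^ j = [:0, 1:] ^ i * [:0, 1::'l:] ^ 2"
        unfolding 3 by (rule power_add)
      have "smult q2 ([:0, 1:] ^ j - [:A, B:]) =
        Q * [:0, 1:] ^ i - smult q0 ([:0, 1:] ^ i - [:a, b:]) - smult q1 ([:0, 1:] ^ (i + 1) - [:a', b':])"
      proof -
        have Qe: "Q = [:q0:] + smult q1 [:0, 1:] + smult q2 ([:0, 1:] ^ 2)"
          by (simp add: Q_def power2_eq_square)
        have AB: "smult q2 [:A, B:] = - smult q0 [:a, b:] - smult q1 [:a', b':]"
          using q2 by (simp add: A_def B_def field_simps)
        have "[:q0:] * p = smult q0 p" for p by simp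
        thus ?thesis
          unfolding smult_diff_right AB Qe X2 by (simp add: algebra_simps)
      qed
      also have "Q dvd \<dots>" by (intro dvd_diff dvd_smult ab ab' dvd_triv_left)
      finally show ?thesis using q2 by (simp add: dvd_smult_iff)
    qed
    ultimately show ?thesis by blast
  qed
qed

text \<open>The functional factors through the two-dimensional space of residues, where it sends a +
  b X to a x_0 + b x_1. As it is nonzero, its kernel there is the line spanned by x_1 - x_0
  X.\<close>

lemma functional_kernel_mod_quadratic:
  fixes x f :: "nat \<Rightarrow> 'l::field"
  assumes rec: "\<And>i. i + 2 \<le> d \<Longrightarrow> q0 * x i + q1 * x (i + 1) + q2 * x (i + 2) = 0"
    and q2: "q2 \<noteq> 0" and x: "\<exists>j\<le>d. x j \<noteq> 0" and f: "(\<Sum>j\<le>d. f j * x j) = 0" and d: "2 \<le> d"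
  shows "\<exists>c. [:q0, q1, q2:] dvd (\<Sum>j\<le>d. [:f j:] * [:0, 1:] ^ j) - smult c [:x 1, - x 0:]"
proof -
  let ?Q = "[:q0, q1, q2:]"
  have "\<forall>j. \<exists>a b. j \<le> d \<longrightarrow> ?Q dvd [:0, 1:] ^ j - [:a, b:] \<and> x j = a * x 0 + b * x 1"
    using X_power_mod_quadratic[OF rec q2] by blast
  then obtain a b where ab: "\<And>j. j \<le> d \<Longrightarrow> ?Q dvd [:0, 1:] ^ j - [:a j, b j:]"
    "\<And>j. j \<le> d \<Longrightarrow> x j = a j * x 0 + b j * x 1"
    by metis
  define a' where "a' = (\<Sum>j\<le>d. f j * a j)"
  define b' where "b' = (\<Sum>j\<le>d. f j * b j)"
  have "(\<Sum>j\<le>d. f j * x j) = (\<Sum>j\<le>d. f j * (a j * x 0 + b j * x 1))"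
    by (rule sum.cong[OF refl], subst ab(2)) auto
  also have "\<dots> = a' * x 0 + b' * x 1"
    unfolding a'_def b'_def sum_distrib_right sum.distrib[symmetric]
    by (rule sum.cong) (simp_all add: algebra_simps)
  finally have 0: "a' * x 0 + b' * x 1 = 0" using f by simp
  have s: "[:\<Sum>j\<in>A. u j, \<Sum>j\<in>A. v j:] = (\<Sum>j\<in>A. [:u j, v j:])" for A :: "nat set" and u v :: "nat \<Rightarrow> 'l"
  proof (induction A rule: infinite_finite_induct)
    case (insert j A)
    show ?case unfolding sum.insert[OF insert.hyps] insert.IH[symmetric] by simp
  qed auto
  have "(\<Sum>j\<le>d. [:f j:] * [:0, 1:] ^ j) - [:a', b':] = (\<Sum>j\<le>d. [:f j:] * ([:0, 1:] ^ j - [:a j, b j:]))"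
    unfolding a'_def b'_def s sum_subtractf[symmetric]
    by (rule sum.cong) (simp_all add: algebra_simps)
  also have "?Q dvd \<dots>" by (intro dvd_sum dvd_mult ab(1)) simp
  finally have Q: "?Q dvd (\<Sum>j\<le>d. [:f j:] * [:0, 1:] ^ j) - [:a', b':]" .
  have "x 0 \<noteq> 0 \<or> x 1 \<noteq> 0"
  proof (rule ccontr)
    assume "\<not> (x 0 \<noteq> 0 \<or> x 1 \<noteq> 0)"
    hence "x j = 0" if "j \<le> d" for j using ab(2)[OF that] by simp
    thus False using x by blast
  qed
  hence "\<exists>c. [:a', b':] = smult c [:x 1, - x 0:]"
  proof (cases "x 0 = 0")
    case True
    thus ?thesis using 0 \<open>x 0 \<noteq> 0 \<or> x 1 \<noteq> 0\<close>
      by (intro exI[of _ "a' / x 1"]) simp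
  next
    case False
    have "a' = - (b' * x 1) / x 0" using 0 False by (simp add: field_simps eq_neg_iff_add_eq_0)
    thus ?thesis using False by (intro exI[of _ "- b' / x 0"]) simp
  qed
  then obtain c where "[:a', b':] = smult c [:x 1, - x 0:]" by blast
  thus ?thesis using Q by (intro exI[of _ c]) (simp only:)
qed

text \<open>The quadric q0 u^2 + q1 u v + q2 v^2 annihilates the functional, so modulo the quadric
  the sections lie in a line. The cases choose an affine coordinate in which the whole zero scheme
  of the quadric is visible: v/u, u/v, or a mixed one if the zeros are u = 0 and v = 0.\<close>

lemma closed_embedding_functional_rank:
  fixes s :: "4 \<Rightarrow> 'f::field poly poly" and h :: "'f \<Rightarrow> 'l::field_gcd" and x :: "nat \<Rightarrow> 'l"
  assumes emb: "closed_embedding F d s" and F: "semiring_set F" and h: "comm_ring_hom h"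
    and d: "2 \<le> d" and x: "\<exists>j\<le>d. x j \<noteq> 0"
    and van: "\<And>i. (\<Sum>j\<le>d. h (form_coeff d (s i) j) * x j) = 0"
    and q: "(q0, q1, q2) \<noteq> (0, 0, 0)"
    and rec: "\<And>i. i + 2 \<le> d \<Longrightarrow> q0 * x i + q1 * x (i + 1) + q2 * x (i + 2) = 0"
  shows False
proof -
  have s: "s i \<in> forms F d" for i
    using emb by (auto simp: closed_embedding_def generating_sections_def)
  note np = closed_embedding_not_proportional[OF emb F comm_ring_hom_eval_form[OF h] _
      eval_form_fmono[OF h]]
  have ec: "\<exists>b. eval_form h A B (cst a) = [:b:]" for A B a
    using eval_form_cst[OF h] by blast
  consider "q2 \<noteq> 0" | "q2 = 0" "q0 \<noteq> 0" | "q2 = 0" "q0 = 0" "q1 \<noteq> 0" using q by auto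
  thus False
  proof cases
    case 1
    have "\<exists>c. [:q0, q1, q2:] dvd eval_form h 1 [:0, 1:] (s i) - smult c [:x 1, - x 0:]" for i
      using functional_kernel_mod_quadratic[OF rec 1 x van[of i] d]
      by (simp add: eval_form_forms[OF h s])
    from np[OF ec _ this, of 1 0 0 1] show False using 1 by simp
  next
    case 2
    \<comment> \<open>Reversing the order of the coefficients exchanges u and v and reduces to a
      quadric whose leading coefficient is nonzero.\<close>
    define y where "y j = x (d - j)" for j
    have rev: "(\<Sum>j\<le>d. g (d - j)) = (\<Sum>j\<le>d. g j)" for g :: "nat \<Rightarrow> 'l"
      by (rule sum.reindex_bij_witness[of _ "\<lambda>j. d - j" "\<lambda>j. d - j"]) auto
    have revp: "(\<Sum>j\<le>d. g (d - j)) = (\<Sum>j\<le>d. g j)" for g :: "nat \<Rightarrow> 'l poly"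
      by (rule sum.reindex_bij_witness[of _ "\<lambda>j. d - j" "\<lambda>j. d - j"]) auto
    have rec': "q2 * y i + q1 * y (i + 1) + q0 * y (i + 2) = 0" if "i + 2 \<le> d" for i
    proof -
      define e where "e = d - (i + 2)"
      have e: "d = e + (i + 2)" using that by (simp add: e_def)
      have "d - i = e + 2" "d - (i + 1) = e + 1" "d - (i + 2) = e" using e by simp_all
      thus ?thesis using rec[of e] e by (simp add: y_def algebra_simps)
    qed
    have y: "\<exists>j\<le>d. y j \<noteq> 0"
    proof -
      obtain j where "j \<le> d" "x j \<noteq> 0" using x by blast
      thus ?thesis by (intro exI[of _ "d - j"]) (simp add: y_def)
    qed
    have "\<exists>c. [:q2, q1, q0:] dvd eval_form h [:0, 1:] 1 (s i) - smult c [:y 1, - y 0:]" for i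
    proof -
      have "(\<Sum>j\<le>d. h (form_coeff d (s i) (d - j)) * y j) = 0"
        using rev[of "\<lambda>j. h (form_coeff d (s i) j) * x j"] van[of i] by (simp add: y_def)
      from functional_kernel_mod_quadratic[OF rec' 2(2) y this d]
      show ?thesis
        using revp[of "\<lambda>j. [:h (form_coeff d (s i) j):] * [:0, 1:] ^ (d - j)"]
        by (simp add: eval_form_forms[OF h s])
    qed
    from np[OF ec _ this, of 0 1 1 0] show False using 2 by simp
  next
    case 3
    have x0: "x j = 0" if "0 < j" "j < d" for j
    proof -
      have "q1 * x (j - 1 + 1) = 0" using rec[of "j - 1"] 3 that by simp
      thus ?thesis using 3 that by simp
    qed
    \<comment> \<open>The quadric is u v up to a scalar, and neither u = 1 nor v = 1 sees both of
      its zeros. On the line u + v = 1 with u = X they lie at X = 0 and X = 1.\<close>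
    define Xp :: "'l poly" where "Xp = [:0, 1:]"
    define Y :: "'l poly" where "Y = [:1, -1:]"
    define Q :: "'l poly" where "Q = [:0, 1, -1:]"
    have Q: "Q = Xp * Y" by (simp add: Q_def Xp_def Y_def)
    \<comment> \<open>X and 1 - X are idempotent modulo Q = X (1 - X), so powers collapse and mixed
      monomials vanish.\<close>
    have pw: "Q dvd Z ^ Suc n - Z" if "Z = Xp \<or> Z = Y" for Z :: "'l poly" and n
    proof (induction n)
      case (Suc n)
      have "Z ^ Suc (Suc n) - Z = Z * (Z ^ Suc n - Z) + (Z * Z - Z)" by (simp add: algebra_simps)
      moreover have "Z * Z - Z = - Q" using that by (auto simp: Xp_def Y_def Q_def)
      moreover have "Q dvd Z * (Z ^ Suc n - Z) + - Q" by (intro dvd_add dvd_mult Suc.IH) simp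
      ultimately show ?case by (simp only:)
    qed simp
    \<comment> \<open>Modulo Q only f_0 X + f_d (1 - X) is left, with f_0 x_0 + f_d x_d = 0. The
      solutions are the multiples of x_d X - x_0 (1 - X), whose coefficients are the ones given
      here.\<close>
    have "\<exists>c. Q dvd eval_form h Xp Y (s i) - smult c [:- x 0, x 0 + x d:]" for i
    proof -
      let ?f = "\<lambda>j. h (form_coeff d (s i) j)"
      have split: "(\<Sum>j\<le>d. g j) = g 0 + (g d + (\<Sum>j\<in>{0<..<d}. g j))" for g :: "nat \<Rightarrow> 'b::comm_monoid_add"
      proof -
        have "{..d} = insert 0 (insert d {0<..<d})" using d by auto
        thus ?thesis using d by simp
      qed
      have "(\<Sum>j\<in>{0<..<d}. ?f j * x j) = 0" by (rule sum.neutral) (simp add: x0)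
      hence 0: "?f 0 * x 0 + ?f d * x d = 0" using van[of i] by (simp add: split)
      have mid: "Q dvd (\<Sum>j\<in>{0<..<d}. [:?f j:] * (Xp ^ (d - j) * Y ^ j))"
      proof (rule dvd_sum)
        fix j assume "j \<in> {0<..<d}"
        hence "Xp dvd Xp ^ (d - j)" "Y dvd Y ^ j" by (auto intro: dvd_power)
        hence "Q dvd Xp ^ (d - j) * Y ^ j" unfolding Q by (rule mult_dvd_mono)
        thus "Q dvd [:?f j:] * (Xp ^ (d - j) * Y ^ j)" by (rule dvd_mult)
      qed
      have e: "eval_form h Xp Y (s i) = [:?f 0:] * Xp ^ d + ([:?f d:] * Y ^ d +
          (\<Sum>j\<in>{0<..<d}. [:?f j:] * (Xp ^ (d - j) * Y ^ j)))"
        unfolding eval_form_forms[OF h s] split by simp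
      obtain n where n: "d = Suc n" using d by (cases d) auto
      have pwd: "Q dvd Xp ^ d - Xp" "Q dvd Y ^ d - Y" unfolding n by (rule pw, simp)+
      have "Q dvd eval_form h Xp Y (s i) - ([:?f 0:] * Xp + [:?f d:] * Y)"
      proof -
        have "eval_form h Xp Y (s i) - ([:?f 0:] * Xp + [:?f d:] * Y) =
           [:?f 0:] * (Xp ^ d - Xp) + [:?f d:] * (Y ^ d - Y) + (\<Sum>j\<in>{0<..<d}. [:?f j:] * (Xp ^ (d - j) * Y ^ j))"
          unfolding e by (simp add: smult_diff_right algebra_simps)
        also have "Q dvd \<dots>"
          by (intro dvd_add dvd_mult mid pwd)
        finally show ?thesis .
      qed
      moreover have "\<exists>c. [:?f 0:] * Xp + [:?f d:] * Y = smult c [:- x 0, x 0 + x d:]"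
      proof (cases "x d = 0")
        case True
        have "x 0 \<noteq> 0"
        proof
          assume "x 0 = 0"
          hence "x j = 0" if "j \<le> d" for j
            using x0[of j] True that by (cases "j = 0"; cases "j = d") auto
          thus False using x by blast
        qed
        thus ?thesis using 0 True
          by (intro exI[of _ "- ?f d / x 0"]) (simp add: Xp_def Y_def)
      next
        case False
        define c where "c = ?f 0 / x d"
        have f0: "?f 0 = c * x d" using False by (simp add: c_def)
        have "x d * (c * x 0 + ?f d) = 0" using 0 by (simp only: f0) (simp add: algebra_simps)
        hence "?f d = c * (- x 0)" using False by (simp add: add_eq_0_iff)
        hence "[:?f d, ?f 0 - ?f d:] = smult c [:- x 0, x 0 + x d:]"
          by (simp add: f0 algebra_simps)
        moreover have "[:?f 0:] * Xp + [:?f d:] * Y = [:?f d, ?f 0 - ?f d:]"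
          by (simp add: Xp_def Y_def)
        ultimately show ?thesis by (intro exI[of _ c]) (simp only:)
      qed
      then obtain c where "[:?f 0:] * Xp + [:?f d:] * Y = smult c [:- x 0, x 0 + x d:]" by blast
      ultimately show ?thesis by (intro exI[of _ c]) (simp only:)
    qed
    moreover have "degree Q = 2" by (simp add: Q_def)
    moreover have "smult 1 Xp + smult 1 Y = 1" "smult 1 Xp + smult 0 Y = [:0, 1:]"
      by (simp_all add: Xp_def Y_def one_pCons)
    ultimately show False using np[OF ec, of Q] by blast
  qed
qed

section \<open>Isometries and Witt cancellation\<close>

text \<open>Vectors are functions of which only the first \<open>n\<close> values count; components
  in an orthogonal sum are then obtained by shifting the argument.\<close>

definition bil :: "'a::comm_ring_1 mat \<Rightarrow> nat \<Rightarrow> (nat \<Rightarrow> 'a) \<Rightarrow> (nat \<Rightarrow> 'a) \<Rightarrow> 'a" where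
  "bil A n x y = (\<Sum>a\<in>{0..<n}. \<Sum>b\<in>{0..<n}. x a * A $$ (a, b) * y b)"

lemma bil_add_left: "bil A n (\<lambda>a. x a + z a) y = bil A n x y + bil A n z y"
  and bil_add_right: "bil A n x (\<lambda>a. y a + z a) = bil A n x y + bil A n x z"
  and bil_diff_left: "bil A n (\<lambda>a. x a - z a) y = bil A n x y - bil A n z y"
  and bil_diff_right: "bil A n x (\<lambda>a. y a - z a) = bil A n x y - bil A n x z"
  by (simp_all add: bil_def algebra_simps sum.distrib sum_subtractf)

lemma bil_scale_left: "bil A n (\<lambda>a. k * x a) y = k * bil A n x y"
  and bil_scale_right: "bil A n x (\<lambda>a. k * y a) = k * bil A n x y"
  by (simp_all add: bil_def sum_distrib_left mult_ac)

lemma bil_cong: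
  "(\<And>a. a < n \<Longrightarrow> x a = x' a) \<Longrightarrow> (\<And>a. a < n \<Longrightarrow> y a = y' a) \<Longrightarrow> bil A n x y = bil A n x' y'"
  unfolding bil_def by (intro sum.cong) auto

lemma congruence_entry:
  assumes "P \<in> carrier_mat n n" "A \<in> carrier_mat n n" "i < n" "j < n"
  shows "(P\<^sup>T * A * P) $$ (i, j) = bil A n (\<lambda>a. P $$ (a, i)) (\<lambda>a. P $$ (a, j))"
proof -
  have "(P\<^sup>T * A * P) $$ (i, j) = (\<Sum>a\<in>{0..<n}. P $$ (a, i) * (\<Sum>b\<in>{0..<n}. A $$ (a, b) * P $$ (b, j)))"
    using assms by (simp add: scalar_prod_def)
  also have "\<dots> = bil A n (\<lambda>a. P $$ (a, i)) (\<lambda>a. P $$ (a, j))"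
    by (simp add: bil_def sum_distrib_left mult.assoc)
  finally show ?thesis .
qed

lemma det_congruence:
  assumes "P \<in> carrier_mat n n" "A \<in> carrier_mat n n"
  shows "det (P\<^sup>T * A * P) = (det P)\<^sup>2 * det A"
proof -
  have "det (P\<^sup>T * A * P) = det (P\<^sup>T * A) * det P"
    using assms by (intro det_mult) auto
  also have "det (P\<^sup>T * A) = det (P\<^sup>T) * det A" using assms by (intro det_mult) auto
  also have "det (P\<^sup>T) = det P" using assms(1) by (rule det_transpose)
  finally show ?thesis by (simp add: power2_eq_square)
qed

lemma invertible_mat_iff_det:
  fixes P :: "'a::field mat"
  assumes P: "P \<in> carrier_mat n n"
  shows "invertible_mat P \<longleftrightarrow> det P \<noteq> 0"
proof
  assume "invertible_mat P"
  then obtain Q where Q: "P * Q = 1\<^sub>m n" "Q * P = 1\<^sub>m (dim_row Q)"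
    using P by (auto simp: invertible_mat_def inverts_mat_def)
  have "dim_col (Q * P) = dim_row Q" using Q(2) by simp
  hence "dim_row Q = n" using P by simp
  moreover have "dim_col (P * Q) = n" using Q(1) by simp
  ultimately have "Q \<in> carrier_mat n n" by (intro carrier_matI) auto
  hence "det P * det Q = 1" using Q(1) P det_mult[of P n Q] by simp
  thus "det P \<noteq> 0" by auto
next
  assume "det P \<noteq> 0"
  then obtain Q where "Q \<in> carrier_mat n n" "Q * P = 1\<^sub>m n" "P * Q = 1\<^sub>m n"
    using det_non_zero_imp_unit[OF P] unfolding Units_def ring_mat_def by auto
  thus "invertible_mat P" using P
    by (auto simp: invertible_mat_def inverts_mat_def intro!: exI[of _ Q])
qed

lemma isometric_iff:
  fixes A :: "'a::field mat"
  assumes "A \<in> carrier_mat n n"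
  shows "isometric A B \<longleftrightarrow> (\<exists>P\<in>carrier_mat n n. det P \<noteq> 0 \<and> B = P\<^sup>T * A * P)"
  using assms by (auto simp: isometric_def invertible_mat_iff_det)

lemma isometric_carrier:
  assumes "isometric A B" "A \<in> carrier_mat n n"
  shows "B \<in> carrier_mat n n"
  using assms by (auto simp: isometric_def)

lemma isometric_det:
  fixes A :: "'a::field mat"
  assumes "isometric A B" "A \<in> carrier_mat n n"
  obtains e where "e \<noteq> 0" "det B = e\<^sup>2 * det A"
proof -
  obtain P where P: "P \<in> carrier_mat n n" "det P \<noteq> 0" "B = P\<^sup>T * A * P"
    using assms by (auto simp: isometric_iff)
  show ?thesis using that[OF P(2)] det_congruence[OF P(1) assms(2)] P(3) by simp
qed

text \<open>The vectors form a basis automatically, since det B is det A times the square of their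
  determinant. An isometry can thus be given by vectors with prescribed products.\<close>

lemma isometric_iff_bil:
  fixes A :: "'a::field mat"
  assumes A: "A \<in> carrier_mat n n" and B: "B \<in> carrier_mat n n" "det B \<noteq> 0"
  shows "isometric A B \<longleftrightarrow> (\<exists>p. \<forall>i<n. \<forall>j<n. bil A n (p i) (p j) = B $$ (i, j))"
proof
  assume "isometric A B"
  then obtain P where P: "P \<in> carrier_mat n n" "B = P\<^sup>T * A * P"
    using A by (auto simp: isometric_iff)
  thus "\<exists>p. \<forall>i<n. \<forall>j<n. bil A n (p i) (p j) = B $$ (i, j)"
    using congruence_entry[OF P(1) A] by (intro exI[of _ "\<lambda>i a. P $$ (a, i)"]) simp
next
  assume "\<exists>p. \<forall>i<n. \<forall>j<n. bil A n (p i) (p j) = B $$ (i, j)"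
  then obtain p where p: "\<And>i j. i < n \<Longrightarrow> j < n \<Longrightarrow> bil A n (p i) (p j) = B $$ (i, j)" by blast
  define P where "P = mat n n (\<lambda>(a, i). p i a)"
  have P: "P \<in> carrier_mat n n" by (simp add: P_def)
  have "B = P\<^sup>T * A * P"
  proof (rule eq_matI)
    fix i j assume "i < dim_row (P\<^sup>T * A * P)" "j < dim_col (P\<^sup>T * A * P)"
    hence ij: "i < n" "j < n" using P by auto
    have "bil A n (\<lambda>a. P $$ (a, i)) (\<lambda>a. P $$ (a, j)) = bil A n (p i) (p j)"
      by (rule bil_cong) (use ij in \<open>simp_all add: P_def\<close>)
    thus "B $$ (i, j) = (P\<^sup>T * A * P) $$ (i, j)"
      using congruence_entry[OF P A ij] p[OF ij] by simp
  qed (use A B P in auto)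
  moreover from this have "det P \<noteq> 0"
    using det_congruence[OF P A] B(2) by auto
  ultimately show "isometric A B" using P A by (auto simp: isometric_iff)
qed

lemma isometric_refl:
  fixes A :: "'a::field mat"
  assumes "A \<in> carrier_mat n n"
  shows "isometric A A"
  using assms by (subst isometric_iff[OF assms]) (auto intro!: bexI[of _ "1\<^sub>m n"])

lemma isometric_trans:
  fixes A :: "'a::field mat"
  assumes "isometric A B" "isometric B C" "A \<in> carrier_mat n n"
  shows "isometric A C"
proof -
  obtain P where P: "P \<in> carrier_mat n n" "det P \<noteq> 0" "B = P\<^sup>T * A * P"
    using assms(1,3) by (auto simp: isometric_iff)
  have B: "B \<in> carrier_mat n n" using isometric_carrier assms(1,3) by blast
  obtain Q where Q: "Q \<in> carrier_mat n n" "det Q \<noteq> 0" "C = Q\<^sup>T * B * Q"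
    using assms(2) B by (auto simp: isometric_iff)
  have "(P * Q)\<^sup>T * A * (P * Q) = Q\<^sup>T * (P\<^sup>T * A * P) * Q"
    using P(1) Q(1) assms(3)
    by (simp add: transpose_mult[of P n n Q n] assoc_mult_mat[of _ n n _ n _ n])
  hence "C = (P * Q)\<^sup>T * A * (P * Q)" using P(3) Q(3) by (simp only:)
  moreover have "det (P * Q) \<noteq> 0" using P Q det_mult[of P n Q] by simp
  moreover have "P * Q \<in> carrier_mat n n" using P(1) Q(1) by simp
  ultimately show ?thesis unfolding isometric_iff[OF assms(3)] by blast
qed

lemma isometric_sym:
  fixes A :: "'a::field mat"
  assumes "isometric A B" "A \<in> carrier_mat n n"
  shows "isometric B A"
proof -
  obtain P where P: "P \<in> carrier_mat n n" "det P \<noteq> 0" "B = P\<^sup>T * A * P"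
    using assms by (auto simp: isometric_iff)
  then obtain Q where Q: "Q \<in> carrier_mat n n" "Q * P = 1\<^sub>m n" "P * Q = 1\<^sub>m n"
    using det_non_zero_imp_unit[OF P(1,2)] unfolding Units_def ring_mat_def by auto
  have QP: "Q\<^sup>T * P\<^sup>T = 1\<^sub>m n"
    using Q(3) transpose_mult[OF P(1) Q(1)] by simp
  have "Q\<^sup>T * B * Q = (Q\<^sup>T * P\<^sup>T) * A * (P * Q)"
    using P(1) Q(1) assms(2)
    unfolding P(3) by (simp add: assoc_mult_mat[of _ n n _ n _ n])
  also have "\<dots> = A" using QP Q(3) assms(2) by simp
  finally have "A = Q\<^sup>T * B * Q" ..
  moreover have "det Q \<noteq> 0"
    using Q(2) det_mult[OF Q(1) P(1)] by auto
  moreover have "B \<in> carrier_mat n n" using isometric_carrier assms by blast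
  ultimately show ?thesis using Q(1) by (subst isometric_iff) auto
qed

section \<open>Orthogonal sums of Gram matrices\<close>

definition dsum :: "'a::zero mat \<Rightarrow> 'a mat \<Rightarrow> 'a mat" where
  "dsum A B = four_block_mat A (0\<^sub>m (dim_row A) (dim_col B)) (0\<^sub>m (dim_row B) (dim_col A)) B"

lemma diag_block_mat_Cons: "diag_block_mat (A # As) = dsum A (diag_block_mat As)"
  by (simp add: dsum_def Let_def)

lemma dsum_assoc: "dsum A (dsum B C) = dsum (dsum A B) C"
  unfolding dsum_def by (rule assoc_four_block_mat)

lemma dsum_carrier [simp]:
  "A \<in> carrier_mat n n \<Longrightarrow> B \<in> carrier_mat m m \<Longrightarrow> dsum A B \<in> carrier_mat (n + m) (n + m)"
  by (auto simp: dsum_def)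

lemma dsum_empty_left [simp]: "dsum (0\<^sub>m 0 0) A = A"
  by (rule eq_matI) (auto simp: dsum_def)

lemma dsum_empty_right [simp]: "dsum A (0\<^sub>m 0 0) = A"
  by (rule eq_matI) (auto simp: dsum_def)

lemma det_dsum:
  fixes A :: "'a::idom mat"
  assumes "A \<in> carrier_mat n n" "B \<in> carrier_mat m m"
  shows "det (dsum A B) = det A * det B"
  using assms unfolding dsum_def
  by (intro det_four_block_mat_upper_right_zero[of A n _ m _ B]) auto

lemma bil_dsum:
  assumes "A \<in> carrier_mat n n" "B \<in> carrier_mat m m"
  shows "bil (dsum A B) (n + m) x y = bil A n x y + bil B m (\<lambda>a. x (n + a)) (\<lambda>a. y (n + a))"
proof -
  have split: "(\<Sum>a\<in>{0..<n + m}. f a) = (\<Sum>a\<in>{0..<n}. f a) + (\<Sum>a\<in>{0..<m}. f (n + a))"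
    for f :: "nat \<Rightarrow> 'a"
    using sum.atLeastLessThan_concat[of 0 n "n + m" f] sum.shift_bounds_nat_ivl[of f 0 n m]
    by (simp add: add.commute)
  have "(\<Sum>b\<in>{0..<n}. x a * dsum A B $$ (a, b) * y b) = (\<Sum>b\<in>{0..<n}. x a * A $$ (a, b) * y b)"
    "(\<Sum>b\<in>{0..<m}. x a * dsum A B $$ (a, n + b) * y (n + b)) = 0" if "a < n" for a
    using that assms by (auto simp: dsum_def intro!: sum.cong sum.neutral)
  moreover have "(\<Sum>b\<in>{0..<n}. x (n + a) * dsum A B $$ (n + a, b) * y b) = 0"
    "(\<Sum>b\<in>{0..<m}. x (n + a) * dsum A B $$ (n + a, n + b) * y (n + b)) =
     (\<Sum>b\<in>{0..<m}. x (n + a) * B $$ (a, b) * y (n + b))" if "a < m" for a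
    using that assms by (auto simp: dsum_def intro!: sum.cong sum.neutral)
  ultimately show ?thesis
    unfolding bil_def split by (simp add: sum.distrib)
qed

lemma isometric_dsum:
  fixes A B :: "'a::field mat"
  assumes A: "A \<in> carrier_mat n n" "isometric A A'" "det A \<noteq> 0"
    and B: "B \<in> carrier_mat m m" "isometric B B'" "det B \<noteq> 0"
  shows "isometric (dsum A B) (dsum A' B')"
proof -
  have c: "A' \<in> carrier_mat n n" "B' \<in> carrier_mat m m"
    using A B isometric_carrier by blast+
  have d: "det A' \<noteq> 0" "det B' \<noteq> 0"
    using isometric_det[OF A(2,1)] isometric_det[OF B(2,1)] A(3) B(3) by (metis mult_eq_0_iff power_not_zero)+
  obtain p where p: "\<And>i j. i < n \<Longrightarrow> j < n \<Longrightarrow> bil A n (p i) (p j) = A' $$ (i, j)"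
    using A c d by (auto simp: isometric_iff_bil)
  obtain q where q: "\<And>i j. i < m \<Longrightarrow> j < m \<Longrightarrow> bil B m (q i) (q j) = B' $$ (i, j)"
    using B c d by (auto simp: isometric_iff_bil)
  define r where "r i a = (if i < n then (if a < n then p i a else 0)
     else if a < n then 0 else q (i - n) (a - n))" for i a
  have z: "bil M l (\<lambda>a. 0) y = 0" "bil M l x (\<lambda>a. 0) = 0" for M :: "'a mat" and l x y
    by (simp_all add: bil_def)
  have "bil (dsum A B) (n + m) (r i) (r j) = dsum A' B' $$ (i, j)" if ij: "i < n + m" "j < n + m" for i j
  proof -
    have "bil A n (r i) (r j) = (if i < n \<and> j < n then A' $$ (i, j) else 0)"
    proof -
      have "bil A n (r i) (r j) = bil A n (if i < n then p i else (\<lambda>a. 0)) (if j < n then p j else (\<lambda>a. 0))"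
        by (rule bil_cong) (auto simp: r_def)
      thus ?thesis by (auto simp: z p)
    qed
    moreover have "bil B m (\<lambda>a. r i (n + a)) (\<lambda>a. r j (n + a)) =
        (if i < n \<or> j < n then 0 else B' $$ (i - n, j - n))"
    proof -
      have "bil B m (\<lambda>a. r i (n + a)) (\<lambda>a. r j (n + a)) =
          bil B m (if i < n then (\<lambda>a. 0) else q (i - n)) (if j < n then (\<lambda>a. 0) else q (j - n))"
        by (rule bil_cong) (auto simp: r_def)
      thus ?thesis using ij by (auto simp: z q)
    qed
    moreover have "dsum A' B' $$ (i, j) = (if i < n \<and> j < n then A' $$ (i, j) else 0) +
       (if i < n \<or> j < n then 0 else B' $$ (i - n, j - n))"
      using ij c by (auto simp: dsum_def)
    ultimately show ?thesis using bil_dsum[OF A(1) B(1)] by simp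
  qed
  moreover have "det (dsum A' B') \<noteq> 0" using det_dsum[OF c] d by simp
  ultimately show ?thesis
    using isometric_iff_bil[of "dsum A B" "n + m" "dsum A' B'"] A(1) B(1) c by auto
qed

text \<open>
  The correction \<open>k r i s\<close> subtracted below is the effect of the reflection that moves the last
  column of the isometry to a multiple of the last basis vector.
\<close>
lemma isometric_cancel_1:
  fixes A B :: "'a::field mat"
  assumes two: "(2::'a) \<noteq> 0" and A: "A \<in> carrier_mat n n" and B: "B \<in> carrier_mat n n" "det B \<noteq> 0"
    and c: "c \<noteq> 0" and iso: "isometric (dsum A (c \<cdot>\<^sub>m 1\<^sub>m 1)) (dsum B (c \<cdot>\<^sub>m 1\<^sub>m 1))"
  shows "isometric A B"
proof -
  let ?C = "c \<cdot>\<^sub>m 1\<^sub>m 1 :: 'a mat"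
  have C: "?C \<in> carrier_mat 1 1" by simp
  have "det (dsum B ?C) \<noteq> 0" using det_dsum[OF B(1) C] B(2) c by simp
  then obtain p where p: "\<And>i j. i < n + 1 \<Longrightarrow> j < n + 1 \<Longrightarrow>
      bil (dsum A ?C) (n + 1) (p i) (p j) = dsum B ?C $$ (i, j)"
    using iso isometric_iff_bil[of "dsum A ?C" "n + 1" "dsum B ?C"] dsum_carrier[OF A C] dsum_carrier[OF B(1) C]
    by auto
  have bC: "bil ?C 1 x y = c * x 0 * y 0" for x y by (simp add: bil_def)
  let ?b = "bil A n"
  define r where "r i = p i n" for i
  have e: "?b (p i) (p j) + c * r i * r j = dsum B ?C $$ (i, j)" if "i < n + 1" "j < n + 1" for i j
    using p[OF that] bil_dsum[OF A C, of "p i" "p j"] by (simp add: bC r_def del: One_nat_def)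
  have B': "dsum B ?C $$ (i, j) = B $$ (i, j)" if "i < n" "j < n" for i j
    using that B(1) by (simp add: dsum_def)
  have e1: "?b (p i) (p j) = B $$ (i, j) - c * r i * r j" if "i < n" "j < n" for i j
    using e[of i j] B'[OF that] that by (simp add: eq_diff_eq del: One_nat_def)
  have e2: "?b (p i) (p n) = - (c * r i * r n)" "?b (p n) (p i) = - (c * r n * r i)" if "i < n" for i
    using e[of i n] e[of n i] that B(1) by (simp_all add: dsum_def eq_neg_iff_add_eq_0)
  have e3: "?b (p n) (p n) = c - c * r n * r n"
    using e[of n n] B(1) by (simp add: dsum_def eq_diff_eq)
  obtain \<epsilon> :: 'a where eps: "\<epsilon> * \<epsilon> = 1" "r n + \<epsilon> \<noteq> 0"
  proof (cases "r n + 1 = 0")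
    case True
    have "r n + (- 1) \<noteq> 0"
    proof
      assume "r n + (- 1) = 0"
      hence "r n = 1" by simp
      thus False using True two by simp
    qed
    thus ?thesis using that[of "- 1"] by simp
  qed (use that[of 1] in simp)
  define k where "k = 1 / (r n + \<epsilon>)"
  have k: "k * (r n + \<epsilon>) = 1" using eps(2) by (simp add: k_def)
  have k0: "- 1 + 2 * k * r n + k * k * (1 - r n * r n) = 0"
  proof -
    have "- 1 + 2 * k * r n + k * k * (1 - r n * r n) =
      - (k * (r n + \<epsilon>)) * (k * (r n + \<epsilon>)) + 2 * k * r n * (k * (r n + \<epsilon>)) + k * k * (\<epsilon> * \<epsilon> - r n * r n)"
      unfolding k eps(1) by simp
    also have "\<dots> = 0" by (simp add: algebra_simps)
    finally show ?thesis .
  qed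
  define q where "q i = (\<lambda>a. p i a - (k * r i) * p n a)" for i
  have "?b (q i) (q j) = B $$ (i, j)" if ij: "i < n" "j < n" for i j
  proof -
    have "?b (q i) (q j) = ?b (p i) (p j) - k * r j * ?b (p i) (p n) - k * r i * ?b (p n) (p j)
       + k * r i * (k * r j) * ?b (p n) (p n)"
      unfolding q_def bil_diff_left bil_diff_right bil_scale_left bil_scale_right
      by (simp add: algebra_simps)
    also have "\<dots> = B $$ (i, j) + c * r i * r j * (- 1 + 2 * k * r n + k * k * (1 - r n * r n))"
      unfolding e1[OF ij] e2(1)[OF ij(1)] e2(2)[OF ij(2)] e3 by (simp add: algebra_simps)
    finally show ?thesis unfolding k0 by simp
  qed
  thus ?thesis using isometric_iff_bil[OF A B] by blast
qed

lemma isometric_cancel_scalar: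
  fixes A B :: "'a::field mat"
  assumes two: "(2::'a) \<noteq> 0" and A: "A \<in> carrier_mat n n" and B: "B \<in> carrier_mat n n" "det B \<noteq> 0"
    and c: "c \<noteq> 0"
  shows "isometric (dsum A (c \<cdot>\<^sub>m 1\<^sub>m m)) (dsum B (c \<cdot>\<^sub>m 1\<^sub>m m)) \<Longrightarrow> isometric A B"
proof (induction m)
  case 0
  have "c \<cdot>\<^sub>m 1\<^sub>m 0 = (0\<^sub>m 0 0 :: 'a mat)" by (rule eq_matI) auto
  thus ?case using 0 by simp
next
  case (Suc m)
  have "c \<cdot>\<^sub>m 1\<^sub>m (Suc m) = dsum (c \<cdot>\<^sub>m 1\<^sub>m m) (c \<cdot>\<^sub>m 1\<^sub>m 1 :: 'a mat)"
    by (rule eq_matI) (auto simp: dsum_def less_Suc_eq)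
  hence *: "dsum D (c \<cdot>\<^sub>m 1\<^sub>m (Suc m)) = dsum (dsum D (c \<cdot>\<^sub>m 1\<^sub>m m)) (c \<cdot>\<^sub>m 1\<^sub>m 1)" for D :: "'a mat"
    by (simp add: dsum_assoc)
  have C: "c \<cdot>\<^sub>m 1\<^sub>m m \<in> carrier_mat m m" by simp
  have "det (dsum B (c \<cdot>\<^sub>m 1\<^sub>m m)) \<noteq> 0"
    using det_dsum[OF B(1) C] B(2) c by simp
  from isometric_cancel_1[OF two dsum_carrier[OF A C] dsum_carrier[OF B(1) C] this c Suc.prems[unfolded *]]
  show ?case by (rule Suc.IH)
qed

text \<open>Both sides are hyperbolic. The proof polarises: for a basis e_i and its dual basis x_i,
  the halves of x_i + e_i and x_i - e_i, placed in the two summands, are orthogonal with values 1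
  and -1.\<close>

lemma isometric_hyperbolic:
  fixes C :: "'a::field mat"
  assumes two: "(2::'a) \<noteq> 0" and C: "C \<in> carrier_mat n n" "C\<^sup>T = C" "det C \<noteq> 0"
  shows "isometric (dsum C (- C)) (dsum (1 \<cdot>\<^sub>m 1\<^sub>m n) ((- 1) \<cdot>\<^sub>m 1\<^sub>m n))"
proof -
  let ?I = "1 \<cdot>\<^sub>m 1\<^sub>m n :: 'a mat" and ?J = "(- 1) \<cdot>\<^sub>m 1\<^sub>m n :: 'a mat"
  obtain D where D: "D \<in> carrier_mat n n" "D * C = 1\<^sub>m n" "C * D = 1\<^sub>m n"
    using det_non_zero_imp_unit[OF C(1,3)] unfolding Units_def ring_mat_def by auto
  define e where "e i = (\<lambda>a. if a = i then 1 else 0 :: 'a)" for i :: nat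
  define x where "x i = (\<lambda>a. D $$ (a, i))" for i
  let ?b = "bil C n"
  have Csym: "C $$ (a, b) = C $$ (b, a)" if "a < n" "b < n" for a b
    using that C(1) index_transpose_mat(1)[of b C a] C(2) by simp
  have CD: "(\<Sum>b\<in>{0..<n}. C $$ (a, b) * D $$ (b, j)) = (if a = j then 1 else 0)"
    if "a < n" "j < n" for a j
    using arg_cong[OF D(3), of "\<lambda>M. M $$ (a, j)"] that C(1) D(1) by (simp add: scalar_prod_def)
  have bx: "?b y (x j) = y j" if "j < n" for y j
  proof -
    have "?b y (x j) = (\<Sum>a\<in>{0..<n}. y a * (\<Sum>b\<in>{0..<n}. C $$ (a, b) * D $$ (b, j)))"
      by (simp add: bil_def x_def sum_distrib_left mult.assoc)
    also have "\<dots> = (\<Sum>a\<in>{0..<n}. if a = j then y j else 0)"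
      by (rule sum.cong) (use that in \<open>simp_all add: CD\<close>)
    finally show ?thesis using that by simp
  qed
  have bsym: "?b y z = ?b z y" for y z
  proof -
    have "?b y z = (\<Sum>b\<in>{0..<n}. \<Sum>a\<in>{0..<n}. y a * C $$ (a, b) * z b)"
      unfolding bil_def by (rule sum.swap)
    also have "\<dots> = ?b z y"
      unfolding bil_def by (intro sum.cong) (auto simp: Csym mult_ac)
    finally show ?thesis .
  qed
  have bxe: "?b (x i) (e j) = e i j" "?b (e i) (x j) = e i j" if "i < n" "j < n" for i j
    using that bx bsym[of "x i" "e j"] by (auto simp: e_def)
  define h where "h = 1 / (2::'a)"
  have h: "h * h * 4 = 1"
  proof -
    have "h * 2 = 1" using two by (simp add: h_def)
    moreover have "h * h * 4 = (h * 2) * (h * 2)" by simp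
    ultimately show ?thesis by simp
  qed
  \<comment> \<open>The products of the x_i among themselves and of the e_i among themselves enter
    both summands equally and cancel in C and -C; only the cross terms, known by duality,
    survive.\<close>
  define t where "t \<sigma> i = (\<lambda>a. h * (x i a + \<sigma> * e i a))" for \<sigma> i
  have bt: "?b (t \<sigma> i) (t \<tau> j) = h * h * (?b (x i) (x j) + \<sigma> * \<tau> * ?b (e i) (e j) + (\<sigma> + \<tau>) * e i j)"
    if "i < n" "j < n" for \<sigma> \<tau> i j
    unfolding t_def bil_add_left bil_add_right bil_scale_left bil_scale_right bxe[OF that]
    by (simp add: algebra_simps)
  have mC: "bil (- C) n y z = - ?b y z" for y z
  proof -
    have "bil (- C) n y z = (\<Sum>a\<in>{0..<n}. \<Sum>b\<in>{0..<n}. - (y a * C $$ (a, b) * z b))"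
      unfolding bil_def by (intro sum.cong) (use C(1) in auto)
    thus ?thesis by (simp add: bil_def sum_negf)
  qed
  define p where "p i a = (if i < n then (if a < n then t 1 i a else t (- 1) i (a - n))
    else (if a < n then t (- 1) (i - n) a else t 1 (i - n) (a - n)))" for i a
  have main: "bil (dsum C (- C)) (n + n) (p i) (p j) = dsum ?I ?J $$ (i, j)"
    if ij: "i < n + n" "j < n + n" for i j
  proof -
    let ?s = "\<lambda>i. if i < n then 1 else - 1 :: 'a" and ?m = "\<lambda>i. if i < n then i else i - n"
    have m: "?m i < n" "?m j < n" using ij by auto
    have "bil (dsum C (- C)) (n + n) (p i) (p j) =
        ?b (p i) (p j) - ?b (\<lambda>a. p i (n + a)) (\<lambda>a. p j (n + a))"
      using bil_dsum[OF C(1), of "- C" n "p i" "p j"] C(1) by (simp add: mC)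
    also have "?b (p i) (p j) = ?b (t (?s i) (?m i)) (t (?s j) (?m j))"
      by (rule bil_cong) (auto simp: p_def)
    also have "?b (\<lambda>a. p i (n + a)) (\<lambda>a. p j (n + a)) = ?b (t (- ?s i) (?m i)) (t (- ?s j) (?m j))"
      by (rule bil_cong) (auto simp: p_def)
    also have "?b (t (?s i) (?m i)) (t (?s j) (?m j)) - \<dots> = h * h * 2 * ((?s i + ?s j) * e (?m i) (?m j))"
      unfolding bt[OF m] by (simp add: algebra_simps)
    also have "\<dots> = (if ?s i = ?s j then ?s i * e (?m i) (?m j) else 0)"
    proof -
      have "h * h * 2 * (2 * z) = z" for z
      proof -
        have "h * h * 2 * (2 * z) = (h * h * 4) * z" by simp
        thus ?thesis unfolding h by simp
      qed
      from this[of 1] this[of "- 1"] show ?thesis by (auto simp: e_def)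
    qed
    also have "\<dots> = dsum ?I ?J $$ (i, j)"
      using ij two by (auto simp: dsum_def e_def)
    finally show ?thesis .
  qed
  have c: "dsum C (- C) \<in> carrier_mat (n + n) (n + n)" "dsum ?I ?J \<in> carrier_mat (n + n) (n + n)"
    using C(1) by auto
  have "det (dsum ?I ?J) = det ?I * det ?J" by (rule det_dsum) auto
  hence "det (dsum ?I ?J) \<noteq> 0" by simp
  thus ?thesis using isometric_iff_bil[OF c] main by blast
qed

text \<open>Adding -C turns C into a hyperbolic form, isometric to m copies of 1 and m copies of -1.
  These rank one forms are cancelled one at a time, which avoids diagonalising C.\<close>

lemma Witt_cancellation:
  fixes A B C :: "'a::field mat"
  assumes two: "(2::'a) \<noteq> 0" and A: "A \<in> carrier_mat n n" "det A \<noteq> 0"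
    and B: "B \<in> carrier_mat n n" "det B \<noteq> 0"
    and C: "C \<in> carrier_mat m m" "C\<^sup>T = C" "det C \<noteq> 0"
    and iso: "isometric (dsum A C) (dsum B C)"
  shows "isometric A B"
proof -
  let ?I = "1 \<cdot>\<^sub>m 1\<^sub>m m :: 'a mat" and ?J = "(- 1) \<cdot>\<^sub>m 1\<^sub>m m :: 'a mat"
  have IJ: "?I \<in> carrier_mat m m" "?J \<in> carrier_mat m m" "det ?I \<noteq> 0" "det ?J \<noteq> 0" by simp_all
  have "det (- C) = (- 1) ^ m * det C"
  proof -
    have "- C = (- 1) \<cdot>\<^sub>m C" by (rule eq_matI) auto
    thus ?thesis using C(1) by simp
  qed
  hence mC: "- C \<in> carrier_mat m m" "det (- C) \<noteq> 0" using C by auto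
  have hyp: "isometric (dsum D (dsum C (- C))) (dsum D (dsum ?I ?J))"
    if D: "D \<in> carrier_mat n n" "det D \<noteq> 0" for D
    using isometric_dsum[OF D(1) isometric_refl[OF D(1)] D(2) dsum_carrier[OF C(1) mC(1)]
        isometric_hyperbolic[OF two C]] det_dsum[OF C(1) mC(1)] C(3) mC(2) by simp
  have AC: "dsum A C \<in> carrier_mat (n + m) (n + m)" "det (dsum A C) \<noteq> 0"
    using A C det_dsum[OF A(1) C(1)] by auto
  have "isometric (dsum (dsum A C) (- C)) (dsum (dsum B C) (- C))"
    by (rule isometric_dsum[OF AC(1) iso AC(2) mC(1) isometric_refl[OF mC(1)] mC(2)])
  hence mid: "isometric (dsum A (dsum C (- C))) (dsum B (dsum C (- C)))"
    by (simp add: dsum_assoc)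
  have cA: "dsum A (dsum C (- C)) \<in> carrier_mat (n + (m + m)) (n + (m + m))"
    "dsum A (dsum ?I ?J) \<in> carrier_mat (n + (m + m)) (n + (m + m))"
    using A C mC IJ by auto
  have "isometric (dsum A (dsum ?I ?J)) (dsum A (dsum C (- C)))"
    by (rule isometric_sym[OF hyp[OF A] cA(1)])
  from isometric_trans[OF isometric_trans[OF this mid cA(2)] hyp[OF B] cA(2)]
  have "isometric (dsum (dsum A ?I) ?J) (dsum (dsum B ?I) ?J)" by (simp add: dsum_assoc)
  hence "isometric (dsum A ?I) (dsum B ?I)"
    using isometric_cancel_scalar[OF two dsum_carrier[OF A(1) IJ(1)] dsum_carrier[OF B(1) IJ(1)], of "- 1" m]
      det_dsum[OF B(1) IJ(1)] B(2) IJ(3) by simp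
  thus ?thesis using isometric_cancel_scalar[OF two A(1) B, of 1 m] by simp
qed

section \<open>Power classes and classes in the Grothendieck-Witt group\<close>

lemma carrier_mult_group: "carrier (mult_group :: 'a::field monoid) = {x. x \<noteq> 0}"
proof -
  have "x \<in> Units (ring_of_type_algebra :: 'a ring) \<longleftrightarrow> x \<noteq> 0" for x :: 'a
  proof
    assume "x \<noteq> 0"
    thus "x \<in> Units (ring_of_type_algebra :: 'a ring)"
      by (auto simp: Units_def ring_of_type_algebra_def intro!: exI[of _ "inverse x"])
  qed (auto simp: Units_def ring_of_type_algebra_def)
  thus ?thesis by (auto simp: mult_group_def units_of_def)
qed

lemma mult_mult_group: "x \<otimes>\<^bsub>mult_group\<^esub> y = x * (y::'a::field)"
  by (simp add: mult_group_def units_of_def ring_of_type_algebra_def)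

lemma power_class_altdef: "power_class n a = {x ^ n * a | x. x \<noteq> (0::'a::field)}"
  by (auto simp: power_class_def nth_powers_def r_coset_def carrier_mult_group mult_mult_group)

lemma power_class_eq_iff:
  fixes a b :: "'a::field"
  shows "power_class n a = power_class n b \<longleftrightarrow> (\<exists>c. c \<noteq> 0 \<and> b = c ^ n * a)"
proof
  assume "power_class n a = power_class n b"
  moreover have "b \<in> power_class n b"
    unfolding power_class_altdef by (intro CollectI exI[of _ 1]) simp
  ultimately have "b \<in> power_class n a" by (simp only:)
  thus "\<exists>c. c \<noteq> 0 \<and> b = c ^ n * a" unfolding power_class_altdef by blast
next
  assume "\<exists>c. c \<noteq> 0 \<and> b = c ^ n * a"
  then obtain c where c: "c \<noteq> 0" "b = c ^ n * a" by blast
  have 1: "x ^ n * a = (x / c) ^ n * b" for x using c by (simp add: power_divide)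
  have 2: "x ^ n * b = (x * c) ^ n * a" for x using c by (simp add: power_mult_distrib)
  show "power_class n a = power_class n b"
    unfolding power_class_altdef
  proof (intro subset_antisym subsetI)
    fix z assume "z \<in> {x ^ n * a | x. x \<noteq> 0}"
    then obtain x where "z = x ^ n * a" "x \<noteq> 0" by blast
    thus "z \<in> {x ^ n * b | x. x \<noteq> 0}"
      using 1[of x] c(1) by (intro CollectI exI[of _ "x / c"]) simp
  next
    fix z assume "z \<in> {x ^ n * b | x. x \<noteq> 0}"
    then obtain x where "z = x ^ n * b" "x \<noteq> 0" by blast
    thus "z \<in> {x ^ n * a | x. x \<noteq> 0}"
      using 2[of x] c(1) by (intro CollectI exI[of _ "x * c"]) simp
  qed
qed

lemma carrier_power_class_group:
  "carrier (power_class_group n) = {power_class n a | a. a \<noteq> (0::'a::field)}"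
  by (auto simp: power_class_group_def FactGroup_def RCOSETS_def carrier_mult_group power_class_def)

text \<open>The factor y^(2 m) is itself a square and is absorbed.\<close>

lemma to_square_class_power_class:
  "to_square_class (power_class (2 * m) a) = power_class 2 (a::'a::field)"
proof -
  have 1: "x\<^sup>2 * (y ^ (2 * m) * a) = (x * y ^ m)\<^sup>2 * a" for x y
    by (simp add: power_mult_distrib power_mult mult.commute[of 2 m])
  have "to_square_class (power_class (2 * m) a) =
      {x\<^sup>2 * (y ^ (2 * m) * a) | x y. x \<noteq> 0 \<and> y \<noteq> 0}"
    by (auto simp: to_square_class_def nth_powers_def set_mult_def carrier_mult_group
        mult_mult_group power_class_altdef)
  also have "\<dots> = power_class 2 a"
    unfolding power_class_altdef
  proof (intro subset_antisym subsetI)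
    fix z assume "z \<in> {x\<^sup>2 * (y ^ (2 * m) * a) | x y. x \<noteq> 0 \<and> y \<noteq> 0}"
    then obtain x y where "z = x\<^sup>2 * (y ^ (2 * m) * a)" "x \<noteq> 0" "y \<noteq> 0" by blast
    thus "z \<in> {x\<^sup>2 * a | x. x \<noteq> 0}" unfolding 1 by (intro CollectI exI[of _ "x * y ^ m"]) simp
  next
    fix z assume "z \<in> {x\<^sup>2 * a | x. x \<noteq> 0}"
    then obtain x where "z = x\<^sup>2 * a" "x \<noteq> 0" by blast
    thus "z \<in> {x\<^sup>2 * (y ^ (2 * m) * a) | x y. x \<noteq> 0 \<and> y \<noteq> 0}"
      by (intro CollectI exI[of _ x] exI[of _ 1]) simp
  qed
  finally show ?thesis .
qed

section \<open>Classes of symmetric forms\<close>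

lemma symmetric_formsD:
  assumes "A \<in> symmetric_forms"
  shows "A \<in> carrier_mat (dim_row A) (dim_row A)" "A\<^sup>T = A" "det A \<noteq> 0"
  using assms by (auto simp: symmetric_forms_def)

lemma symmetric_formsI: "A \<in> carrier_mat n n \<Longrightarrow> A\<^sup>T = A \<Longrightarrow> det A \<noteq> 0 \<Longrightarrow> A \<in> symmetric_forms"
  by (auto simp: symmetric_forms_def)

lemma empty_symmetric_form: "0\<^sub>m 0 0 \<in> symmetric_forms"
proof (rule symmetric_formsI)
  show "(0\<^sub>m 0 0)\<^sup>T = (0\<^sub>m 0 0 :: 'a mat)" by (rule eq_matI) auto
qed auto

lemma diag_block_mat_3: "diag_block_mat [A, B, C] = dsum A (dsum B C)"
  by (simp only: diag_block_mat_Cons diag_block_mat.simps(1) dsum_empty_right)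

lemma gw_class_iff:
  "(A', B') \<in> gw_class A \<longleftrightarrow> A \<in> symmetric_forms \<and> A' \<in> symmetric_forms \<and> B' \<in> symmetric_forms \<and>
     (\<exists>C\<in>symmetric_forms. isometric (dsum A (dsum B' C)) (dsum A' C))"
  by (simp only: gw_class_def gw_rel_def Image_singleton_iff mem_Collect_eq case_prod_conv
      diag_block_mat_3 dsum_empty_left empty_symmetric_form simp_thms)

lemma gw_class_refl:
  assumes "A \<in> symmetric_forms"
  shows "(A, 0\<^sub>m 0 0) \<in> gw_class A"
proof -
  have "isometric (dsum A (dsum (0\<^sub>m 0 0) (0\<^sub>m 0 0))) (dsum A (0\<^sub>m 0 0))"
    using isometric_refl[OF symmetric_formsD(1)[OF assms]] by simp
  thus ?thesis unfolding gw_class_iff using assms empty_symmetric_form by blast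
qed

lemma gw_class_isometric:
  assumes A: "A \<in> symmetric_forms" and iso: "isometric A B" and B: "B \<in> symmetric_forms"
  shows "gw_class A \<subseteq> gw_class B"
proof
  fix z assume z: "z \<in> gw_class A"
  obtain A' B' where z': "z = (A', B')" by (cases z)
  obtain C where C: "A' \<in> symmetric_forms" "B' \<in> symmetric_forms" "C \<in> symmetric_forms"
    "isometric (dsum A (dsum B' C)) (dsum A' C)"
    using z unfolding z' gw_class_iff by blast
  note a = symmetric_formsD[OF A] and b = symmetric_formsD[OF C(2)] and c = symmetric_formsD[OF C(3)]
  have D: "dsum B' C \<in> carrier_mat (dim_row B' + dim_row C) (dim_row B' + dim_row C)"
    "det (dsum B' C) \<noteq> 0"
    by (rule dsum_carrier[OF b(1) c(1)]) (simp only: det_dsum[OF b(1) c(1)] b(3) c(3) mult_eq_0_iff, simp)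
  have "isometric (dsum A (dsum B' C)) (dsum B (dsum B' C))"
    by (rule isometric_dsum[OF a(1) iso a(3) D(1) isometric_refl[OF D(1)] D(2)])
  note 1 = isometric_sym[OF this dsum_carrier[OF a(1) D(1)]]
  have "B \<in> carrier_mat (dim_row A) (dim_row A)" by (rule isometric_carrier[OF iso a(1)])
  from isometric_trans[OF 1 C(4) dsum_carrier[OF this D(1)]]
  show "z \<in> gw_class B" using C(1-3) B unfolding z' gw_class_iff by blast
qed

text \<open>Equality of classes gives an isometry only after adding a form \<open>C\<close>. The
  ranks are compared first, because cancellation relates forms of equal rank.\<close>

lemma gw_class_eq_iff:
  fixes A B :: "'a::field mat"
  assumes two: "(2::'a) \<noteq> 0" and A: "A \<in> symmetric_forms" and B: "B \<in> symmetric_forms"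
  shows "gw_class A = gw_class B \<longleftrightarrow> isometric A B"
proof
  assume "gw_class A = gw_class B"
  hence "(B, 0\<^sub>m 0 0) \<in> gw_class A" using gw_class_refl[OF B] by simp
  then obtain C where C: "C \<in> symmetric_forms" "isometric (dsum A C) (dsum B C)"
    unfolding gw_class_iff dsum_empty_left by blast
  note a = symmetric_formsD[OF A] and b = symmetric_formsD[OF B] and c = symmetric_formsD[OF C(1)]
  have "dsum B C \<in> carrier_mat (dim_row A + dim_row C) (dim_row A + dim_row C)"
    by (rule isometric_carrier[OF C(2) dsum_carrier[OF a(1) c(1)]])
  from carrier_matD(1)[OF this] have "dim_row B = dim_row A" by (simp add: dsum_def)
  from Witt_cancellation[OF two a(1,3) b(1)[unfolded this] b(3) c C(2)]
  show "isometric A B" .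
next
  assume iso: "isometric A B"
  show "gw_class A = gw_class B"
    using gw_class_isometric[OF A iso B]
      gw_class_isometric[OF B isometric_sym[OF iso symmetric_formsD(1)[OF A]] A] by blast
qed

lemma gw_class_in_carrier: "A \<in> symmetric_forms \<Longrightarrow> gw_class A \<in> carrier GW"
  using empty_symmetric_form by (auto simp: GW_def gw_class_def quotient_def)

text \<open>In the determinants of the stable isometry the factor det C cancels, so every
  representative has det A' / det B' equal to det A times a square.\<close>

lemma gw_disc_gw_class:
  assumes A: "A \<in> symmetric_forms"
  shows "gw_disc (gw_class A) = power_class 2 (det A)"
proof -
  have "power_class 2 (det A' / det B') = power_class 2 (det A)" if AB: "(A', B') \<in> gw_class A" for A' B'
  proof -
    obtain C where C: "A' \<in> symmetric_forms" "B' \<in> symmetric_forms" "C \<in> symmetric_forms"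
      "isometric (dsum A (dsum B' C)) (dsum A' C)"
      using AB unfolding gw_class_iff by blast
    note a = symmetric_formsD[OF A] and b = symmetric_formsD[OF C(2)]
      and c = symmetric_formsD[OF C(3)] and a' = symmetric_formsD[OF C(1)]
    obtain e where e: "e \<noteq> 0" "det (dsum A' C) = e\<^sup>2 * det (dsum A (dsum B' C))"
      by (rule isometric_det[OF C(4) dsum_carrier[OF a(1) dsum_carrier[OF b(1) c(1)]]])
    have "det A' * det C = e\<^sup>2 * (det A * (det B' * det C))"
      using e(2) det_dsum[OF a'(1) c(1)] det_dsum[OF a(1) dsum_carrier[OF b(1) c(1)]]
        det_dsum[OF b(1) c(1)] by simp
    hence d: "det A' = e\<^sup>2 * det A * det B'" using c(3) by simp
    have "det A' / det B' = e\<^sup>2 * det A" unfolding d using b(3) by simp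
    hence "power_class 2 (det A) = power_class 2 (det A' / det B')"
      using e(1) unfolding power_class_eq_iff by (intro exI[of _ e]) simp
    thus ?thesis ..
  qed
  hence "(case z of (A', B') \<Rightarrow> power_class 2 (det A' / det B')) = power_class 2 (det A)"
    if "z \<in> gw_class A" for z using that by (cases z) simp
  hence "gw_disc (gw_class A) = (\<Union>z\<in>gw_class A. power_class 2 (det A))"
    unfolding gw_disc_def by (rule SUP_cong[OF refl])
  also have "\<dots> = power_class 2 (det A)" using gw_class_refl[OF A] by auto
  finally show ?thesis .
qed

section \<open>Unimodular ternary forms over polynomial rings\<close>

lemma det_2:
  assumes "A \<in> carrier_mat 2 2"
  shows "det A = A $$ (0, 0) * A $$ (1, 1) - A $$ (0, 1) * A $$ (1, 0)"
proof -
  have 1: "det (mat_delete A i 0) = A $$ (1 - i, 1)" if "i < 2" for i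
    using assms that by (subst det_single) (auto simp: mat_delete_def less_2_cases_iff)
  have "det A = (\<Sum>i<2. A $$ (i, 0) * cofactor A i 0)"
    by (rule laplace_expansion_column[OF assms]) simp
  thus ?thesis by (simp add: cofactor_def 1 numeral_2_eq_2)
qed

text \<open>The determinant of the symmetric matrix with rows a b c, b d e and c e f.\<close>

definition det3 :: "'a::comm_ring_1 \<Rightarrow> 'a \<Rightarrow> 'a \<Rightarrow> 'a \<Rightarrow> 'a \<Rightarrow> 'a \<Rightarrow> 'a" where
  "det3 a b c d e f = a * (d * f - e * e) - b * (b * f - e * c) + c * (b * e - d * c)"

lemma det_3:
  assumes A: "A \<in> carrier_mat 3 3"
  shows "det A = A $$ (0, 0) * (A $$ (1, 1) * A $$ (2, 2) - A $$ (1, 2) * A $$ (2, 1))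
    - A $$ (1, 0) * (A $$ (0, 1) * A $$ (2, 2) - A $$ (0, 2) * A $$ (2, 1))
    + A $$ (2, 0) * (A $$ (0, 1) * A $$ (1, 2) - A $$ (0, 2) * A $$ (1, 1))"
proof -
  have D: "det (mat_delete A i 0) =
      mat_delete A i 0 $$ (0, 0) * mat_delete A i 0 $$ (1, 1) -
      mat_delete A i 0 $$ (0, 1) * mat_delete A i 0 $$ (1, 0)" if "i < 3" for i
    using A by (intro det_2) (auto simp: mat_delete_def)
  have "det A = (\<Sum>i<3. A $$ (i, 0) * cofactor A i 0)"
    by (rule laplace_expansion_column[OF A]) simp
  also have "\<dots> = A $$ (0, 0) * cofactor A 0 0 + A $$ (1, 0) * cofactor A 1 0 + A $$ (2, 0) * cofactor A 2 0"
    by (simp add: numeral_3_eq_3 numeral_2_eq_2)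
  finally show ?thesis
    unfolding cofactor_def using A by (simp add: D) (simp add: mat_delete_def algebra_simps eval_nat_numeral)
qed

lemma det_3_sym:
  assumes "A \<in> carrier_mat 3 3" "A\<^sup>T = A"
  shows "det A = det3 (A $$ (0, 0)) (A $$ (0, 1)) (A $$ (0, 2)) (A $$ (1, 1)) (A $$ (1, 2)) (A $$ (2, 2))"
proof -
  have "A $$ (j, i) = A $$ (i, j)" if "i < 3" "j < 3" for i j
    using that assms(1) index_transpose_mat(1)[of i A j] assms(2) by simp
  from this[of 0 1] this[of 0 2] this[of 1 2] show ?thesis
    unfolding det_3[OF assms(1)] det3_def by (simp add: mult.commute)
qed

section \<open>Elementary moves on ternary Gram matrices\<close>

locale sym_bilinear =
  fixes \<beta> :: "(nat \<Rightarrow> 'r::comm_ring_1) \<Rightarrow> (nat \<Rightarrow> 'r) \<Rightarrow> 'r" and \<delta> :: 'r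
  assumes add_left: "\<beta> (\<lambda>a. x a + y a) z = \<beta> x z + \<beta> y z"
    and scale_left: "\<beta> (\<lambda>a. k * x a) z = k * \<beta> x z"
    and sym: "\<beta> x y = \<beta> y x"
begin

lemma add_right: "\<beta> z (\<lambda>a. x a + y a) = \<beta> z x + \<beta> z y"
  by (metis add_left sym)

lemma scale_right: "\<beta> z (\<lambda>a. k * x a) = k * \<beta> z x"
  by (metis scale_left sym)

text \<open>Gram matrices of triples of vectors, listed by the upper triangle. The determinant
  condition stands in for being a basis: the moves keep it, and a nonzero determinant is what makes
  the evaluated vectors a basis.\<close>

definition gram :: "'r \<Rightarrow> 'r \<Rightarrow> 'r \<Rightarrow> 'r \<Rightarrow> 'r \<Rightarrow> 'r \<Rightarrow> bool" where
  "gram a b c d e f \<longleftrightarrow> det3 a b c d e f = \<delta> \<and>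
     (\<exists>x y z. \<beta> x x = a \<and> \<beta> x y = b \<and> \<beta> x z = c \<and> \<beta> y y = d \<and> \<beta> y z = e \<and> \<beta> z z = f)"

lemma gram_swap12: "gram a b c d e f \<Longrightarrow> gram d b e a c f"
proof -
  assume g: "gram a b c d e f"
  have "det3 d b e a c f = det3 a b c d e f" by (simp add: det3_def algebra_simps)
  thus ?thesis using g sym unfolding gram_def by metis
qed

lemma gram_add12:
  assumes "gram a b c d e f"
  shows "gram a (b + k * a) c (d + 2 * k * b + k * k * a) (e + k * c) f"
proof -
  obtain x y z where *: "\<beta> x x = a" "\<beta> x y = b" "\<beta> x z = c" "\<beta> y y = d" "\<beta> y z = e" "\<beta> z z = f"
    using assms by (auto simp: gram_def)
  have "det3 a (b + k * a) c (d + 2 * k * b + k * k * a) (e + k * c) f = det3 a b c d e f"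
    by (simp add: det3_def algebra_simps)
  moreover have "\<beta> y x = b" using * sym by metis
  ultimately show ?thesis
    using assms * unfolding gram_def
    by (intro conjI exI[of _ x] exI[of _ "\<lambda>a. y a + k * x a"] exI[of _ z])
       (simp_all add: add_left add_right scale_left scale_right algebra_simps)
qed

lemma gram_SL23:
  assumes "gram a b c d e f" "p * s - q * r = 1"
  shows "gram a (p * b + q * c) (r * b + s * c) (p * p * d + 2 * p * q * e + q * q * f)
    (p * r * d + (p * s + q * r) * e + q * s * f) (r * r * d + 2 * r * s * e + s * s * f)"
proof -
  obtain x y z where *: "\<beta> x x = a" "\<beta> x y = b" "\<beta> x z = c" "\<beta> y y = d" "\<beta> y z = e" "\<beta> z z = f"
    using assms by (auto simp: gram_def)
  have "det3 a (p * b + q * c) (r * b + s * c) (p * p * d + 2 * p * q * e + q * q * f)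
    (p * r * d + (p * s + q * r) * e + q * s * f) (r * r * d + 2 * r * s * e + s * s * f) =
    (p * s - q * r) * (p * s - q * r) * det3 a b c d e f"
    by (simp add: det3_def algebra_simps)
  moreover have "\<beta> z y = e" using * sym by metis
  ultimately show ?thesis
    using assms * unfolding gram_def
    by (intro conjI exI[of _ x] exI[of _ "\<lambda>a. p * y a + q * z a"] exI[of _ "\<lambda>a. r * y a + s * z a"])
       (simp_all add: add_left add_right scale_left scale_right algebra_simps)
qed

lemma gram_swap23: "gram a b c d e f \<Longrightarrow> gram a c b f e d"
proof -
  assume g: "gram a b c d e f"
  have "det3 a c b f e d = det3 a b c d e f" by (simp add: det3_def algebra_simps)
  thus ?thesis using g sym unfolding gram_def by metis
qed

lemma gram_add23:
  assumes "gram a b c d e f"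
  shows "gram a b (c + k * b) d (e + k * d) (f + 2 * k * e + k * k * d)"
  using gram_SL23[OF assms, of 1 1 0 k] by (simp add: algebra_simps)

lemma gram_add13:
  assumes "gram a b c d e f"
  shows "gram a b (c + k * a) d (e + k * b) (f + 2 * k * c + k * k * a)"
  using gram_swap23[OF gram_add12[OF gram_swap23[OF assms], of k]] by (simp add: algebra_simps)

end

section \<open>Degree reduction over a polynomial ring\<close>

lemma poly_reduce:
  fixes a b :: "'a::field poly"
  assumes "degree a > 0"
  obtains k where "degree (b + k * a) < degree a"
proof -
  have "b + (- (b div a)) * a = b mod a" by (simp add: minus_div_mult_eq_mod)
  moreover have "degree (b mod a) < degree a"
  proof (cases "b mod a = 0")
    case False
    moreover have "a \<noteq> 0" using assms by auto
    ultimately show ?thesis using degree_mod_less[of a b] by blast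
  qed (use assms in simp)
  ultimately show ?thesis using that by metis
qed

text \<open>The square has degree below 2 n, too small to cancel the leading term of the
  product.\<close>

lemma degree_mult_minus_square:
  fixes a d b :: "'a::field poly"
  assumes "degree b < n" "n \<le> degree a" "n \<le> degree d"
  shows "degree (a * d - b * b) = degree a + degree d"
proof -
  have "a \<noteq> 0" "d \<noteq> 0" using assms by auto
  hence ad: "degree (a * d) = degree a + degree d" by (rule degree_mult_eq)
  moreover have "degree (b * b) < degree a + degree d"
    using degree_mult_le[of b b] assms by linarith
  ultimately show ?thesis
    using degree_add_eq_left[of "- (b * b)" "a * d"] by simp
qed

text \<open>
  Hermite reduction. In the anisotropic case the product of the two minors below has degree at
  least \<open>4 n\<close>, where \<open>n\<close> is the minimal degree of a represented element, whereas it equals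
  the determinant times a polynomial of degree \<open>n\<close>, up to a square of smaller degree.
\<close>
lemma gram_const:
  fixes \<beta> :: "(nat \<Rightarrow> 'a::field poly) \<Rightarrow> _"
  assumes "sym_bilinear \<beta>" and two: "(2::'a) \<noteq> 0" and \<delta>0: "\<delta>0 \<noteq> 0"
    and init: "sym_bilinear.gram \<beta> [:\<delta>0:] a b c d e f"
  shows "\<exists>a b c d e f. sym_bilinear.gram \<beta> [:\<delta>0:] [:a:] [:b:] [:c:] [:d:] [:e:] [:f:]"
proof -
  interpret sym_bilinear \<beta> "[:\<delta>0:]" by fact
  have det: "det3 a b c d e f = [:\<delta>0:]" if "gram a b c d e f" for a b c d e f
    using that by (simp add: gram_def)
  define h :: "'a poly" where "h = [:1 / 2:]"
  have h: "2 * h = 1" using two by (simp add: h_def numeral_poly one_pCons)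
  define \<iota> :: "'a poly" where "\<iota> = [:1 / \<delta>0:]"
  have \<iota>: "\<iota> * [:\<delta>0:] = 1" using \<delta>0 by (simp add: \<iota>_def one_pCons)
  show ?thesis
  proof (cases "\<exists>b c d e f. gram 0 b c d e f")
    case True
    then obtain b c d e f where g: "gram 0 b c d e f" by blast
    \<comment> \<open>If the first vector is isotropic, expanding the determinant gives Bezout
      coefficients for \<open>b\<close> and \<open>c\<close>. The new second vector pairs to 1 with
      the first, and -c y + b z is orthogonal to it.\<close>
    define p where "p = \<iota> * (e * c - b * f)"
    define q where "q = \<iota> * (b * e - d * c)"
    have "p * b - q * (- c) = \<iota> * det3 0 b c d e f"
      by (simp add: p_def q_def det3_def algebra_simps)
    hence pq: "p * b - q * (- c) = 1" using det[OF g] \<iota> by simp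
    have "r * b + s * c = 0" if "r = - c" "s = b" for r s using that by simp
    moreover have "p * b + q * c = 1" using pq by simp
    ultimately obtain d1 e1 f1 where g1: "gram 0 1 0 d1 e1 f1"
      using gram_SL23[OF g pq] by (metis mult.commute add.commute)
    \<comment> \<open>The second vector has product 1 with the isotropic one, so half of its own
      value can be subtracted to make it isotropic, too.\<close>
    define k where "k = - (h * d1)"
    have "d1 + 2 * k * 1 + k * k * 0 = d1 - (2 * h) * d1" by (simp add: k_def)
    hence k: "d1 + 2 * k * 1 + k * k * 0 = 0" unfolding h by simp
    have "gram 0 1 0 0 e1 f1" using gram_add12[OF g1, of k] unfolding k by simp
    from gram_add13[OF this, of "- e1"] have g2: "gram 0 1 0 0 0 f1" by simp
    have "f1 = [:- \<delta>0:]" using det[OF g2] by (simp add: det3_def) (metis minus_equation_iff minus_pCons minus_zero)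
    hence "gram [:0:] [:1:] [:0:] [:0:] [:0:] [:- \<delta>0:]" using g2 by (simp add: one_pCons)
    thus ?thesis by blast
  next
    case False
    hence nz: "a \<noteq> 0" if "gram a b c d e f" for a b c d e f using that by blast
    define n where "n = (LEAST n. \<exists>a b c d e f. gram a b c d e f \<and> degree a = n)"
    have "\<exists>a b c d e f. gram a b c d e f \<and> degree a = n"
      unfolding n_def by (rule LeastI_ex) (use init in blast)
    then obtain a b c d e f where g: "gram a b c d e f" "degree a = n" by blast
    have min: "n \<le> degree a" if "gram a b c d e f" for a b c d e f
      unfolding n_def by (rule Least_le) (use that in blast)
    have "n = 0"
    proof (rule ccontr)
      assume n: "n \<noteq> 0"
      \<comment> \<open>After reducing \<open>b\<close> modulo \<open>a\<close>, both diagonal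
        entries are represented values and so have degree at least \<open>n\<close>. The minor does
        not notice the reduction.\<close>
      have D: "2 * n \<le> degree (a * d - b * b)" if gr: "gram a b c d e f" and da: "degree a = n" for a b c d e f
      proof -
        obtain k where k: "degree (b + k * a) < degree a" using poly_reduce[of a b] da n by auto
        note g' = gram_add12[OF gr, of k]
        have "n \<le> degree (d + 2 * k * b + k * k * a)" using min[OF gram_swap12[OF g']] .
        hence "degree (a * (d + 2 * k * b + k * k * a) - (b + k * a) * (b + k * a)) =
            degree a + degree (d + 2 * k * b + k * k * a)"
          using k da by (intro degree_mult_minus_square[where n = n]) auto
        moreover have "a * (d + 2 * k * b + k * k * a) - (b + k * a) * (b + k * a) = a * d - b * b"
          by (simp add: algebra_simps)
        ultimately show ?thesis using da \<open>n \<le> _\<close> by simp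
      qed
      define m where "m = (LEAST m. \<exists>a b c d e f. gram a b c d e f \<and> degree a = n \<and> degree (a * d - b * b) = m)"
      have "\<exists>a b c d e f. gram a b c d e f \<and> degree a = n \<and> degree (a * d - b * b) = m"
        unfolding m_def by (rule LeastI_ex) (use g in blast)
      then obtain a b c d e f where g: "gram a b c d e f" "degree a = n" "degree (a * d - b * b) = m" by blast
      have minm: "m \<le> degree (a * d - b * b)" if "gram a b c d e f" "degree a = n" for a b c d e f
        unfolding m_def by (rule Least_le) (use that in blast)
      have m: "2 * n \<le> m" using D[OF g(1,2)] g(3) by simp
      \<comment> \<open>Adding k times the second vector to the third changes the mixed minor a e -
        b c by k times a d - b^2, so it can be made smaller than \<open>m\<close>.\<close>
      obtain k where k: "degree ((a * e - b * c) + k * (a * d - b * b)) < degree (a * d - b * b)"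
        using poly_reduce[of "a * d - b * b" "a * e - b * c"] g(3) m n by auto
      note g' = gram_add23[OF g(1), of k]
      define c' e' f' where "c' = c + k * b" "e' = e + k * d" "f' = f + 2 * k * e + k * k * d"
      have g': "gram a b c' d e' f'" using g' by (simp add: c'_e'_f'_def)
      have E: "a * e' - b * c' = (a * e - b * c) + k * (a * d - b * b)"
        by (simp add: c'_e'_f'_def algebra_simps)
      have "m \<le> degree (a * f' - c' * c')" using minm[OF gram_swap23[OF g'] g(2)] .
      hence "degree ((a * d - b * b) * (a * f' - c' * c') - (a * e' - b * c') * (a * e' - b * c')) =
          degree (a * d - b * b) + degree (a * f' - c' * c')"
        using k unfolding E by (intro degree_mult_minus_square[where n = m]) (auto simp: g(3))
      \<comment> \<open>Sylvester's identity for the 2 x 2 minors that contain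
        \<open>a\<close>.\<close>
      also have "(a * d - b * b) * (a * f' - c' * c') - (a * e' - b * c') * (a * e' - b * c') =
          a * det3 a b c' d e' f'"
        by (simp add: det3_def algebra_simps)
      also have "degree \<dots> = n" using det[OF g'] g(2) \<delta>0 by simp
      finally show False using \<open>m \<le> degree (a * f' - c' * c')\<close> m n g(3) by simp
    qed
    then obtain a0 where a0: "a = [:a0:]" using g(2) by (metis degree_eq_zeroE)
    have a0nz: "a0 \<noteq> 0" using nz[OF g(1)] a0 by simp
    have inv: "x + (- ([:1 / a0:] * x)) * a = 0" for x
    proof -
      have "(- ([:1 / a0:] * x)) * a = - (([:1 / a0:] * a) * x)" by (simp add: algebra_simps)
      also have "[:1 / a0:] * a = 1" using a0 a0nz by (simp add: one_pCons)
      finally show ?thesis by simp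
    qed
    \<comment> \<open>A nonzero constant \<open>a\<close> is invertible, so \<open>b\<close> and
      \<open>c\<close> can be cleared and the first vector splits off.\<close>
    obtain d1 e1 where g1: "gram a 0 c d1 e1 f"
      using gram_add12[OF g(1), of "- ([:1 / a0:] * b)"] unfolding inv by blast
    obtain f2 e2 where g2: "gram a 0 0 d1 e2 f2"
      using gram_add13[OF g1, of "- ([:1 / a0:] * c)"] unfolding inv by blast
    have bin: "degree (d * f - e * e) = 0 \<and> d * f - e * e \<noteq> 0" if "gram a 0 0 d e f" for d e f
    proof -
      have "a * (d * f - e * e) = [:\<delta>0:]" using det[OF that] by (simp add: det3_def)
      hence "smult a0 (d * f - e * e) = [:\<delta>0:]" by (simp add: a0)
      hence "degree (smult a0 (d * f - e * e)) = 0" "smult a0 (d * f - e * e) \<noteq> 0" using \<delta>0 by simp_all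
      thus ?thesis using a0nz by auto
    qed
    show ?thesis
    proof (cases "\<exists>e f. gram a 0 0 0 e f")
      case True
      then obtain e f where g: "gram a 0 0 0 e f" by blast
      have e: "degree e = 0" "e \<noteq> 0" using bin[OF g] degree_mult_eq[of e e] by auto
      then obtain e0 where e0: "e = [:e0:]" by (metis degree_eq_zeroE)
      define k where "k = - (h * ([:1 / e0:] * f))"
      have "f + 2 * k * e + k * k * 0 = f - (2 * h) * ([:1 / e0:] * e) * f"
        by (simp add: k_def algebra_simps)
      also have "[:1 / e0:] * e = 1" using e e0 by (simp add: one_pCons)
      finally have k: "f + 2 * k * e + k * k * 0 = 0" unfolding h by simp
      have "gram a 0 0 0 e 0" using gram_add23[OF g, of k] unfolding k by simp
      hence "gram [:a0:] [:0:] [:0:] [:0:] [:e0:] [:0:]" by (simp add: a0 e0)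
      thus ?thesis by blast
    next
      case False
      define l where "l = (LEAST l. \<exists>d e f. gram a 0 0 d e f \<and> degree d = l)"
      have "\<exists>d e f. gram a 0 0 d e f \<and> degree d = l"
        unfolding l_def by (rule LeastI_ex) (use g2 in blast)
      then obtain d e f where g: "gram a 0 0 d e f" "degree d = l" by blast
      have minl: "l \<le> degree d" if "gram a 0 0 d e f" for d e f
        unfolding l_def by (rule Least_le) (use that in blast)
      \<comment> \<open>The same descent in rank two: with \<open>e\<close> reduced modulo
        \<open>d\<close>, the constant d f - e^2 would have degree at least 2 l.\<close>
      have "l = 0"
      proof (rule ccontr)
        assume l: "l \<noteq> 0"
        obtain k where k: "degree (e + k * d) < degree d" using poly_reduce[of d e] g(2) l by auto
        have g': "gram a 0 0 d (e + k * d) (f + 2 * k * e + k * k * d)"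
          using gram_add23[OF g(1), of k] by simp
        have "l \<le> degree (f + 2 * k * e + k * k * d)" using minl[OF gram_swap23[OF g']] .
        hence "degree (d * (f + 2 * k * e + k * k * d) - (e + k * d) * (e + k * d)) =
            degree d + degree (f + 2 * k * e + k * k * d)"
          using k g(2) by (intro degree_mult_minus_square[where n = l]) auto
        thus False using bin[OF g'] g(2) l by simp
      qed
      then obtain d0 where d0: "d = [:d0:]" using g(2) by (metis degree_eq_zeroE)
      have d0nz: "d0 \<noteq> 0" using False g(1) d0 by auto
      have "e + (- ([:1 / d0:] * e)) * d = e - ([:1 / d0:] * d) * e" by (simp add: algebra_simps)
      also have "[:1 / d0:] * d = 1" using d0 d0nz by (simp add: one_pCons)
      finally have k: "e + (- ([:1 / d0:] * e)) * d = 0" by simp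
      obtain f' where g': "gram a 0 0 d 0 f'"
        using gram_add23[OF g(1), of "- ([:1 / d0:] * e)"] unfolding k by auto
      have "degree f' = 0" using bin[OF g'] d0 d0nz by simp
      then obtain f0 where "f' = [:f0:]" by (metis degree_eq_zeroE)
      hence "gram [:a0:] [:0:] [:0:] [:d0:] [:0:] [:f0:]" using g' a0 d0 by simp
      thus ?thesis by blast
    qed
  qed
qed

lemma sum_3: "(\<Sum>a\<in>{0..<3}. f a) = f 0 + f 1 + f (2::nat)"
  by (simp add: numeral_3_eq_3 numeral_2_eq_2)

lemma less_3_cases: "i < 3 \<Longrightarrow> i = 0 \<or> i = 1 \<or> i = (2::nat)"
  by arith

text \<open>Three vectors over K[t] have a constant Gram matrix \<open>N\<close>; their values at u
  show that each specialisation is isometric to \<open>N\<close>. This is a ternary case of Harder's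
  theorem.\<close>

lemma isometric_specializations:
  fixes M :: "'a::field poly mat"
  assumes two: "(2::'a) \<noteq> 0" and M: "M \<in> carrier_mat 3 3" "M\<^sup>T = M"
    and det: "det M = [:\<delta>:]" "\<delta> \<noteq> 0"
  shows "isometric (map_mat (\<lambda>p. poly p s) M) (map_mat (\<lambda>p. poly p t) M)"
proof -
  have Msym: "M $$ (j, i) = M $$ (i, j)" if "i < 3" "j < 3" for i j
    using that M(1) index_transpose_mat(1)[of i M j] M(2) by simp
  have bsym: "bil M 3 x y = bil M 3 y x" for x y
    using Msym[of 0 1] Msym[of 0 2] Msym[of 1 2]
    unfolding bil_def sum_3 by (simp add: algebra_simps)
  interpret sym_bilinear "bil M 3" "[:\<delta>:]"
    by unfold_locales (simp_all add: bil_add_left bil_scale_left bsym)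
  define e where "e i = (\<lambda>a. if a = i then 1 else 0 :: 'a poly)" for i :: nat
  have "gram (M $$ (0, 0)) (M $$ (0, 1)) (M $$ (0, 2)) (M $$ (1, 1)) (M $$ (1, 2)) (M $$ (2, 2))"
    unfolding gram_def
  proof
    show "det3 (M $$ (0, 0)) (M $$ (0, 1)) (M $$ (0, 2)) (M $$ (1, 1)) (M $$ (1, 2)) (M $$ (2, 2)) = [:\<delta>:]"
      using det_3_sym[OF M] det(1) by simp
  qed (rule exI[of _ "e 0"], rule exI[of _ "e 1"], rule exI[of _ "e 2"], simp add: bil_def sum_3 e_def)
  from gram_const[OF sym_bilinear_axioms two det(2) this] obtain a b c d f g where
    G: "gram [:a:] [:b:] [:c:] [:d:] [:f:] [:g:]"
    by blast
  then obtain x y z where xyz: "bil M 3 x x = [:a:]" "bil M 3 x y = [:b:]" "bil M 3 x z = [:c:]"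
    "bil M 3 y y = [:d:]" "bil M 3 y z = [:f:]" "bil M 3 z z = [:g:]"
    unfolding gram_def by blast
  define L where "L = [[a, b, c], [b, d, f], [c, f, g]]"
  define N where "N = mat 3 3 (\<lambda>(i, j). L ! i ! j)"
  have N: "N \<in> carrier_mat 3 3" by (simp add: N_def)
  have "[:det N:] = det3 [:a:] [:b:] [:c:] [:d:] [:f:] [:g:]"
    unfolding det_3[OF N] det3_def by (simp add: N_def L_def algebra_simps)
  hence detN: "det N \<noteq> 0" using G det(2) by (simp add: gram_def)
  have iso: "isometric (map_mat (\<lambda>p. poly p u) M) N" for u
  proof -
    have ev: "bil (map_mat (\<lambda>p. poly p u) M) 3 (\<lambda>a. poly (x a) u) (\<lambda>a. poly (y a) u) = poly (bil M 3 x y) u"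
      for x y using M(1) by (simp add: bil_def sum_3)
    define v where "v i = (\<lambda>a. poly (([x, y, z] ! i) a) u)" for i
    have "bil (map_mat (\<lambda>p. poly p u) M) 3 (v i) (v j) = N $$ (i, j)" if "i < 3" "j < 3" for i j
      using less_3_cases[OF that(1)] less_3_cases[OF that(2)] xyz(2)[unfolded bsym[of x y]]
        xyz(3)[unfolded bsym[of x z]] xyz(5)[unfolded bsym[of y z]]
      unfolding v_def ev by (elim disjE) (simp_all add: N_def L_def xyz)
    thus ?thesis using isometric_iff_bil[of "map_mat (\<lambda>p. poly p u) M" 3 N] M(1) N detN by auto
  qed
  have c: "map_mat (\<lambda>p. poly p u) M \<in> carrier_mat 3 3" for u using M(1) by simp
  show ?thesis by (rule isometric_trans[OF iso isometric_sym[OF iso c] c])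
qed

section \<open>Paths of Hankel matrices\<close>

text \<open>The catalecticant of a quartic functional, invariant under the substitution of v + T u
  for v.\<close>

definition hdet :: "'r::comm_ring_1 \<Rightarrow> 'r \<Rightarrow> 'r \<Rightarrow> 'r \<Rightarrow> 'r \<Rightarrow> 'r" where
  "hdet a b c d e = a * c * e + 2 * b * c * d - c * c * c - a * d * d - b * b * e"

definition hankel :: "'r \<Rightarrow> 'r \<Rightarrow> 'r \<Rightarrow> 'r \<Rightarrow> 'r \<Rightarrow> 'r mat" where
  "hankel a b c d e = mat 3 3 (\<lambda>(i, j). [a, b, c, d, e] ! (i + j))"

lemma hankel_carrier [simp]: "hankel a b c d e \<in> carrier_mat 3 3"
  by (simp add: hankel_def)

lemma hankel_transpose: "(hankel a b c d e)\<^sup>T = hankel a b c d e"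
  by (rule eq_matI) (auto simp: hankel_def add.commute)

lemma det_hankel: "det (hankel a b c d e) = hdet a b c d e"
  unfolding det_3[OF hankel_carrier] by (simp add: hankel_def hdet_def algebra_simps)

lemma hankel_symmetric_form: "hdet a b c d e \<noteq> 0 \<Longrightarrow> hankel a b c d e \<in> symmetric_forms"
  by (intro symmetric_formsI[OF hankel_carrier hankel_transpose]) (simp add: det_hankel)

lemma hdet_const: "hdet [:a:] [:b:] [:c:] [:d:] [:e:] = [:hdet a b c d e:]"
  by (simp add: hdet_def numeral_poly)

text \<open>
  The constant entry is needed to lift the path to a path of quadruples of quartic forms.
\<close>
inductive_set hankel_path ::
    "(('a::field \<times> 'a \<times> 'a \<times> 'a \<times> 'a) \<times> ('a \<times> 'a \<times> 'a \<times> 'a \<times> 'a)) set" where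
  "hdet a b c d e = [:\<delta>:] \<Longrightarrow> \<delta> \<noteq> 0 \<Longrightarrow> k \<noteq> 0 \<Longrightarrow> [:k:] \<in> {a, b, c} \<Longrightarrow>
   ((poly a s, poly b s, poly c s, poly d s, poly e s),
    (poly a t, poly b t, poly c t, poly d t, poly e t)) \<in> hankel_path"

text \<open>The parameters \<open>s\<close> and \<open>t\<close> of a path are arbitrary and can be
  exchanged.\<close>

lemma hankel_path_sym: "(x, y) \<in> hankel_path\<^sup>* \<Longrightarrow> (y, x) \<in> hankel_path\<^sup>*"
proof (rule symD[OF sym_rtrancl])
  show "sym hankel_path"
    by (rule symI) (auto elim!: hankel_path.cases intro: hankel_path.intros)
qed

lemma poly_hdet: "poly (hdet a b c d e) t = hdet (poly a t) (poly b t) (poly c t) (poly d t) (poly e t)"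
  by (simp add: hdet_def)

lemma map_poly_hankel:
  "map_mat (\<lambda>p. poly p u) (hankel a b c d e) = hankel (poly a u) (poly b u) (poly c u) (poly d u) (poly e u)"
proof (rule eq_matI)
  fix i j assume "i < dim_row (hankel (poly a u) (poly b u) (poly c u) (poly d u) (poly e u))"
    "j < dim_col (hankel (poly a u) (poly b u) (poly c u) (poly d u) (poly e u))"
  hence ij: "i < 3" "j < 3" by (simp_all add: hankel_def)
  show "map_mat (\<lambda>p. poly p u) (hankel a b c d e) $$ (i, j) =
      hankel (poly a u) (poly b u) (poly c u) (poly d u) (poly e u) $$ (i, j)"
    using less_3_cases[OF ij(1)] less_3_cases[OF ij(2)]
    by (elim disjE) (simp_all add: hankel_def)
qed (simp_all add: hankel_def)

lemma hankel_path_isometric: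
  assumes two: "(2::'a::field) \<noteq> 0" and "(x, y) \<in> hankel_path\<^sup>*"
    and "x = (a, b, c, d, e)" "y = (a', b', c', d', e' :: 'a)"
  shows "isometric (hankel a b c d e) (hankel a' b' c' d' e') \<and> hdet a b c d e = hdet a' b' c' d' e'"
  using assms(2-)
proof (induction arbitrary: a' b' c' d' e' rule: rtrancl_induct)
  case base
  thus ?case using isometric_refl[OF hankel_carrier] by auto
next
  case (step y z)
  obtain a1 b1 c1 d1 e1 where y: "y = (a1, b1, c1, d1, e1)" by (metis prod_cases5)
  note IH = step.IH[OF step.prems(1) y]
  have "isometric (hankel a1 b1 c1 d1 e1) (hankel a' b' c' d' e') \<and>
      hdet a1 b1 c1 d1 e1 = hdet a' b' c' d' e'"
    using step.hyps(2) unfolding y step.prems(2)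
  proof (cases rule: hankel_path.cases)
    case (1 A B C D E \<delta> k s t)
    have "isometric (map_mat (\<lambda>p. poly p s) (hankel A B C D E)) (map_mat (\<lambda>p. poly p t) (hankel A B C D E))"
      by (rule isometric_specializations[OF two hankel_carrier hankel_transpose _ 1(12)])
         (simp add: det_hankel 1(11))
    moreover have "hdet (poly A u) (poly B u) (poly C u) (poly D u) (poly E u) = \<delta>" for u
      unfolding poly_hdet[symmetric] 1(11) by simp
    ultimately show ?thesis unfolding map_poly_hankel 1(1-10) by simp
  qed
  thus ?case using IH isometric_trans[OF _ _ hankel_carrier] by auto
qed

section \<open>Moving diagonal forms inside the Hankel matrices\<close>

lemma const_inverse: "(k::'a::field) \<noteq> 0 \<Longrightarrow> [:k:] * ([:1 / k:] * x) = x"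
  by simp

text \<open>The Schur complement of the corner \<open>a\<close> is the binary form with rows b h and
  h y. The summand b^2 / a makes up for the entry b in position (0, 2), which the Hankel shape
  forces.\<close>

abbreviation binary_diag :: "'a::field \<Rightarrow> 'a \<Rightarrow> 'a \<Rightarrow> 'a \<Rightarrow> 'a \<times> 'a \<times> 'a \<times> 'a \<times> 'a" where
  "binary_diag a b h y \<equiv> (a, 0, b, h, y + b * b / a)"

text \<open>The Schur complement is now diagonal: the form is isometric to the diagonal form with
  entries a, b, c.\<close>

abbreviation normal_form :: "'a::field \<Rightarrow> 'a \<Rightarrow> 'a \<Rightarrow> 'a \<times> 'a \<times> 'a \<times> 'a \<times> 'a" where
  "normal_form a b c \<equiv> (a, 0, b, 0, c + b * b / a)"

text \<open>For r nonzero a matrix of determinant 1 is a product of an upper, a lower and an upper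
  transvection, with parameters \<sigma>, r and \<tau>. The discriminant d is carried along because
  the moves are available only for forms with that discriminant.\<close>

lemma SL2_generated:
  fixes b h y p q r s :: "'a::field"
  assumes trans: "\<And>x y z. E x y \<Longrightarrow> E y z \<Longrightarrow> E x z"
    and U: "\<And>b h y t. b * y - h * h = d \<Longrightarrow> E (b, h, y) (b, h + t * b, y + 2 * t * h + t * t * b)"
    and L: "\<And>b h y t. b * y - h * h = d \<Longrightarrow> E (b, h, y) (b + 2 * t * h + t * t * y, h + t * y, y)"
    and d: "b * y - h * h = d" and det: "p * s - q * r = 1"
  shows "E (b, h, y) (p * p * b + 2 * p * r * h + r * r * y,
    p * q * b + (p * s + q * r) * h + r * s * y, q * q * b + 2 * q * s * h + s * s * y)"
proof -
  have ULU: "E (b, h, y) (p * p * b + 2 * p * r * h + r * r * y,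
    p * q * b + (p * s + q * r) * h + r * s * y, q * q * b + 2 * q * s * h + s * s * y)"
    if d: "b * y - h * h = d" and det: "p * s - q * r = 1" and r: "r \<noteq> 0" for b h y p q r s
  proof -
    define \<sigma> where "\<sigma> = (p - 1) / r"
    define \<tau> where "\<tau> = (s - 1) / r"
    have p: "p = 1 + r * \<sigma>" and s: "s = 1 + \<tau> * r" using r by (simp_all add: \<sigma>_def \<tau>_def)
    have "r * q = r * (\<sigma> + \<tau> * p)" using det unfolding p s by (simp add: algebra_simps)
    hence q: "q = \<sigma> + \<tau> * p" using r by simp
    define h1 y1 where "h1 = h + \<sigma> * b" "y1 = y + 2 * \<sigma> * h + \<sigma> * \<sigma> * b"
    have d1: "b * y1 - h1 * h1 = d" using d by (simp add: h1_y1_def algebra_simps)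
    define b2 h2 where "b2 = b + 2 * r * h1 + r * r * y1" "h2 = h1 + r * y1"
    have d2: "b2 * y1 - h2 * h2 = d" using d1 by (simp add: b2_h2_def algebra_simps)
    have "E (b, h, y) (b, h1, y1)" unfolding h1_y1_def by (rule U[OF d])
    moreover have "E (b, h1, y1) (b2, h2, y1)" unfolding b2_h2_def by (rule L[OF d1])
    moreover have "E (b2, h2, y1) (b2, h2 + \<tau> * b2, y1 + 2 * \<tau> * h2 + \<tau> * \<tau> * b2)" by (rule U[OF d2])
    ultimately have "E (b, h, y) (b2, h2 + \<tau> * b2, y1 + 2 * \<tau> * h2 + \<tau> * \<tau> * b2)"
      by (blast intro: trans)
    moreover have "b2 = p * p * b + 2 * p * r * h + r * r * y"
      by (simp add: b2_h2_def h1_y1_def p algebra_simps)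
    moreover have "h2 + \<tau> * b2 = p * q * b + (p * s + q * r) * h + r * s * y"
      by (simp add: b2_h2_def h1_y1_def q s p algebra_simps)
    moreover have "y1 + 2 * \<tau> * h2 + \<tau> * \<tau> * b2 = q * q * b + 2 * q * s * h + s * s * y"
      by (simp add: b2_h2_def h1_y1_def q s p algebra_simps)
    ultimately show ?thesis by simp
  qed
  show ?thesis
  proof (cases "r = 0")
    case False
    thus ?thesis using ULU[OF d det] by blast
  next
    case True
    have p: "p \<noteq> 0" using det True by auto
    \<comment> \<open>The form in the basis e_1 + e_2, e_2, where the vector p e_1 has the nonzero
      second coordinate -p; this returns to the case treated above.\<close>
    define b1 h1 where "b1 = b + 2 * 1 * h + 1 * 1 * y" "h1 = h + 1 * y"
    have E1: "E (b, h, y) (b1, h1, y)" unfolding b1_h1_def by (rule L[OF d])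
    have d1: "b1 * y - h1 * h1 = d" using d by (simp add: b1_h1_def algebra_simps)
    have det1: "p * (s - q) - q * (- p) = 1" using det True by (simp add: algebra_simps)
    have "- p \<noteq> 0" using p by simp
    from trans[OF E1 ULU[OF d1 det1 this]]
    have "E (b, h, y) (p * p * b1 + 2 * p * (- p) * h1 + (- p) * (- p) * y,
      p * q * b1 + (p * (s - q) + q * (- p)) * h1 + (- p) * (s - q) * y,
      q * q * b1 + 2 * q * (s - q) * h1 + (s - q) * (s - q) * y)"
      .
    moreover have "p * p * b1 + 2 * p * (- p) * h1 + (- p) * (- p) * y = p * p * b + 2 * p * r * h + r * r * y"
      by (simp add: True b1_h1_def algebra_simps)
    moreover have "p * q * b1 + (p * (s - q) + q * (- p)) * h1 + (- p) * (s - q) * y =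
        p * q * b + (p * s + q * r) * h + r * s * y"
      by (simp add: True b1_h1_def algebra_simps)
    moreover have "q * q * b1 + 2 * q * (s - q) * h1 + (s - q) * (s - q) * y = q * q * b + 2 * q * s * h + s * s * y"
      by (simp add: b1_h1_def algebra_simps)
    ultimately show ?thesis by simp
  qed
qed

lemma hankel_pathI:
  assumes "hdet a b c d e = [:\<delta>:]" "\<delta> \<noteq> 0" "k \<noteq> 0" "[:k:] \<in> {a, b, c}"
    and "x = (poly a s, poly b s, poly c s, poly d s, poly e s)"
    and "y = (poly a t, poly b t, poly c t, poly d t, poly e t)"
  shows "(x, y) \<in> hankel_path\<^sup>*"
  unfolding assms(5,6) by (intro r_into_rtrancl hankel_path.intros[OF assms(1-4)])

text \<open>The complement of \<open>a\<close> runs through transvections with parameter T, so its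
  determinant is constant, and \<open>a\<close> itself is the constant entry.\<close>

lemma hankel_path_binary_U:
  assumes "a \<noteq> 0" "b * y - h * h \<noteq> 0"
  shows "(binary_diag a b h y, binary_diag a b (h + t * b) (y + 2 * t * h + t * t * b)) \<in> hankel_path\<^sup>*"
proof -
  define Z Y where "Z = [:h:] + [:0, 1:] * [:b:]"
    "Y = [:y:] + 2 * [:0, 1:] * [:h:] + [:0, 1:] * [:0, 1:] * [:b:] + [:1 / a:] * ([:b:] * [:b:])"
  have "hdet [:a:] 0 [:b:] Z Y = [:b:] * ([:a:] * Y) - [:b:] * [:b:] * [:b:] - [:a:] * Z * Z"
    by (simp add: hdet_def algebra_simps)
  also have "[:a:] * Y = [:a:] * ([:y:] + 2 * [:0, 1:] * [:h:] + [:0, 1:] * [:0, 1:] * [:b:]) + [:b:] * [:b:]"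
    unfolding Z_Y_def distrib_left const_inverse[OF assms(1)] ..
  also have "[:b:] * \<dots> - [:b:] * [:b:] * [:b:] - [:a:] * Z * Z = [:a:] * ([:b:] * [:y:] - [:h:] * [:h:])"
    unfolding Z_Y_def by (simp only: algebra_simps) (simp add: numeral_poly)
  also have "\<dots> = [:a * (b * y - h * h):]" by simp
  finally have hd: "hdet [:a:] 0 [:b:] Z Y = [:a * (b * y - h * h):]" .
  show ?thesis
    by (rule hankel_pathI[OF hd _ assms(1), where s = 0 and t = t])
       (use assms in \<open>simp_all add: Z_Y_def algebra_simps\<close>)
qed

text \<open>Here the entry b moves along \<open>W\<close>. By the Hankel shape it occurs a second
  time, in position (0, 2), and the last entry has to follow with W^2 / a.\<close>

lemma hankel_path_binary_L:
  assumes "a \<noteq> 0" "b * y - h * h \<noteq> 0"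
  shows "(binary_diag a b h y, binary_diag a (b + 2 * t * h + t * t * y) (h + t * y) y) \<in> hankel_path\<^sup>*"
proof -
  define Z W where "Z = [:h:] + [:0, 1:] * [:y:]"
    "W = [:b:] + 2 * [:0, 1:] * [:h:] + [:0, 1:] * [:0, 1:] * [:y:]"
  define Y where "Y = [:y:] + [:1 / a:] * (W * W)"
  have "hdet [:a:] 0 W Z Y = W * ([:a:] * Y) - W * W * W - [:a:] * Z * Z"
    by (simp add: hdet_def algebra_simps)
  also have "[:a:] * Y = [:a:] * [:y:] + W * W"
    unfolding Y_def distrib_left const_inverse[OF assms(1)] ..
  also have "W * \<dots> - W * W * W - [:a:] * Z * Z = [:a:] * (W * [:y:] - Z * Z)"
    by (simp only: algebra_simps)
  also have "W * [:y:] - Z * Z = [:b:] * [:y:] - [:h:] * [:h:]"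
    unfolding Z_W_def by (simp only: algebra_simps) (simp add: numeral_poly)
  also have "[:a:] * \<dots> = [:a * (b * y - h * h):]" by simp
  finally have hd: "hdet [:a:] 0 W Z Y = [:a * (b * y - h * h):]" .
  show ?thesis
    by (rule hankel_pathI[OF hd _ assms(1), where s = 0 and t = t])
       (use assms in \<open>simp_all add: Z_W_def Y_def algebra_simps add_divide_distrib\<close>)
qed

lemma hankel_path_last_two:
  assumes "a \<noteq> 0" "b \<noteq> 0" "c \<noteq> 0" "b' = b * p * p + c * r * r" "b' \<noteq> 0"
  shows "(normal_form a b c, normal_form a b' (b * c / b')) \<in> hankel_path\<^sup>*"
proof -
  \<comment> \<open>The second basis vector is orthogonal to (p, r) and scaled to make the
    determinant 1.\<close>
  define q s where "q = - (r * c / b')" "s = p * b / b'"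
  have "p * s - q * r = (b * p * p + c * r * r) / b'"
    by (simp add: q_s_def add_divide_distrib algebra_simps)
  hence det: "p * s - q * r = 1" using assms(4,5) by simp
  define E where "E x y \<longleftrightarrow> ((case x of (b, h, y) \<Rightarrow> binary_diag a b h y),
    (case y of (b, h, y) \<Rightarrow> binary_diag a b h y)) \<in> hankel_path\<^sup>*" for x y
  have "E (b, 0, c) (p * p * b + 2 * p * r * 0 + r * r * c,
    p * q * b + (p * s + q * r) * 0 + r * s * c, q * q * b + 2 * q * s * 0 + s * s * c)"
  proof (rule SL2_generated[where d = "b * c"])
    show "E x y \<Longrightarrow> E y z \<Longrightarrow> E x z" for x y z unfolding E_def by (rule rtrancl_trans)
    show "E (b', h, y) (b', h + t * b', y + 2 * t * h + t * t * b')" if "b' * y - h * h = b * c" for b' h y t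
      using hankel_path_binary_U[OF assms(1), of b' y h t] that assms(2,3) by (simp add: E_def)
    show "E (b', h, y) (b' + 2 * t * h + t * t * y, h + t * y, y)" if "b' * y - h * h = b * c" for b' h y t
      using hankel_path_binary_L[OF assms(1), of b' y h t] that assms(2,3) by (simp add: E_def)
  qed (use det in simp_all)
  moreover have "p * p * b + 2 * p * r * 0 + r * r * c = b'" using assms(4) by (simp add: algebra_simps)
  moreover have "p * q * b + (p * s + q * r) * 0 + r * s * c = 0" by (simp add: q_s_def)
  moreover have "q * q * b + 2 * q * s * 0 + s * s * c = b * c / b'"
  proof -
    have "q * q * b + 2 * q * s * 0 + s * s * c = b * c * (b * p * p + c * r * r) / (b' * b')"
      by (simp add: q_s_def add_divide_distrib algebra_simps)
    also have "\<dots> = b * c / b'" using assms(4,5) by simp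
    finally show ?thesis .
  qed
  ultimately show ?thesis by (simp add: E_def)
qed

text \<open>
  The Schur complement of the upper left \<open>2 \<times> 2\<close> block is kept constant.
\<close>
lemma hankel_path_block:
  assumes "d \<noteq> 0" "c \<noteq> 0" and hd: "u * w - v * v = [:d:]" and k: "k \<noteq> 0" "[:k:] \<in> {u, v, w}"
  shows "((poly u s, poly v s, poly w s, 0, c + poly w s * poly w s * poly w s / d),
    (poly u t, poly v t, poly w t, 0, c + poly w t * poly w t * poly w t / d)) \<in> hankel_path\<^sup>*"
proof -
  define Y where "Y = [:c:] + [:1 / d:] * (w * w * w)"
  have "hdet u v w 0 Y = (u * w - v * v) * Y - w * w * w" by (simp add: hdet_def algebra_simps)
  also have "\<dots> = [:d:] * [:c:]" unfolding hd Y_def distrib_left const_inverse[OF assms(1)] by simp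
  finally have "hdet u v w 0 Y = [:d * c:]" by simp
  from hankel_pathI[OF this _ k refl refl, of s t] show ?thesis using assms by (simp add: Y_def)
qed

text \<open>Now the upper left block with entries u, v, w moves while its determinant d = a b stays.
  The block overlaps the entry w in position (0, 2); with fourth entry 0 the last one compensates by
  w^3 / d, which equals b^2 / a at the start.\<close>

lemma hankel_path_first_two:
  assumes "a \<noteq> 0" "b \<noteq> 0" "c \<noteq> 0" "a' = a * p * p + b * r * r" "a' \<noteq> 0"
  shows "(normal_form a b c, normal_form a' (a * b / a') c) \<in> hankel_path\<^sup>*"
proof -
  define q s where "q = - (r * b / a')" "s = p * a / a'"
  have "p * s - q * r = (a * p * p + b * r * r) / a'"
    by (simp add: q_s_def add_divide_distrib algebra_simps)
  hence det: "p * s - q * r = 1" using assms(4,5) by simp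
  define d where "d = a * b"
  have d: "d \<noteq> 0" using assms by (simp add: d_def)
  define f :: "'a \<times> 'a \<times> 'a \<Rightarrow> 'a \<times> 'a \<times> 'a \<times> 'a \<times> 'a" where "f = (\<lambda>(u, v, w). (u, v, w, 0, c + w * w * w / d))"
  define E where "E x y \<longleftrightarrow> (f x, f y) \<in> hankel_path\<^sup>*" for x y
  have "E (a, 0, b) (p * p * a + 2 * p * r * 0 + r * r * b,
    p * q * a + (p * s + q * r) * 0 + r * s * b, q * q * a + 2 * q * s * 0 + s * s * b)"
  proof (rule SL2_generated[where d = d])
    show "E x y \<Longrightarrow> E y z \<Longrightarrow> E x z" for x y z unfolding E_def by (rule rtrancl_trans)
    show "E (u, v, w) (u, v + t * u, w + 2 * t * v + t * t * u)" if uvw: "u * w - v * v = d" for u v w t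
    proof -
      let ?v = "[:v:] + [:0, 1:] * [:u:] :: 'a poly"
      let ?w = "[:w:] + 2 * [:0, 1:] * [:v:] + [:0, 1:] * [:0, 1:] * [:u:] :: 'a poly"
      have "[:u:] * ?w - ?v * ?v = [:u:] * [:w:] - [:v:] * [:v:]" by (simp only: algebra_simps) (simp add: numeral_poly)
      also have "\<dots> = [:d:]" using uvw by (simp add: mult.commute)
      finally have hd: "[:u:] * ?w - ?v * ?v = [:d:]" .
      \<comment> \<open>The fixed entry u is constant; if it is 0, then \<open>?v\<close> is the
        constant v, nonzero because u w - v^2 = d.\<close>
      have "\<exists>k. k \<noteq> 0 \<and> [:k:] \<in> {[:u:], ?v, ?w}"
      proof (cases "u = 0")
        case True
        hence "v \<noteq> 0" using uvw d by auto
        thus ?thesis using True by (intro exI[of _ v]) simp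
      qed (auto intro!: exI[of _ u])
      then obtain k where k: "k \<noteq> 0" "[:k:] \<in> {[:u:], ?v, ?w}" by blast
      from hankel_path_block[OF d assms(3) hd k, where s = 0 and t = t] show ?thesis
        by (simp add: E_def f_def algebra_simps)
    qed
    show "E (u, v, w) (u + 2 * t * v + t * t * w, v + t * w, w)" if uvw: "u * w - v * v = d" for u v w t
    proof -
      let ?v = "[:v:] + [:0, 1:] * [:w:] :: 'a poly"
      let ?u = "[:u:] + 2 * [:0, 1:] * [:v:] + [:0, 1:] * [:0, 1:] * [:w:] :: 'a poly"
      have "?u * [:w:] - ?v * ?v = [:u:] * [:w:] - [:v:] * [:v:]" by (simp only: algebra_simps) (simp add: numeral_poly)
      also have "\<dots> = [:d:]" using uvw by (simp add: mult.commute)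
      finally have hd: "?u * [:w:] - ?v * ?v = [:d:]" .
      have "\<exists>k. k \<noteq> 0 \<and> [:k:] \<in> {?u, ?v, [:w:]}"
      proof (cases "w = 0")
        case True
        hence "v \<noteq> 0" using uvw d by auto
        thus ?thesis using True by (intro exI[of _ v]) simp
      qed (auto intro!: exI[of _ w])
      then obtain k where k: "k \<noteq> 0" "[:k:] \<in> {?u, ?v, [:w:]}" by blast
      from hankel_path_block[OF d assms(3) hd k, where s = 0 and t = t] show ?thesis
        by (simp add: E_def f_def algebra_simps)
    qed
  qed (use det in \<open>simp_all add: d_def\<close>)
  moreover have "p * p * a + 2 * p * r * 0 + r * r * b = a'" using assms(4) by (simp add: algebra_simps)
  moreover have "p * q * a + (p * s + q * r) * 0 + r * s * b = 0" by (simp add: q_s_def)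
  moreover have "q * q * a + 2 * q * s * 0 + s * s * b = a * b / a'"
  proof -
    have "q * q * a + 2 * q * s * 0 + s * s * b = a * b * (a * p * p + b * r * r) / (a' * a')"
      by (simp add: q_s_def add_divide_distrib algebra_simps)
    also have "\<dots> = a * b / a'" using assms(4,5) by simp
    finally show ?thesis .
  qed
  ultimately have "E (a, 0, b) (a', 0, a * b / a')" by simp
  moreover have "b * b * b / d = b * b / a" using assms by (simp add: d_def)
  moreover have "(a * b / a') * (a * b / a') * (a * b / a') / d = (a * b / a') * (a * b / a') / a'"
    using assms(1,2,5) by (simp add: d_def)
  ultimately show ?thesis by (simp add: E_def f_def)
qed

text \<open>A nonzero corner is produced, a substitution of v clears the second entry, and the
  binary complement is diagonalised by completing the square.\<close>

lemma hankel_path_normal_form: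
  fixes x0 x1 x2 x3 x4 :: "'a::field"
  assumes two: "(2::'a) \<noteq> 0" and hd: "hdet x0 x1 x2 x3 x4 \<noteq> 0"
  shows "\<exists>a b c. a \<noteq> 0 \<and> b \<noteq> 0 \<and> c \<noteq> 0 \<and>
    ((x0, x1, x2, x3, x4), normal_form a b c) \<in> hankel_path\<^sup>*"
proof -
  have 1: "\<exists>y0 y1 y2 y3 y4. y0 \<noteq> 0 \<and> ((x0, x1, x2, x3, x4), (y0, y1, y2, y3, y4)) \<in> hankel_path\<^sup>*"
  proof -
    consider "x0 \<noteq> 0" | "x0 = 0" "x1 \<noteq> 0" | "x0 = 0" "x1 = 0" by blast
    thus ?thesis
    proof cases
      case 1
      thus ?thesis by blast
    next
      case 2
      \<comment> \<open>With x0 = 0 the determinant is linear in the last entry with coefficient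
        -x1^2. The middle entries can therefore shrink to 0 while \<open>Y\<close> is solved from
        the determinant.\<close>
      define \<delta> where "\<delta> = hdet x0 x1 x2 x3 x4"
      define V W Y where "V = [:0, x2:]" "W = [:0, x3:]"
        "Y = [:1 / (x1 * x1):] * (2 * [:x1:] * V * W - V * V * V - [:\<delta>:])"
      have "hdet 0 [:x1:] V W Y = 2 * [:x1:] * V * W - V * V * V - [:x1 * x1:] * Y"
        by (simp add: hdet_def)
      also have "[:x1 * x1:] * Y = 2 * [:x1:] * V * W - V * V * V - [:\<delta>:]"
        unfolding V_W_Y_def using 2 by (intro const_inverse) simp
      finally have hd1: "hdet 0 [:x1:] V W Y = [:\<delta>:]" by simp
      have d: "\<delta> \<noteq> 0" using hd by (simp add: \<delta>_def)
      have Y1: "poly Y 1 = x4"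
      proof -
        have "poly Y 1 = 1 / (x1 * x1) * (2 * x1 * x2 * x3 - x2 * x2 * x2 - \<delta>)"
          by (simp add: V_W_Y_def algebra_simps)
        hence "x1 * x1 * poly Y 1 = 2 * x1 * x2 * x3 - x2 * x2 * x2 - \<delta>" using 2 by simp
        also have "\<dots> = x1 * x1 * x4" by (simp add: \<delta>_def hdet_def 2)
        finally show ?thesis using 2 by simp
      qed
      define e where "e = poly Y 0"
      have "((x0, x1, x2, x3, x4), (0, x1, 0, 0, e)) \<in> hankel_path\<^sup>*"
        by (rule hankel_pathI[OF hd1 d 2(2), where s = 1 and t = 0])
           (simp_all add: Y1 2 e_def V_W_Y_def(1,2))
      \<comment> \<open>At this shape the determinant is -x1^2 e whatever the corner is, so the
        corner can move to 1.\<close>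
      moreover have "((0, x1, 0, 0, e), (1, x1, 0, 0, e)) \<in> hankel_path\<^sup>*"
      proof (rule hankel_pathI[where a = "[:0, 1:]" and b = "[:x1:]" and c = 0 and d = 0 and e = "[:e:]"
            and s = 0 and t = 1 and \<delta> = "- (x1 * x1 * e)" and k = x1])
        have "- (x1 * x1 * e) = hdet 0 x1 0 0 e" by (simp add: hdet_def)
        also have "\<dots> = poly (hdet 0 [:x1:] V W Y) 0"
          unfolding poly_hdet by (simp add: e_def V_W_Y_def(1,2))
        also have "\<dots> = \<delta>" unfolding hd1 by simp
        finally show "- (x1 * x1 * e) \<noteq> 0" using d by simp
      qed (use 2 in \<open>simp_all add: hdet_def\<close>)
      ultimately have "((x0, x1, x2, x3, x4), (1, x1, 0, 0, e)) \<in> hankel_path\<^sup>*"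
        by (rule rtrancl_trans)
      thus ?thesis by (intro exI conjI) (rule one_neq_zero)
    next
      case 3
      \<comment> \<open>With x0 = x1 = 0 the determinant is -x2^3, so x3 and x4 may shrink to 0;
        after that it no longer involves the corner.\<close>
      hence x2: "x2 \<noteq> 0" using hd by (auto simp: hdet_def)
      have "((x0, x1, x2, x3, x4), (0, 0, x2, 0, 0)) \<in> hankel_path\<^sup>*"
        by (rule hankel_pathI[where a = 0 and b = 0 and c = "[:x2:]" and d = "[:0, x3:]" and e = "[:0, x4:]"
              and s = 1 and t = 0 and \<delta> = "- (x2 * x2 * x2)" and k = x2])
           (use x2 3 in \<open>simp_all add: hdet_def\<close>)
      moreover have "((0, 0, x2, 0, 0), (1, 0, x2, 0, 0)) \<in> hankel_path\<^sup>*"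
        by (rule hankel_pathI[where a = "[:0, 1:]" and b = 0 and c = "[:x2:]" and d = 0 and e = 0
              and s = 0 and t = 1 and \<delta> = "- (x2 * x2 * x2)" and k = x2])
           (use x2 in \<open>simp_all add: hdet_def\<close>)
      ultimately have "((x0, x1, x2, x3, x4), (1, 0, x2, 0, 0)) \<in> hankel_path\<^sup>*"
        by (rule rtrancl_trans)
      thus ?thesis by (intro exI conjI) (rule one_neq_zero)
    qed
  qed
  then obtain y0 y1 y2 y3 y4 where y: "y0 \<noteq> 0"
    "((x0, x1, x2, x3, x4), (y0, y1, y2, y3, y4)) \<in> hankel_path\<^sup>*" by blast
  have hdy: "hdet y0 y1 y2 y3 y4 \<noteq> 0"
    using hankel_path_isometric[OF two y(2) refl refl] hd by simp
  have "\<exists>z2 z3 z4. ((y0, y1, y2, y3, y4), (y0, 0, z2, z3, z4)) \<in> hankel_path\<^sup>*"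
  proof -
    let ?T = "[:0, 1:] :: 'a poly"
    define c0 c1 c2 c3 c4 where "c0 = [:y0:]" "c1 = [:y1:]" "c2 = [:y2:]" "c3 = [:y3:]" "c4 = [:y4:]"
    \<comment> \<open>The effect on the functional of substituting v + T u for v, hence the binomial
      coefficients. At T = - y1 / y0 the second entry vanishes.\<close>
    define p1 p2 p3 p4 where "p1 = c1 + ?T * c0" "p2 = c2 + 2 * ?T * c1 + ?T * ?T * c0"
      "p3 = c3 + 3 * ?T * c2 + 3 * ?T * ?T * c1 + ?T * ?T * ?T * c0"
      "p4 = c4 + 4 * ?T * c3 + 6 * ?T * ?T * c2 + 4 * ?T * ?T * ?T * c1 + ?T * ?T * ?T * ?T * c0"
    have "hdet c0 (c1 + T * c0) (c2 + 2 * T * c1 + T * T * c0)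
        (c3 + 3 * T * c2 + 3 * T * T * c1 + T * T * T * c0)
        (c4 + 4 * T * c3 + 6 * T * T * c2 + 4 * T * T * T * c1 + T * T * T * T * c0) = hdet c0 c1 c2 c3 c4"
      for T :: "'a poly"
      by (simp add: hdet_def algebra_simps)
    from this[of ?T] have "hdet c0 p1 p2 p3 p4 = hdet c0 c1 c2 c3 c4" unfolding p1_p2_p3_p4_def .
    also have "\<dots> = [:hdet y0 y1 y2 y3 y4:]" unfolding c0_c1_c2_c3_c4_def by (rule hdet_const)
    finally have hd2: "hdet c0 p1 p2 p3 p4 = [:hdet y0 y1 y2 y3 y4:]" .
    have "((y0, y1, y2, y3, y4), (y0, 0, poly p2 (- y1 / y0), poly p3 (- y1 / y0), poly p4 (- y1 / y0)))
        \<in> hankel_path\<^sup>*"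
      by (rule hankel_pathI[OF hd2 hdy y(1), where s = 0 and t = "- y1 / y0"])
         (use y(1) in \<open>simp_all add: c0_c1_c2_c3_c4_def p1_p2_p3_p4_def\<close>)
    thus ?thesis by blast
  qed
  then obtain z2 z3 z4 where z: "((y0, y1, y2, y3, y4), (y0, 0, z2, z3, z4)) \<in> hankel_path\<^sup>*" by blast
  have hdz: "hdet y0 0 z2 z3 z4 \<noteq> 0"
    using hankel_path_isometric[OF two z refl refl] hdy by simp
  define w where "w = z4 - z2 * z2 / y0"
  have z4: "z4 = w + z2 * z2 / y0" by (simp add: w_def)
  have "hdet y0 0 z2 z3 z4 = y0 * (z2 * w - z3 * z3)"
    using y(1) by (simp add: hdet_def z4 algebra_simps)
  hence B: "z2 * w - z3 * z3 \<noteq> 0" using hdz by auto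
  have "\<exists>b h v. b \<noteq> 0 \<and> b * v - h * h \<noteq> 0 \<and>
      (binary_diag y0 z2 z3 w, binary_diag y0 b h v) \<in> hankel_path\<^sup>*"
  proof (cases "z2 = 0")
    case False
    thus ?thesis using B by blast
  next
    case True
    hence z3: "z3 \<noteq> 0" using B by auto
    \<comment> \<open>If both t = 1 and t = -1 failed, then 4 z3 would be 0.\<close>
    have "\<exists>t. 2 * t * z3 + t * t * w \<noteq> 0"
    proof (rule ccontr)
      assume "\<nexists>t. 2 * t * z3 + t * t * w \<noteq> 0"
      hence "2 * 1 * z3 + 1 * 1 * w = 0" "2 * (- 1) * z3 + (- 1) * (- 1) * w = 0" by blast+
      hence "2 * z3 + w = 0" "w = 2 * z3" by simp_all
      hence "2 * (2 * z3) = 0" by simp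
      thus False using two z3 by (simp only: mult_eq_0_iff) simp
    qed
    then obtain t where t: "2 * t * z3 + t * t * w \<noteq> 0" by blast
    note hankel_path_binary_L[OF y(1) B, of t]
    moreover have "(z2 + 2 * t * z3 + t * t * w) * w - (z3 + t * w) * (z3 + t * w) = z2 * w - z3 * z3"
      by (simp add: algebra_simps)
    ultimately show ?thesis using B t True
      by (intro exI[of _ "z2 + 2 * t * z3 + t * t * w"] exI[of _ "z3 + t * w"] exI[of _ w]) simp
  qed
  then obtain b h v where bhv: "b \<noteq> 0" "b * v - h * h \<noteq> 0"
    "(binary_diag y0 z2 z3 w, binary_diag y0 b h v) \<in> hankel_path\<^sup>*" by blast
  \<comment> \<open>Completing the square in the binary complement.\<close>
  define t where "t = - h / b"
  define c where "c = v + 2 * t * h + t * t * b"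
  have ht: "h + t * b = 0" using bhv(1) by (simp add: t_def)
  have "b * c - (h + t * b) * (h + t * b) = b * v - h * h" by (simp add: c_def algebra_simps)
  hence c: "c \<noteq> 0" using bhv(2) ht by auto
  have "(binary_diag y0 b h v, normal_form y0 b c) \<in> hankel_path\<^sup>*"
    using hankel_path_binary_U[OF y(1) bhv(2), of t] unfolding ht c_def .
  from rtrancl_trans[OF bhv(3) this] have "((y0, 0, z2, z3, z4), normal_form y0 b c) \<in> hankel_path\<^sup>*"
    unfolding z4 .
  from rtrancl_trans[OF y(2) rtrancl_trans[OF z this]] show ?thesis using y(1) bhv(1) c by blast
qed

section \<open>Diagonal ternary forms and chain equivalence\<close>

definition diag2 :: "'a::zero \<Rightarrow> 'a \<Rightarrow> 'a mat" where
  "diag2 b c = mat 2 2 (\<lambda>(i, j). if i = j then (if i = 0 then b else c) else 0)"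

lemma diag2_carrier [simp]: "diag2 b c \<in> carrier_mat 2 2"
  by (simp add: diag2_def)

lemma det_diag2: "det (diag2 b c) = b * (c::'a::comm_ring_1)"
  by (simp add: det_2[OF diag2_carrier]) (simp add: diag2_def)

lemma bil_diag2: "bil (diag2 b c) 2 x y = b * x 0 * y 0 + c * x 1 * (y 1 :: 'a::comm_ring_1)"
  by (simp add: bil_def diag2_def numeral_2_eq_2)

text \<open>The entry \<open>a\<close> stands last, where \<open>isometric_cancel_1\<close> can
  remove it.\<close>

abbreviation diag_form :: "'a::field \<Rightarrow> 'a \<Rightarrow> 'a \<Rightarrow> 'a mat" where
  "diag_form a b c \<equiv> dsum (diag2 b c) (a \<cdot>\<^sub>m 1\<^sub>m 1)"

lemma diag_form_carrier: "diag_form a b c \<in> carrier_mat 3 3"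
  using dsum_carrier[OF diag2_carrier, of "a \<cdot>\<^sub>m 1\<^sub>m 1" 1] by simp

lemma bil_diag_form: "bil (diag_form a b c) 3 x y = b * x 0 * y 0 + c * x 1 * y 1 + a * x 2 * y 2"
proof -
  have "bil (diag_form a b c) (2 + 1) x y = bil (diag2 b c) 2 x y +
      bil (a \<cdot>\<^sub>m 1\<^sub>m 1) 1 (\<lambda>i. x (2 + i)) (\<lambda>i. y (2 + i))"
    by (rule bil_dsum) simp_all
  moreover have "bil (a \<cdot>\<^sub>m 1\<^sub>m 1) 1 (\<lambda>i. x (2 + i)) (\<lambda>i. y (2 + i)) = a * x 2 * y 2"
    by (simp add: bil_def numeral_2_eq_2)
  ultimately show ?thesis unfolding bil_diag2 by simp
qed

lemma isometric_diag_form_normal_form: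
  fixes a b c :: "'a::field"
  assumes "a \<noteq> 0" "b \<noteq> 0" "c \<noteq> 0"
  shows "isometric (diag_form a b c) (hankel a 0 b 0 (c + b * b / a))"
proof -
  let ?H = "hankel a 0 b 0 (c + b * b / a)"
  have "hdet a 0 b 0 (c + b * b / a) = a * b * c"
    using assms(1) by (simp add: hdet_def algebra_simps)
  hence d: "det ?H \<noteq> 0" using assms by (simp add: det_hankel)
  \<comment> \<open>The basis vectors for a, for b, and for c corrected by b / a times the one for
    a.\<close>
  define p where "p i = (\<lambda>k. [[0, 0, 1], [1, 0, 0], [0, 1, b / a]] ! i ! k)" for i :: nat
  have "bil (diag_form a b c) 3 (p i) (p j) = ?H $$ (i, j)" if "i < 3" "j < 3" for i j
    using less_3_cases[OF that(1)] less_3_cases[OF that(2)] assms(1)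
    unfolding bil_diag_form by (elim disjE) (simp_all add: p_def hankel_def)
  thus ?thesis using isometric_iff_bil[OF diag_form_carrier hankel_carrier d] by blast
qed

text \<open>Witt's chain argument. The form represents a'; a change of the last two entries, if
  necessary, makes the first two represent it, and a second change puts a' in front. Cancelling a'
  leaves isometric binary forms, which one change of the last two entries matches.\<close>

lemma normal_form_chain:
  fixes a b c a' b' c' :: "'a::field"
  assumes two: "(2::'a) \<noteq> 0" and nz: "a \<noteq> 0" "b \<noteq> 0" "c \<noteq> 0" and nz': "a' \<noteq> 0" "b' \<noteq> 0" "c' \<noteq> 0"
    and det: "a * b * c = a' * b' * c'"
    and iso: "isometric (hankel a 0 b 0 (c + b * b / a)) (hankel a' 0 b' 0 (c' + b' * b' / a'))"
  shows "(normal_form a b c, normal_form a' b' c') \<in> hankel_path\<^sup>*"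
proof -
  note d = isometric_diag_form_normal_form
  have diso: "isometric (diag_form a b c) (hankel a' 0 b' 0 (c' + b' * b' / a'))"
    by (rule isometric_trans[OF d[OF nz] iso diag_form_carrier])
  have hn: "hdet x 0 y 0 (z + y * y / x) = x * y * z" if "x \<noteq> 0" for x y z :: 'a
    using that by (simp add: hdet_def algebra_simps)
  have dH: "det (hankel a' 0 b' 0 (c' + b' * b' / a')) \<noteq> 0" using nz' by (simp add: det_hankel hn)
  obtain v where v: "\<And>i j. i < 3 \<Longrightarrow> j < 3 \<Longrightarrow>
      bil (diag_form a b c) 3 (v i) (v j) = hankel a' 0 b' 0 (c' + b' * b' / a') $$ (i, j)"
    using isometric_iff_bil[OF diag_form_carrier hankel_carrier dH, THEN iffD1, OF diso] by blast
  obtain p q r where a': "a' = a * p * p + b * q * q + c * r * r"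
    using v[of 0 0] unfolding bil_diag_form
    by (intro that[of "v 0 2" "v 0 0" "v 0 1"]) (simp add: hankel_def algebra_simps)
  have "\<exists>b1 c1. b1 \<noteq> 0 \<and> c1 \<noteq> 0 \<and> (normal_form a b c, normal_form a' b1 c1) \<in> hankel_path\<^sup>*"
  proof (cases "b * q * q + c * r * r = 0")
    case True
    hence "a' = a * p * p + b * 0 * 0" using a' by (simp add: add.assoc)
    from hankel_path_first_two[OF nz this nz'(1)] show ?thesis
      using nz nz' by (intro exI[of _ "a * b / a'"] exI[of _ c] conjI) simp_all
  next
    case False
    define f where "f = b * q * q + c * r * r"
    have f: "f \<noteq> 0" "b * c / f \<noteq> 0" using False nz by (simp_all add: f_def)
    have 1: "(normal_form a b c, normal_form a f (b * c / f)) \<in> hankel_path\<^sup>*"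
      by (rule hankel_path_last_two[OF nz f_def f(1)])
    have "a' = a * p * p + f * 1 * 1" using a' by (simp add: f_def add.assoc)
    from rtrancl_trans[OF 1 hankel_path_first_two[OF nz(1) f this nz'(1)]] show ?thesis
      using nz nz' f by (intro exI[of _ "a * f / a'"] exI[of _ "b * c / f"] conjI) simp_all
  qed
  then obtain b1 c1 where bc: "b1 \<noteq> 0" "c1 \<noteq> 0"
    and P: "(normal_form a b c, normal_form a' b1 c1) \<in> hankel_path\<^sup>*" by blast
  note I = hankel_path_isometric[OF two P refl refl]
  have det1: "a' * b1 * c1 = a' * b' * c'" using I det by (simp add: hn nz nz')
  hence det1': "b1 * c1 = b' * c'" using nz'(1) by (simp add: mult.assoc)
  have "isometric (hankel a' 0 b1 0 (c1 + b1 * b1 / a')) (hankel a' 0 b' 0 (c' + b' * b' / a'))"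
    using I iso isometric_sym[OF _ hankel_carrier] isometric_trans[OF _ _ hankel_carrier] by blast
  from isometric_trans[OF d[OF nz'(1) bc] this diag_form_carrier]
  have "isometric (diag_form a' b1 c1) (hankel a' 0 b' 0 (c' + b' * b' / a'))" .
  from isometric_trans[OF this isometric_sym[OF d[OF nz'] diag_form_carrier] diag_form_carrier]
  have "isometric (diag_form a' b1 c1) (diag_form a' b' c')" .
  from isometric_cancel_1[OF two diag2_carrier diag2_carrier _ nz'(1) this]
  have "isometric (diag2 b1 c1) (diag2 b' c')" using nz' by (simp add: det_diag2)
  then obtain u where u: "\<And>i j. i < 2 \<Longrightarrow> j < 2 \<Longrightarrow> bil (diag2 b1 c1) 2 (u i) (u j) = diag2 b' c' $$ (i, j)"
    using isometric_iff_bil[OF diag2_carrier diag2_carrier, of b' c' b1 c1] nz' by (auto simp: det_diag2)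
  have "b' = b1 * u 0 0 * u 0 0 + c1 * u 0 1 * u 0 1"
    using u[of 0 0] unfolding bil_diag2 by (simp add: diag2_def)
  note Q = hankel_path_last_two[OF nz'(1) bc this nz'(2)]
  have "b1 * c1 / b' = c'" using det1' nz'(2) by simp
  from rtrancl_trans[OF P Q[unfolded this]] show ?thesis .
qed

theorem hankel_path_if_isometric:
  fixes a b c d e a' b' c' d' e' :: "'a::field"
  assumes two: "(2::'a) \<noteq> 0" and hd: "hdet a b c d e \<noteq> 0" "hdet a' b' c' d' e' = hdet a b c d e"
    and iso: "isometric (hankel a b c d e) (hankel a' b' c' d' e')"
  shows "((a, b, c, d, e), (a', b', c', d', e')) \<in> hankel_path\<^sup>*"
proof -
  obtain p q r where N: "p \<noteq> 0" "q \<noteq> 0" "r \<noteq> 0" "((a, b, c, d, e), normal_form p q r) \<in> hankel_path\<^sup>*"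
    using hankel_path_normal_form[OF two hd(1)] by blast
  obtain p' q' r' where N': "p' \<noteq> 0" "q' \<noteq> 0" "r' \<noteq> 0"
    "((a', b', c', d', e'), normal_form p' q' r') \<in> hankel_path\<^sup>*"
    using hankel_path_normal_form[OF two, of a' b' c' d' e'] hd by auto
  note I = hankel_path_isometric[OF two N(4) refl refl]
  note I' = hankel_path_isometric[OF two N'(4) refl refl]
  have hn: "hdet x 0 y 0 (z + y * y / x) = x * y * z" if "x \<noteq> 0" for x y z :: 'a
    using that by (simp add: hdet_def algebra_simps)
  have "p * q * r = p' * q' * r'" using I I' hd(2) by (simp add: hn N N')
  moreover have "isometric (hankel p 0 q 0 (r + q * q / p)) (hankel p' 0 q' 0 (r' + q' * q' / p'))"
    using I I' iso isometric_sym[OF _ hankel_carrier] isometric_trans[OF _ _ hankel_carrier] by blast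
  ultimately have "(normal_form p q r, normal_form p' q' r') \<in> hankel_path\<^sup>*"
    by (rule normal_form_chain[OF two N(1-3) N'(1-3)])
  from rtrancl_trans[OF N(4) rtrancl_trans[OF this hankel_path_sym[OF N'(4)]]] show ?thesis .
qed

section \<open>The exterior product of four quartic forms\<close>

text \<open>The last row is free, so the determinant is the value at \<open>f\<close> of the
  functional given by the exterior product.\<close>

definition wedge_mat :: "(4 \<Rightarrow> 'r::comm_ring_1 poly poly) \<Rightarrow> (nat \<Rightarrow> 'r) \<Rightarrow> 'r mat" where
  "wedge_mat s f = mat 5 5 (\<lambda>(r, c). if r < 4 then form_coeff 4 (s (of_nat r)) c else f c)"

definition wedge :: "(4 \<Rightarrow> 'r::comm_ring_1 poly poly) \<Rightarrow> nat \<Rightarrow> 'r" where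
  "wedge s i = det (wedge_mat s (\<lambda>c. if c = i then 1 else 0))"

lemma wedge_mat_carrier [simp]: "wedge_mat s f \<in> carrier_mat 5 5"
  by (simp add: wedge_mat_def)

lemma writhe_coord_eq_wedge: "writhe_coord s = wedge s"
  unfolding writhe_coord_def[abs_def] wedge_def[abs_def] wedge_mat_def form_coeff_def ..

lemma sum_5: "(\<Sum>c\<in>{..<5}. f c) = f 0 + f 1 + f 2 + f 3 + f (4::nat)"
  by (simp add: eval_nat_numeral)

lemma less_5_cases: "i < 5 \<Longrightarrow> i = 0 \<or> i = 1 \<or> i = 2 \<or> i = 3 \<or> i = (4::nat)"
  by arith

text \<open>Expansion along the last row, whose cofactors depend on the sections only.\<close>

lemma det_wedge_mat: "det (wedge_mat s f) = (\<Sum>c<5. f c * wedge s c)"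
proof -
  have cof: "cofactor (wedge_mat s f) 4 c = cofactor (wedge_mat s g) 4 c" for f g :: "nat \<Rightarrow> 'a" and c
  proof -
    have "mat_delete (wedge_mat s f) 4 c = mat_delete (wedge_mat s g) 4 c"
      by (rule eq_matI) (auto simp: mat_delete_def wedge_mat_def)
    thus ?thesis by (simp add: cofactor_def)
  qed
  have lap: "det (wedge_mat s f) = (\<Sum>c<5. f c * cofactor (wedge_mat s f) 4 c)" for f
  proof -
    have "det (wedge_mat s f) = (\<Sum>c<5. wedge_mat s f $$ (4, c) * cofactor (wedge_mat s f) 4 c)"
      by (rule laplace_expansion_row) simp_all
    also have "\<dots> = (\<Sum>c<5. f c * cofactor (wedge_mat s f) 4 c)"
      by (rule sum.cong) (simp_all add: wedge_mat_def)
    finally show ?thesis .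
  qed
  have "wedge s c = cofactor (wedge_mat s f) 4 c" if "c < 5" for c
  proof -
    have "wedge s c = (\<Sum>i<5. (if i = c then 1 else 0) * cofactor (wedge_mat s f) 4 i)"
      unfolding wedge_def lap by (rule sum.cong) (use cof in auto)
    also have "\<dots> = (\<Sum>i<5. if i = c then cofactor (wedge_mat s f) 4 c else 0)"
      by (rule sum.cong) auto
    also have "\<dots> = cofactor (wedge_mat s f) 4 c" using that by simp
    finally show ?thesis .
  qed
  thus ?thesis unfolding lap by (intro sum.cong) auto
qed

lemma ex_of_nat_4: "\<exists>r<4. of_nat r = (i :: 4)"
proof -
  have "i \<in> {0, 1, 2, 3}" using UNIV_4 by blast
  moreover have "of_nat 0 = (0::4)" "of_nat 1 = (1::4)" "of_nat 2 = (2::4)" "of_nat 3 = (3::4)" by simp_all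
  moreover have "(0::nat) < 4" "(1::nat) < 4" "(2::nat) < 4" "(3::nat) < 4" by simp_all
  ultimately show ?thesis by blast
qed

lemma of_nat_4_inj: "r < 4 \<Longrightarrow> l < 4 \<Longrightarrow> of_nat r = (of_nat l :: 4) \<Longrightarrow> r = l"
proof -
  assume "r < 4" "l < 4" and eq: "of_nat r = (of_nat l :: 4)"
  hence "r = 0 \<or> r = 1 \<or> r = 2 \<or> r = 3" "l = 0 \<or> l = 1 \<or> l = 2 \<or> l = 3" by arith+
  thus "r = l" using eq by (elim disjE) simp_all
qed

lemma wedge_vanishes: "(\<Sum>c<5. form_coeff 4 (s i) c * wedge s c) = 0"
proof -
  obtain r where r: "r < 4" "of_nat r = i" using ex_of_nat_4 by blast
  have "det (wedge_mat s (form_coeff 4 (s i))) = 0"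
    by (rule det_identical_rows[of _ 5 r 4]) (use r in \<open>auto simp: wedge_mat_def intro!: eq_vecI\<close>)
  thus ?thesis by (simp add: det_wedge_mat)
qed

lemma wedge_row_add:
  assumes "i \<noteq> j"
  shows "wedge (row_add c i j s) k = wedge s k"
proof -
  obtain r l where r: "r < 4" "of_nat r = i" "l < 4" "of_nat l = j" using ex_of_nat_4 by blast
  hence rl: "r \<noteq> l" using assms by auto
  let ?e = "\<lambda>c. if c = k then 1 else 0 :: 'a"
  have "wedge_mat (row_add c i j s) ?e = addrow c r l (wedge_mat s ?e)"
  proof (rule eq_matI)
    fix x y assume "x < dim_row (addrow c r l (wedge_mat s ?e))" "y < dim_col (addrow c r l (wedge_mat s ?e))"
    hence xy: "x < 5" "y < 5" by (simp_all add: wedge_mat_def)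
    show "wedge_mat (row_add c i j s) ?e $$ (x, y) = addrow c r l (wedge_mat s ?e) $$ (x, y)"
    proof (cases "x < 4")
      case True
      have iff: "(of_nat x :: 4) = of_nat r \<longleftrightarrow> x = r" using of_nat_4_inj[OF True r(1)] by auto
      show ?thesis using xy r(1,3) True unfolding r(2)[symmetric] r(4)[symmetric]
        by (cases "x = r") (simp_all add: wedge_mat_def row_add_def mat_addrow_def iff add.commute)
    qed (use xy r in \<open>simp add: wedge_mat_def mat_addrow_def\<close>)
  qed (simp_all add: wedge_mat_def)
  moreover have "det (addrow c r l (wedge_mat s ?e)) = det (wedge_mat s ?e)"
    by (rule det_addrow[OF _ rl wedge_mat_carrier]) (use r in simp)
  ultimately show ?thesis unfolding wedge_def by simp
qed

lemma wedge_row_scale: "wedge (s(i := cst a * s i)) k = a * wedge s k"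
proof -
  obtain r where r: "r < 4" "of_nat r = i" using ex_of_nat_4 by blast
  let ?e = "\<lambda>c. if c = k then 1 else 0 :: 'a"
  have "wedge_mat (s(i := cst a * s i)) ?e = multrow r a (wedge_mat s ?e)"
  proof (rule eq_matI)
    fix x y assume "x < dim_row (multrow r a (wedge_mat s ?e))" "y < dim_col (multrow r a (wedge_mat s ?e))"
    hence xy: "x < 5" "y < 5" by (simp_all add: wedge_mat_def)
    show "wedge_mat (s(i := cst a * s i)) ?e $$ (x, y) = multrow r a (wedge_mat s ?e) $$ (x, y)"
    proof (cases "x < 4")
      case True
      have iff: "(of_nat x :: 4) = of_nat r \<longleftrightarrow> x = r" using of_nat_4_inj[OF True r(1)] by auto
      show ?thesis using xy r(1) True unfolding r(2)[symmetric]
        by (cases "x = r") (simp_all add: wedge_mat_def mat_multrow_def iff)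
    qed (use xy r in \<open>simp add: wedge_mat_def mat_multrow_def\<close>)
  qed (simp_all add: wedge_mat_def)
  moreover have "det (multrow r a (wedge_mat s ?e)) = a * det (wedge_mat s ?e)"
    by (rule det_multrow[OF _ wedge_mat_carrier]) (use r in simp)
  ultimately show ?thesis unfolding wedge_def by simp
qed

lemma wedge_scale: "wedge (\<lambda>i. cst a * s i) k = a ^ 4 * wedge s k"
proof -
  define s1 where "s1 = s(0 := cst a * s 0)"
  define s2 where "s2 = s1(1 := cst a * s1 1)"
  define s3 where "s3 = s2(2 := cst a * s2 2)"
  define s4 where "s4 = s3(3 := cst a * s3 3)"
  have "(\<lambda>i. cst a * s i) = s4"
  proof
    fix i :: 4
    have "i \<in> {0, 1, 2, 3}" using UNIV_4 by blast
    thus "cst a * s i = s4 i" by (auto simp: s4_def s3_def s2_def s1_def)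
  qed
  moreover have "wedge s4 k = a * wedge s3 k" "wedge s3 k = a * wedge s2 k"
    "wedge s2 k = a * wedge s1 k" "wedge s1 k = a * wedge s k"
    unfolding s4_def s3_def s2_def s1_def by (rule wedge_row_scale)+
  ultimately show ?thesis by (simp add: power4_eq_xxxx mult.assoc)
qed

lemma wedge_base_change:
  assumes "comm_ring_hom h"
  shows "wedge (base_change h s) k = h (wedge s k)"
proof -
  interpret h: comm_ring_hom h by fact
  have "wedge_mat (base_change h s) (\<lambda>c. if c = k then 1 else 0) =
      map_mat h (wedge_mat s (\<lambda>c. if c = k then 1 else 0))"
    by (rule eq_matI) (auto simp: wedge_mat_def base_change_def form_coeff_def coeff_map_poly)
  thus ?thesis by (simp add: wedge_def)
qed

lemma wedge_row_steps: "(s, t) \<in> row_step\<^sup>* \<Longrightarrow> wedge t = wedge s"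
proof (induction rule: rtrancl_induct)
  case (step t u)
  then obtain c i j where "u = row_add c i j t" "i \<noteq> j" by (auto simp: row_step_def)
  thus ?case using step.IH wedge_row_add[of i j c t] by (auto simp: fun_eq_iff)
qed simp

lemma sum_UNIV_4: "(\<Sum>i\<in>UNIV. g (i::4)) = (\<Sum>r<4. g (of_nat r))"
  unfolding UNIV_4 by (simp add: eval_nat_numeral add.assoc)

text \<open>If \<open>wedge s k\<close> is a unit, the four sections and the k-th monomial form a
  basis of the quartic forms over the ring. Pairing with the wedge isolates the coefficient of that
  monomial, which is zero for f.\<close>

lemma prod_span_wedge_kernel:
  fixes s :: "4 \<Rightarrow> 'r::comm_ring_1 poly poly"
  assumes s: "\<And>i. s i \<in> forms UNIV 4" and k: "k < 5" "u * wedge s k = 1"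
    and f: "f \<in> forms UNIV 4" "(\<Sum>c<5. form_coeff 4 f c * wedge s c) = 0"
  shows "prod_span UNIV s 1 f"
proof -
  define A where "A = wedge_mat s (\<lambda>c. if c = k then 1 else 0)"
  define B where "B = adj_mat A"
  have A: "A \<in> carrier_mat 5 5" by (simp add: A_def)
  have B: "B \<in> carrier_mat 5 5" and BA: "B * A = wedge s k \<cdot>\<^sub>m 1\<^sub>m 5"
    using adj_mat[OF A] by (simp_all add: A_def B_def wedge_def)
  \<comment> \<open>The coordinates of f with respect to the rows, by the adjugate matrix;
    \<open>u\<close> inverts the determinant.\<close>
  define c where "c r = u * (\<Sum>j<5. form_coeff 4 f j * B $$ (j, r))" for r
  have cA: "(\<Sum>r<5. c r * A $$ (r, m)) = form_coeff 4 f m" if m: "m < 5" for m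
  proof -
    have BA': "(\<Sum>r<5. B $$ (j, r) * A $$ (r, m)) = (if j = m then wedge s k else 0)" if "j < 5" for j
      using arg_cong[OF BA, of "\<lambda>M. M $$ (j, m)"] A B m that
      by (simp add: scalar_prod_def atLeast0LessThan)
    have "(\<Sum>r<5. c r * A $$ (r, m)) = (\<Sum>r<5. \<Sum>j<5. u * (form_coeff 4 f j * (B $$ (j, r) * A $$ (r, m))))"
      by (simp add: c_def sum_distrib_left sum_distrib_right mult.assoc)
    also have "\<dots> = (\<Sum>j<5. u * (form_coeff 4 f j * (\<Sum>r<5. B $$ (j, r) * A $$ (r, m))))"
      by (subst sum.swap) (simp add: sum_distrib_left)
    also have "\<dots> = (\<Sum>j<5. if j = m then form_coeff 4 f m * (u * wedge s k) else 0)"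
    proof (rule sum.cong[OF refl])
      fix j :: nat assume "j \<in> {..<5}"
      hence "j < 5" by simp
      show "u * (form_coeff 4 f j * (\<Sum>r<5. B $$ (j, r) * A $$ (r, m))) =
          (if j = m then form_coeff 4 f m * (u * wedge s k) else 0)"
        unfolding BA'[OF \<open>j < 5\<close>] by (auto simp: mult_ac)
    qed
    also have "\<dots> = form_coeff 4 f m" using m k by simp
    finally show ?thesis .
  qed
  have rows: "A $$ (r, m) = form_coeff 4 (s (of_nat r)) m" if "r < 4" "m < 5" for r m
    using that by (simp add: A_def wedge_mat_def)
  have "0 = (\<Sum>m<5. (\<Sum>r<5. c r * A $$ (r, m)) * wedge s m)"
    using f(2) by (simp add: cA)
  also have "\<dots> = (\<Sum>r<5. c r * (\<Sum>m<5. A $$ (r, m) * wedge s m))"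
    unfolding sum_distrib_left sum_distrib_right by (subst sum.swap) (simp add: mult.assoc)
  also have "\<dots> = (\<Sum>r\<in>{..<5::nat}. if r = 4 then c 4 * wedge s k else 0)"
  proof (rule sum.cong)
    fix r :: nat assume "r \<in> {..<5}"
    hence r: "r < 5" by simp
    show "c r * (\<Sum>m<5. A $$ (r, m) * wedge s m) = (if r = 4 then c 4 * wedge s k else 0)"
    proof (cases "r = 4")
      case True
      have "(\<Sum>m<5. A $$ (r, m) * wedge s m) = (\<Sum>m<5. if m = k then wedge s k else 0)"
        by (rule sum.cong) (auto simp: A_def wedge_mat_def True)
      thus ?thesis using True k by simp
    next
      case False
      hence "(\<Sum>m<5. A $$ (r, m) * wedge s m) = (\<Sum>m<5. form_coeff 4 (s (of_nat r)) m * wedge s m)"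
        using r by (intro sum.cong) (auto simp: rows)
      thus ?thesis using wedge_vanishes[of s "of_nat r"] False by simp
    qed
  qed simp
  also have "\<dots> = c 4 * wedge s k" by simp
  finally have "c 4 * (u * wedge s k) = 0" by (simp add: mult_ac)
  hence c4: "c 4 = 0" using k by simp
  define idx :: "4 \<Rightarrow> nat" where
    "idx i = (if i = 0 then 0 else if i = 1 then 1 else if i = 2 then 2 else 3)" for i
  have idx: "idx (of_nat r) = r" if "r < 4" for r
  proof -
    have "r = 0 \<or> r = 1 \<or> r = 2 \<or> r = 3" using that by arith
    thus ?thesis by (elim disjE) (simp_all add: idx_def)
  qed
  have "f = (\<Sum>i\<in>UNIV. cst (c (idx i)) * s i)"
  proof (rule forms_eqI[OF f(1)])
    show "(\<Sum>i\<in>UNIV. cst (c (idx i)) * s i) \<in> forms UNIV 4"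
      by (intro forms_sum forms_cst_mult s) auto
  next
    fix m :: nat assume "m \<le> 4"
    hence m: "m < 5" by simp
    have "form_coeff 4 f m = (\<Sum>r<5. c r * A $$ (r, m))" using cA[OF m] by simp
    also have "\<dots> = (\<Sum>r<4. c r * A $$ (r, m))" using c4 by (simp add: eval_nat_numeral)
    also have "\<dots> = (\<Sum>r<4. c r * form_coeff 4 (s (of_nat r)) m)" using m by (simp add: rows)
    also have "\<dots> = form_coeff 4 (\<Sum>i\<in>UNIV. cst (c (idx i)) * s i) m"
      unfolding form_coeff_sum sum_UNIV_4 by (rule sum.cong) (simp_all add: idx)
    finally show "form_coeff 4 f m = form_coeff 4 (\<Sum>i\<in>UNIV. cst (c (idx i)) * s i) m" .
  qed
  thus ?thesis using prod_span_comb[of UNIV "\<lambda>i. c (idx i)" s UNIV] by simp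
qed

section \<open>The apolar ideal of a quartic functional\<close>

lemma fmono_power: "fmono i j = fmono 1 0 ^ i * fmono 0 1 ^ j"
proof -
  have 1: "fmono 1 0 ^ i = fmono i 0" for i
    by (induction i) (simp_all add: fmono_mult)
  have 2: "fmono 0 1 ^ j = fmono 0 j" for j
    by (induction j) (simp_all add: fmono_mult)
  show ?thesis unfolding 1 2 by (simp add: fmono_mult)
qed

lemma cst_numeral: "cst (numeral n) = numeral n"
  by (simp add: cst_def numeral_poly)

text \<open>
  The cubics \<open>r0, \<dots>, r3\<close> span the apolar ideal of the quartic functional \<open>x\<close> in degree 3, and
  \<open>q0, q1, q2\<close> is the basis of the quadratic forms dual to the monomials, up to the Hankel
  determinant. All quintic forms lie in the ideal generated by the cubics.
\<close>
locale apolar =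
  fixes x0 x1 x2 x3 x4 v :: "'r::comm_ring_1"
  assumes unit: "v * hdet x0 x1 x2 x3 x4 = 1"
begin

definition U :: "'r poly poly" where "U = fmono 1 0"
definition V :: "'r poly poly" where "V = fmono 0 1"
text \<open>The coefficients of q0, q1, q2 are the rows of the adjugate of the Hankel
  matrix.\<close>

definition "q0 = cst (x2 * x4 - x3 * x3) * U\<^sup>2 + cst (x2 * x3 - x1 * x4) * (U * V) + cst (x1 * x3 - x2 * x2) * V\<^sup>2"
definition "q1 = cst (x2 * x3 - x1 * x4) * U\<^sup>2 + cst (x0 * x4 - x2 * x2) * (U * V) + cst (x1 * x2 - x0 * x3) * V\<^sup>2"
definition "q2 = cst (x1 * x3 - x2 * x2) * U\<^sup>2 + cst (x1 * x2 - x0 * x3) * (U * V) + cst (x0 * x2 - x1 * x1) * V\<^sup>2"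
text \<open>By duality the functional is zero on q_i times the j-th of u^2, uv, v^2 unless i = j,
  where the value is always the Hankel determinant. In these four combinations the values cancel
  after multiplication by u and by v.\<close>

definition "r0 = q0 * V"
definition "r1 = q0 * U - q1 * V"
definition "r2 = q1 * U - q2 * V"
definition "r3 = q2 * U"

text \<open>The Hankel matrix times its adjugate.\<close>

lemma dual_basis:
  "cst (hdet x0 x1 x2 x3 x4) * U\<^sup>2 = cst x0 * q0 + cst x1 * q1 + cst x2 * q2"
  "cst (hdet x0 x1 x2 x3 x4) * (U * V) = cst x1 * q0 + cst x2 * q1 + cst x3 * q2"
  "cst (hdet x0 x1 x2 x3 x4) * V\<^sup>2 = cst x2 * q0 + cst x3 * q1 + cst x4 * q2"
  by (simp_all add: q0_def q1_def q2_def hdet_def cst_add cst_diff cst_mult cst_numeral algebra_simps)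

text \<open>Zero coefficients are spelled out and differences are left unsimplified so that each
  right-hand side has the shape to which the kernel criterion is applied.\<close>

lemma cubic_multiples:
  "r0 * U = cst 0 * U ^ 4 + cst (x2 * x4 - x3 * x3) * (U ^ 3 * V) + cst (x2 * x3 - x1 * x4) * (U\<^sup>2 * V\<^sup>2) + cst (x1 * x3 - x2 * x2) * (U * V ^ 3) + cst 0 * V ^ 4"
  "r0 * V = cst 0 * U ^ 4 + cst 0 * (U ^ 3 * V) + cst (x2 * x4 - x3 * x3) * (U\<^sup>2 * V\<^sup>2) + cst (x2 * x3 - x1 * x4) * (U * V ^ 3) + cst (x1 * x3 - x2 * x2) * V ^ 4"
  "r1 * U = cst (x2 * x4 - x3 * x3) * U ^ 4 + cst 0 * (U ^ 3 * V) + cst ((x1 * x3 - x2 * x2) - (x0 * x4 - x2 * x2)) * (U\<^sup>2 * V\<^sup>2) + cst (- (x1 * x2 - x0 * x3)) * (U * V ^ 3) + cst 0 * V ^ 4"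
  "r1 * V = cst 0 * U ^ 4 + cst (x2 * x4 - x3 * x3) * (U ^ 3 * V) + cst 0 * (U\<^sup>2 * V\<^sup>2) + cst ((x1 * x3 - x2 * x2) - (x0 * x4 - x2 * x2)) * (U * V ^ 3) + cst (- (x1 * x2 - x0 * x3)) * V ^ 4"
  "r2 * U = cst (x2 * x3 - x1 * x4) * U ^ 4 + cst ((x0 * x4 - x2 * x2) - (x1 * x3 - x2 * x2)) * (U ^ 3 * V) + cst 0 * (U\<^sup>2 * V\<^sup>2) + cst (- (x0 * x2 - x1 * x1)) * (U * V ^ 3) + cst 0 * V ^ 4"
  "r2 * V = cst 0 * U ^ 4 + cst (x2 * x3 - x1 * x4) * (U ^ 3 * V) + cst ((x0 * x4 - x2 * x2) - (x1 * x3 - x2 * x2)) * (U\<^sup>2 * V\<^sup>2) + cst 0 * (U * V ^ 3) + cst (- (x0 * x2 - x1 * x1)) * V ^ 4"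
  "r3 * U = cst (x1 * x3 - x2 * x2) * U ^ 4 + cst (x1 * x2 - x0 * x3) * (U ^ 3 * V) + cst (x0 * x2 - x1 * x1) * (U\<^sup>2 * V\<^sup>2) + cst 0 * (U * V ^ 3) + cst 0 * V ^ 4"
  "r3 * V = cst 0 * U ^ 4 + cst (x1 * x3 - x2 * x2) * (U ^ 3 * V) + cst (x1 * x2 - x0 * x3) * (U\<^sup>2 * V\<^sup>2) + cst (x0 * x2 - x1 * x1) * (U * V ^ 3) + cst 0 * V ^ 4"
  by (simp_all add: r0_def r1_def r2_def r3_def q0_def q1_def q2_def cst_minus cst_diff cst_mult
      power2_eq_square power3_eq_cube power4_eq_xxxx algebra_simps)

text \<open>The determinant is a unit, so quadratic monomials are combinations of the q_i; and q_i
  times a cubic monomial telescopes into multiples of the r_j. The factor \<open>p\<close> and the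
  set \<open>T\<close> are left open because the argument is used at two levels.\<close>

lemma quintic_multiple:
  assumes add: "\<And>f g. f \<in> T \<Longrightarrow> g \<in> T \<Longrightarrow> f + g \<in> T" and scale: "\<And>a f. f \<in> T \<Longrightarrow> cst a * f \<in> T"
    and r: "\<And>r m. r \<in> {r0, r1, r2, r3} \<Longrightarrow> m \<in> {U\<^sup>2, U * V, V\<^sup>2} \<Longrightarrow> p * (r * m) \<in> T"
    and ij: "i + j = 5"
  shows "p * (U ^ i * V ^ j) \<in> T"
proof -
  have diff: "f - g \<in> T" if "f \<in> T" "g \<in> T" for f g
    using add[OF that(1) scale[OF that(2), of "- 1"]] by (simp add: cst_minus)
  have r': "p * (r * U\<^sup>2) \<in> T" "p * (r * (U * V)) \<in> T" "p * (r * V\<^sup>2) \<in> T"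
    if "r \<in> {r0, r1, r2, r3}" for r using r[OF that] by simp_all
  note R = r'[of r0, simplified] r'[of r1, simplified] r'[of r2, simplified] r'[of r3, simplified]
  have Q: "p * (q0 * U ^ 3) = p * (r1 * U\<^sup>2) + p * (r2 * (U * V)) + p * (r3 * V\<^sup>2)"
    "p * (q0 * (U\<^sup>2 * V)) = p * (r0 * U\<^sup>2)"
    "p * (q0 * (U * V\<^sup>2)) = p * (r0 * (U * V))"
    "p * (q0 * V ^ 3) = p * (r0 * V\<^sup>2)"
    "p * (q1 * U ^ 3) = p * (r2 * U\<^sup>2) + p * (r3 * (U * V))"
    "p * (q1 * (U\<^sup>2 * V)) = p * (r2 * (U * V)) + p * (r3 * V\<^sup>2)"
    "p * (q1 * (U * V\<^sup>2)) = p * (r0 * U\<^sup>2) - p * (r1 * (U * V))"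
    "p * (q1 * V ^ 3) = p * (r0 * (U * V)) - p * (r1 * V\<^sup>2)"
    "p * (q2 * U ^ 3) = p * (r3 * U\<^sup>2)"
    "p * (q2 * (U\<^sup>2 * V)) = p * (r3 * (U * V))"
    "p * (q2 * (U * V\<^sup>2)) = p * (r3 * V\<^sup>2)"
    "p * (q2 * V ^ 3) = p * (r0 * U\<^sup>2) - p * (r1 * (U * V)) - p * (r2 * V\<^sup>2)"
    by (simp_all add: r0_def r1_def r2_def r3_def power2_eq_square power3_eq_cube algebra_simps)
  have qT: "p * (q0 * U ^ 3) \<in> T" "p * (q0 * (U\<^sup>2 * V)) \<in> T" "p * (q0 * (U * V\<^sup>2)) \<in> T"
    "p * (q0 * V ^ 3) \<in> T" "p * (q1 * U ^ 3) \<in> T" "p * (q1 * (U\<^sup>2 * V)) \<in> T"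
    "p * (q1 * (U * V\<^sup>2)) \<in> T" "p * (q1 * V ^ 3) \<in> T" "p * (q2 * U ^ 3) \<in> T"
    "p * (q2 * (U\<^sup>2 * V)) \<in> T" "p * (q2 * (U * V\<^sup>2)) \<in> T" "p * (q2 * V ^ 3) \<in> T"
    unfolding Q by (intro add diff R)+
  have q: "p * (q * m) \<in> T"
    if "q \<in> {q0, q1, q2}" "m \<in> {U ^ 3, U\<^sup>2 * V, U * V\<^sup>2, V ^ 3}" for q m
    using that by (elim insertE emptyE; simp only: qT)
  have main: "p * (n * m) \<in> T"
    if n: "cst (hdet x0 x1 x2 x3 x4) * n = cst a * q0 + cst b * q1 + cst c * q2"
      and m: "m \<in> {U ^ 3, U\<^sup>2 * V, U * V\<^sup>2, V ^ 3}" for n m a b c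
  proof -
    have "p * (n * m) = cst (v * hdet x0 x1 x2 x3 x4) * (p * (n * m))" unfolding unit by simp
    also have "\<dots> = cst v * (p * ((cst (hdet x0 x1 x2 x3 x4) * n) * m))"
      by (simp add: cst_mult mult_ac)
    also have "\<dots> = cst v * (cst a * (p * (q0 * m)) + cst b * (p * (q1 * m)) + cst c * (p * (q2 * m)))"
      unfolding n by (simp add: algebra_simps)
    also have "\<dots> \<in> T" by (intro scale add q) (use m in simp_all)
    finally show ?thesis .
  qed
  note M = main[OF dual_basis(1)] main[OF dual_basis(2)] main[OF dual_basis(3)]
  have "i = 0 \<and> j = 5 \<or> i = 1 \<and> j = 4 \<or> i = 2 \<and> j = 3 \<or> i = 3 \<and> j = 2 \<or> i = 4 \<and> j = 1 \<or> i = 5 \<and> j = 0"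
  proof -
    have j: "j = 5 - i" using ij by simp
    have "i < 6" using ij by simp
    hence "i = 0 \<or> i = 1 \<or> i = 2 \<or> i = 3 \<or> i = 4 \<or> i = 5" by arith
    thus ?thesis unfolding j by (elim disjE) simp_all
  qed
  moreover have "U ^ 0 * V ^ 5 = V\<^sup>2 * V ^ 3" "U ^ 1 * V ^ 4 = (U * V) * V ^ 3" "U\<^sup>2 * V ^ 3 = U\<^sup>2 * V ^ 3"
    "U ^ 3 * V\<^sup>2 = V\<^sup>2 * U ^ 3" "U ^ 4 * V ^ 1 = U\<^sup>2 * (U\<^sup>2 * V)" "U ^ 5 * V ^ 0 = U\<^sup>2 * U ^ 3"
    using power_add[of V 2 3] power_add[of V 1 3] power_add[of U 2 2] power_add[of U 2 3]
    by (simp_all add: mult.assoc mult.commute[of "U ^ 3"])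
  ultimately show ?thesis
    using M(1)[of "V ^ 3"] M(1)[of "U\<^sup>2 * V"] M(1)[of "U ^ 3"] M(2)[of "V ^ 3"] M(3)[of "V ^ 3"] M(3)[of "U ^ 3"]
    by (elim disjE conjE; simp only: insertI1 insertI2 simp_thms; simp)
qed

text \<open>Products of two sections include r r' m for quadratic monomials m. One use of
  \<open>quintic_multiple\<close> with p = r gives r times all quintic monomials, a second one with
  p a cubic monomial gives all octic ones.\<close>

lemma octic_span:
  assumes s: "\<And>l r. l \<in> {U, V} \<Longrightarrow> r \<in> {r0, r1, r2, r3} \<Longrightarrow> prod_span UNIV s 1 (r * l)"
    and ij: "i + j = 8"
  shows "prod_span UNIV s 2 (fmono i j)"
proof -
  let ?T = "{f. prod_span UNIV s 2 f}"
  have add: "\<And>f g. f \<in> ?T \<Longrightarrow> g \<in> ?T \<Longrightarrow> f + g \<in> ?T" by (simp add: prod_span.add)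
  have scale: "\<And>a f. f \<in> ?T \<Longrightarrow> cst a * f \<in> ?T" by (simp add: prod_span_scale)
  have rr: "r * (r' * m) \<in> ?T"
    if rs: "r \<in> {r0, r1, r2, r3}" "r' \<in> {r0, r1, r2, r3}" and m: "m \<in> {U\<^sup>2, U * V, V\<^sup>2}" for r r' m
  proof -
    have "\<exists>l l'. l \<in> {U, V} \<and> l' \<in> {U, V} \<and> m = l * l'"
      using m by (auto simp: power2_eq_square)
    then obtain l l' where l: "l \<in> {U, V}" "l' \<in> {U, V}" "m = l * l'" by blast
    have "prod_span UNIV s (1 + 1) ((r * l) * (r' * l'))"
      by (intro prod_span_mult s rs l) simp
    thus ?thesis by (simp add: l(3) mult_ac numeral_2_eq_2)
  qed
  have r5: "r * (U ^ i * V ^ j) \<in> ?T" if "r \<in> {r0, r1, r2, r3}" "i + j = 5" for r i j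
    by (rule quintic_multiple[OF add scale rr[OF that(1)] that(2)])
  define a where "a = min i 3"
  have a: "a + (3 - a) = 3" "(i - a) + (j - (3 - a)) = 5" "a + (i - a) = i" "(3 - a) + (j - (3 - a)) = j"
    using ij by (auto simp: a_def min_def)
  have "(U ^ a * V ^ (3 - a)) * (U ^ (i - a) * V ^ (j - (3 - a))) \<in> ?T"
  proof (rule quintic_multiple[OF add scale _ a(2)])
    fix r m assume rm: "r \<in> {r0, r1, r2, r3}" "m \<in> {U\<^sup>2, U * V, V\<^sup>2}"
    have "\<exists>k l. k + l = 2 \<and> m = U ^ k * V ^ l"
    proof -
      consider "m = U ^ 2 * V ^ 0" | "m = U ^ 1 * V ^ 1" | "m = U ^ 0 * V ^ 2" using rm(2) by auto
      thus ?thesis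
      proof cases
        case 1 thus ?thesis by (intro exI[of _ 2] exI[of _ 0]) simp
      next
        case 2 thus ?thesis by (intro exI[of _ 1] exI[of _ 1]) simp
      next
        case 3 thus ?thesis by (intro exI[of _ 0] exI[of _ 2]) simp
      qed
    qed
    then obtain k l where kl: "k + l = 2" "m = U ^ k * V ^ l" by blast
    have "U ^ a * V ^ (3 - a) * (r * m) = r * (U ^ (a + k) * V ^ (3 - a + l))"
      by (simp add: kl(2) power_add mult_ac)
    also have "\<dots> \<in> ?T" by (rule r5[OF rm(1)]) (use kl(1) a(1) in simp)
    finally show "U ^ a * V ^ (3 - a) * (r * m) \<in> ?T" .
  qed
  also have "(U ^ a * V ^ (3 - a)) * (U ^ (i - a) * V ^ (j - (3 - a))) = U ^ (a + (i - a)) * V ^ ((3 - a) + (j - (3 - a)))"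
    unfolding power_add by (simp only: mult_ac)
  also have "\<dots> = fmono i j" unfolding a fmono_power[of i j] U_def V_def ..
  finally show ?thesis by simp
qed

end

text \<open>The sections span the kernel of their wedge, which contains u and v times the apolar
  cubics. The two unit hypotheses keep the argument valid over K[t].\<close>

lemma generically_spanning_quartic:
  fixes s :: "4 \<Rightarrow> 'r::comm_ring_1 poly poly"
  assumes s: "\<And>i. s i \<in> forms UNIV 4" and k: "k < 5" "u * wedge s k = 1"
    and v: "v * hdet (wedge s 0) (wedge s 1) (wedge s 2) (wedge s 3) (wedge s 4) = 1"
  shows "generically_spanning UNIV 4 s"
proof -
  interpret apolar "wedge s 0" "wedge s 1" "wedge s 2" "wedge s 3" "wedge s 4" v
    by unfold_locales (rule v)
  have span: "prod_span UNIV s 1 (cst c0 * U ^ 4 + cst c1 * (U ^ 3 * V) + cst c2 * (U\<^sup>2 * V\<^sup>2) +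
      cst c3 * (U * V ^ 3) + cst c4 * V ^ 4)"
    if "c0 * wedge s 0 + c1 * wedge s 1 + c2 * wedge s 2 + c3 * wedge s 3 + c4 * wedge s 4 = 0" for c0 c1 c2 c3 c4
  proof -
    define c where "c j = [c0, c1, c2, c3, c4] ! j" for j
    have "form_of 4 c = cst c0 * U ^ 4 + cst c1 * (U ^ 3 * V) + cst c2 * (U\<^sup>2 * V\<^sup>2) +
      cst c3 * (U * V ^ 3) + cst c4 * V ^ 4"
    proof -
      have "form_of 4 c = (\<Sum>j<5. cst (c j) * (U ^ (4 - j) * V ^ j))"
        unfolding form_of_def U_def V_def fmono_power[of "4 - j" j for j]
        by (rule sum.cong) auto
      thus ?thesis unfolding sum_5 by (simp add: c_def eval_nat_numeral)
    qed
    moreover have "prod_span UNIV s 1 (form_of 4 c)"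
    proof (rule prod_span_wedge_kernel[OF s k forms_form_of])
      have "(\<Sum>j<5. form_coeff 4 (form_of 4 c) j * wedge s j) = (\<Sum>j<5. c j * wedge s j)"
        by (rule sum.cong) (simp_all add: form_coeff_form_of)
      also have "\<dots> = 0" using that unfolding sum_5 by (simp add: c_def)
      finally show "(\<Sum>j<5. form_coeff 4 (form_of 4 c) j * wedge s j) = 0" .
    qed auto
    ultimately show ?thesis by simp
  qed
  have "prod_span UNIV s 1 (r * l)" if "l \<in> {U, V}" "r \<in> {r0, r1, r2, r3}" for l r
  proof -
    have "prod_span UNIV s 1 (r0 * U)" "prod_span UNIV s 1 (r0 * V)" "prod_span UNIV s 1 (r1 * U)"
      "prod_span UNIV s 1 (r1 * V)" "prod_span UNIV s 1 (r2 * U)" "prod_span UNIV s 1 (r2 * V)"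
      "prod_span UNIV s 1 (r3 * U)" "prod_span UNIV s 1 (r3 * V)"
      unfolding cubic_multiples by (rule span; simp add: algebra_simps)+
    thus ?thesis using that by auto
  qed
  hence "prod_span UNIV s 2 (fmono i j)" if "i + j = 2 * 4" for i j
    using octic_span[of s i j] that by simp
  thus ?thesis using s unfolding generically_spanning_def
    by (intro conjI allI exI[of _ 2]) simp_all
qed

section \<open>Embeddings of degree four up to isotopy\<close>

lemma hdet_wedge_base_change:
  assumes "comm_ring_hom h"
  shows "hdet (h a) (h b) (h c) (h d) (h e) = h (hdet a b c d e)"
proof -
  interpret h: comm_ring_hom h by fact
  have "h 2 = 2" using h.hom_add[of 1 1] by simp
  thus ?thesis by (simp add: hdet_def h.hom_add h.hom_mult h.hom_minus)
qed

text \<open>A basis e_l - r_l e_k of the kernel of a functional with value r_l on the monomial e_l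
  and 1 on e_k; the index l skips \<open>k\<close>.\<close>

definition quartic_frame :: "nat \<Rightarrow> (nat \<Rightarrow> 'r::comm_ring_1) \<Rightarrow> 4 \<Rightarrow> 'r poly poly" where
  "quartic_frame k r i = (let j = (if i = 0 then 0 else if i = 1 then 1 else if i = 2 then 2 else 3);
     l = (if j < k then j else Suc j) in fmono (4 - l) l - cst (r l) * fmono (4 - k) k)"

lemma quartic_frame_of_nat:
  assumes "j < 4"
  shows "quartic_frame k r (of_nat j) =
    (let l = (if j < k then j else Suc j) in fmono (4 - l) l - cst (r l) * fmono (4 - k) k)"
proof -
  have "j = 0 \<or> j = 1 \<or> j = 2 \<or> j = 3" using assms by arith
  thus ?thesis by (elim disjE) (simp_all add: quartic_frame_def)
qed

lemma quartic_frame_forms: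
  assumes "k \<le> 4"
  shows "quartic_frame k r i \<in> forms UNIV 4"
proof -
  obtain j where j: "j < 4" "of_nat j = i" using ex_of_nat_4 by blast
  define l where "l = (if j < k then j else Suc j)"
  have l: "l \<le> 4" using j by (simp add: l_def)
  have "fmono (4 - l) l + cst (- r l) * fmono (4 - k) k \<in> forms UNIV 4"
    by (intro forms_add forms_cst_mult forms_fmono') (use l assms in auto)
  thus ?thesis
    using quartic_frame_of_nat[OF j(1), of k r] j(2) by (simp add: l_def[symmetric] cst_minus Let_def)
qed

lemma form_coeff_quartic_frame:
  fixes r :: "nat \<Rightarrow> 'a::comm_ring_1"
  assumes "j < 4" "c < 5" "k < 5"
  shows "form_coeff 4 (quartic_frame k r (of_nat j)) c =
    (let l = (if j < k then j else Suc j) in (if c = l then 1 else 0) - (if c = k then r l else 0))"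
proof -
  have fm: "form_coeff 4 (fmono (4 - l) l :: 'a poly poly) c = (if c = l then 1 else 0)" if "l \<le> 4" for l
    using that assms(2) by (auto simp: form_coeff_fmono)
  define l where "l = (if j < k then j else Suc j)"
  have l: "l \<le> 4" and k: "k \<le> 4" using assms by (auto simp: l_def)
  have "quartic_frame k r (of_nat j) = fmono (4 - l) l - cst (r l) * fmono (4 - k) k"
    by (simp only: quartic_frame_of_nat[OF assms(1)] Let_def l_def)
  thus ?thesis unfolding Let_def l_def[symmetric]
    by (simp only: form_coeff_simps fm[OF l] fm[OF k]) simp
qed

text \<open>\<open>B\<close> writes each monomial as a frame element plus a multiple of e_k, and so
  is an inverse of the wedge matrix.\<close>

lemma wedge_quartic_frame_unit:
  assumes k: "k < 5"
  shows "wedge (quartic_frame k r) k dvd 1"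
proof -
  let ?l = "\<lambda>j. if j < k then j else Suc j"
  define A where "A = wedge_mat (quartic_frame k r) (\<lambda>c. if c = k then 1 else 0)"
  define B where "B = mat 5 5 (\<lambda>(i, j). if j < 4 then (if i = ?l j then 1 else 0) else
    if i = k then 1 else r i)"
  have A: "A \<in> carrier_mat 5 5" and B: "B \<in> carrier_mat 5 5" by (simp_all add: A_def B_def)
  have "B * A = 1\<^sub>m 5"
  proof (rule eq_matI)
    fix i m assume "i < dim_row (1\<^sub>m 5 :: 'a mat)" "m < dim_col (1\<^sub>m 5 :: 'a mat)"
    hence im: "i < 5" "m < 5" by simp_all
    have A': "A $$ (j, m) = (if m = ?l j then 1 else 0) - (if m = k then r (?l j) else 0)" if "j < 4" for j
      using that im by (simp add: A_def wedge_mat_def form_coeff_quartic_frame k Let_def)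
    have A4: "A $$ (4, m) = (if m = k then 1 else 0)" using im by (simp add: A_def wedge_mat_def)
    have B': "B $$ (i, j) = (if i = ?l j then 1 else 0)" if "j < 4" for j
      using that im by (simp add: B_def)
    have B4: "B $$ (i, 4) = (if i = k then 1 else r i)" using im by (simp add: B_def)
    have "(B * A) $$ (i, m) = (\<Sum>j<5. B $$ (i, j) * A $$ (j, m))"
      using A B im by (simp add: scalar_prod_def atLeast0LessThan)
    also have "\<dots> = (\<Sum>j<4. B $$ (i, j) * A $$ (j, m)) + B $$ (i, 4) * A $$ (4, m)"
      by (simp add: eval_nat_numeral)
    also have "(\<Sum>j<4. B $$ (i, j) * A $$ (j, m)) = (\<Sum>j<4. if i = ?l j then
        (if m = i then 1 else 0) - (if m = k then r i else 0) else 0)"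
      by (rule sum.cong) (auto simp: A' B')
    also have "\<dots> = (if i = k then 0 else (if m = i then 1 else 0) - (if m = k then r i else 0))"
    proof (cases "i = k")
      case True
      thus ?thesis by (intro sum.neutral[THEN trans]) auto
    next
      case False
      define j0 where "j0 = (if i < k then i else i - 1)"
      have j0: "j0 < 4" "i = ?l j0" "\<And>j. i = ?l j \<longleftrightarrow> j = j0"
        using False im k by (auto simp: j0_def)
      have "(\<Sum>j<4. if i = ?l j then (if m = i then 1 else 0) - (if m = k then r i else 0) else 0) =
        (\<Sum>j<4. if j = j0 then (if m = i then 1 else 0) - (if m = k then r i else 0) else 0)"
        unfolding j0(3) ..
      thus ?thesis using j0(1) False by simp
    qed
    also have "\<dots> + B $$ (i, 4) * A $$ (4, m) = 1\<^sub>m 5 $$ (i, m)"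
      using im by (auto simp: A4 B4)
    finally show "(B * A) $$ (i, m) = 1\<^sub>m 5 $$ (i, m)" .
  qed (use A B in auto)
  hence "det B * det A = 1" using det_mult[OF B A] by simp
  thus ?thesis unfolding wedge_def A_def by (metis dvdI mult.commute)
qed

text \<open>The wedge of the frame vanishes on the frame, which makes it proportional to x;
  rescaling one section adjusts the factor. The unit coordinate is what supplies an explicit basis
  of the kernel over K[t].\<close>

lemma ex_quartic_sections:
  fixes x :: "nat \<Rightarrow> 'r::comm_ring_1"
  assumes k: "k < 5" "u * x k = 1"
  shows "\<exists>S. (\<forall>i. S i \<in> forms UNIV 4) \<and> (\<forall>c<5. wedge S c = x c)"
proof -
  define F where "F = quartic_frame k (\<lambda>l. u * x l)"
  obtain w where w: "wedge F k * w = 1"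
    using wedge_quartic_frame_unit[OF k(1), of "\<lambda>l. u * x l"] by (auto simp: F_def dvd_def)
  have F: "wedge F c = u * x c * wedge F k" if c: "c < 5" for c
  proof (cases "c = k")
    case True
    thus ?thesis using k by simp
  next
    case False
    define j where "j = (if c < k then c else c - 1)"
    have j: "j < 4" "(if j < k then j else Suc j) = c" using False c k(1) by (auto simp: j_def)
    have "0 = (\<Sum>m<5. form_coeff 4 (F (of_nat j)) m * wedge F m)"
      by (rule wedge_vanishes[symmetric])
    also have "\<dots> = (\<Sum>m<5. (if m = c then wedge F c else 0) - (if m = k then u * x c * wedge F k else 0))"
    proof (rule sum.cong[OF refl])
      fix m :: nat assume "m \<in> {..<5}"
      hence "form_coeff 4 (F (of_nat j)) m = (if m = c then 1 else 0) - (if m = k then u * x c else 0)"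
        unfolding F_def using form_coeff_quartic_frame[OF j(1) _ k(1), of m "\<lambda>l. u * x l"] j(2)
        by (simp add: Let_def)
      thus "form_coeff 4 (F (of_nat j)) m * wedge F m =
          (if m = c then wedge F c else 0) - (if m = k then u * x c * wedge F k else 0)"
        using False by auto
    qed
    also have "\<dots> = wedge F c - u * x c * wedge F k" using c k(1) by (simp add: sum_subtractf)
    finally show ?thesis by simp
  qed
  define S where "S = F(0 := cst (x k * w) * F 0)"
  have "wedge S c = x c" if "c < 5" for c
  proof -
    have "wedge S c = x k * w * (u * x c * wedge F k)"
      unfolding S_def wedge_row_scale using F[OF that] by simp
    also have "\<dots> = (u * x k) * (wedge F k * w) * x c" by (simp add: mult_ac)
    finally show ?thesis using k w by simp
  qed
  moreover have "S i \<in> forms UNIV 4" for i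
    using quartic_frame_forms[of k] k(1) by (auto simp: S_def F_def intro!: forms_cst_mult)
  ultimately show ?thesis by blast
qed

abbreviation wedge_tuple :: "(4 \<Rightarrow> 'r::comm_ring_1 poly poly) \<Rightarrow> 'r \<times> 'r \<times> 'r \<times> 'r \<times> 'r" where
  "wedge_tuple s \<equiv> (wedge s 0, wedge s 1, wedge s 2, wedge s 3, wedge s 4)"

definition wedge_hdet :: "(4 \<Rightarrow> 'r::comm_ring_1 poly poly) \<Rightarrow> 'r" where
  "wedge_hdet s = hdet (wedge s 0) (wedge s 1) (wedge s 2) (wedge s 3) (wedge s 4)"

lemma wedge_hdet_ex:
  assumes "wedge_hdet s \<noteq> (0::'a::field)"
  obtains k u where "k < 5" "u * wedge s k = 1"
proof -
  have "\<exists>k<5. wedge s k \<noteq> 0"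
  proof (rule ccontr)
    assume "\<not> (\<exists>k<5. wedge s k \<noteq> 0)"
    hence "wedge s 0 = 0" "wedge s 1 = 0" "wedge s 2 = 0" "wedge s 3 = 0" "wedge s 4 = 0" by simp_all
    thus False using assms by (simp add: wedge_hdet_def hdet_def)
  qed
  then obtain k where "k < 5" "wedge s k \<noteq> 0" by blast
  thus ?thesis using that[of k "inverse (wedge s k)"] by simp
qed

lemma generically_spanning_quartic_field:
  fixes s :: "4 \<Rightarrow> 'a::field poly poly"
  assumes "\<And>i. s i \<in> forms UNIV 4" "wedge_hdet s \<noteq> 0"
  shows "generically_spanning UNIV 4 s"
proof -
  obtain k u where "k < 5" "u * wedge s k = 1" using wedge_hdet_ex[OF assms(2)] .
  from generically_spanning_quartic[OF assms(1) this, of "inverse (wedge_hdet s)"]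
  show ?thesis using assms(2) by (simp add: wedge_hdet_def)
qed

text \<open>Equal wedges have equal kernels, so both quadruples span the same space. Row operations
  lead from one to the other up to a scalar in the last row, and the wedge forces that scalar to be
  1.\<close>

lemma isotopic_if_same_wedge:
  fixes s t :: "4 \<Rightarrow> 'a::field poly poly"
  assumes s: "\<And>i. s i \<in> forms UNIV 4" and t: "\<And>i. t i \<in> forms UNIV 4"
    and eq: "\<And>c. c < 5 \<Longrightarrow> wedge t c = wedge s c" and hd: "wedge_hdet s \<noteq> 0"
  shows "(morphism_of s, morphism_of t) \<in> isotopic_rel"
proof -
  obtain k u where k: "k < 5" "u * wedge s k = 1" using wedge_hdet_ex[OF hd] .
  have "\<exists>a. a \<noteq> 0 \<and> (s, t(3 := cst a * t 3)) \<in> row_step\<^sup>*"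
  proof (rule row_steps_basis)
    fix i
    have "(\<Sum>c<5. form_coeff 4 (t i) c * wedge s c) = (\<Sum>c<5. form_coeff 4 (t i) c * wedge t c)"
      by (rule sum.cong) (simp_all add: eq)
    thus "prod_span UNIV s 1 (t i)"
      using wedge_vanishes[of t i] by (intro prod_span_wedge_kernel[OF s k t]) simp
  next
    fix c assume 0: "(\<Sum>k\<in>UNIV. cst (c k) * t k) = 0"
    define A where "A = wedge_mat t (\<lambda>c. if c = k then 1 else 0)"
    have A: "A \<in> carrier_mat 5 5" by (simp add: A_def)
    have det: "det A \<noteq> 0" using k eq[of k] by (auto simp: A_def wedge_def)
    define v where "v = vec 5 (\<lambda>r. if r < 4 then c (of_nat r) else 0)"
    have v: "v \<in> carrier_vec 5" by (simp add: v_def)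
    have "A\<^sup>T *\<^sub>v v = 0\<^sub>v 5"
    proof (rule eq_vecI)
      fix m assume "m < dim_vec (0\<^sub>v 5 :: 'a vec)"
      hence m: "m < 5" by simp
      have "(A\<^sup>T *\<^sub>v v) $ m = (\<Sum>r<5. A $$ (r, m) * v $ r)"
        using A v m by (simp add: scalar_prod_def atLeast0LessThan)
      also have "\<dots> = (\<Sum>r<4. A $$ (r, m) * v $ r)" by (simp add: eval_nat_numeral v_def)
      also have "\<dots> = (\<Sum>r<4. form_coeff 4 (cst (c (of_nat r)) * t (of_nat r)) m)"
        using m by (intro sum.cong) (simp_all add: A_def wedge_mat_def v_def mult.commute[of "form_coeff 4 f m" for f])
      also have "\<dots> = form_coeff 4 (\<Sum>k\<in>UNIV. cst (c k) * t k) m"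
        unfolding form_coeff_sum sum_UNIV_4 ..
      finally show "(A\<^sup>T *\<^sub>v v) $ m = 0\<^sub>v 5 $ m" using 0 m by simp
    qed (use A in simp)
    hence v0: "v = 0\<^sub>v 5"
      using det_0_iff_vec_prod_zero_field[of "A\<^sup>T" 5] A v det det_transpose[OF A] by auto
    show "\<forall>k. c k = 0"
    proof
      fix i :: 4
      obtain r where r: "r < 4" "of_nat r = i" using ex_of_nat_4 by blast
      have "v $ r = 0" using v0 r by simp
      thus "c i = 0" using r by (simp add: v_def)
    qed
  qed
  then obtain a where a: "(s, t(3 := cst a * t 3)) \<in> row_step\<^sup>*" by blast
  have "wedge s k = a * wedge t k"
    using wedge_row_steps[OF a] wedge_row_scale[of t 3 a k] by simp
  hence "u * wedge s k = a * (u * wedge s k)" using eq[OF k(1)] by (simp add: mult_ac)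
  hence "a = 1" using k(2) by simp
  hence "(s, t) \<in> row_step\<^sup>*" using a by simp
  from row_steps_isotopic[OF this _ generically_spanning_quartic_field[OF s hd]] show ?thesis by simp
qed

lemma isotopy_if_hankel_path:
  fixes x0 :: "'a::field"
  assumes "((x0, x1, x2, x3, x4), (y0, y1, y2, y3, y4)) \<in> hankel_path"
  shows "\<exists>s t. (\<forall>i. s i \<in> forms UNIV 4) \<and> (\<forall>i. t i \<in> forms UNIV 4) \<and>
    wedge_tuple s = (x0, x1, x2, x3, x4) \<and> wedge_tuple t = (y0, y1, y2, y3, y4) \<and>
    (morphism_of s, morphism_of t) \<in> isotopy_rel"
  using assms
proof (cases rule: hankel_path.cases)
  case (1 a b c d e \<delta> k p q)
  \<comment> \<open>Affine reparametrisation: the path has to start at 0 and end at 1.\<close>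
  define g :: "'a poly" where "g = [:p, q - p:]"
  define z where "z j = ([a, b, c, d, e] ! j) \<circ>\<^sub>p g" for j
  have hom: "comm_ring_hom (\<lambda>f. f \<circ>\<^sub>p g)" by unfold_locales (simp_all add: pcompose_add pcompose_mult pcompose_1)
  have "hdet (z 0) (z 1) (z 2) (z 3) (z 4) = hdet a b c d e \<circ>\<^sub>p g"
    unfolding hdet_wedge_base_change[OF hom, symmetric] by (simp add: z_def eval_nat_numeral)
  hence hz: "hdet (z 0) (z 1) (z 2) (z 3) (z 4) = [:\<delta>:]" using 1 by (simp add: pcompose_const)
  have "[:k:] = z 0 \<or> [:k:] = z 1 \<or> [:k:] = z 2"
  proof -
    have "[:k:] \<circ>\<^sub>p g = [:k:]" by (simp add: pcompose_const)
    thus ?thesis using 1 by (auto simp: z_def eval_nat_numeral)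
  qed
  then obtain j where j: "j < 5" "z j = [:k:]"
  proof -
    assume that: "\<And>j. j < 5 \<Longrightarrow> z j = [:k:] \<Longrightarrow> thesis"
    assume "[:k:] = z 0 \<or> [:k:] = z 1 \<or> [:k:] = z 2"
    thus thesis using that[of 0] that[of 1] that[of 2] by auto
  qed
  have "[:1 / k:] * z j = 1" using 1 j by (simp add: one_pCons)
  from ex_quartic_sections[where x = z, OF j(1) this] obtain S where
    S: "\<And>i. S i \<in> forms UNIV 4" "\<And>c. c < 5 \<Longrightarrow> wedge S c = z c" by blast
  have "generically_spanning UNIV 4 S"
  proof (rule generically_spanning_quartic[OF S(1) j(1)])
    show "[:1 / k:] * wedge S j = 1" using S(2)[OF j(1)] \<open>[:1 / k:] * z j = 1\<close> by simp
    show "[:1 / \<delta>:] * hdet (wedge S 0) (wedge S 1) (wedge S 2) (wedge S 3) (wedge S 4) = 1"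
      using hz 1 by (simp add: S(2) one_pCons)
  qed
  from isotopy_rel_if_generically_spanning[OF _ this]
  have iso: "(morphism_of (base_change (\<lambda>p. poly p 0) S), morphism_of (base_change (\<lambda>p. poly p 1) S)) \<in> isotopy_rel"
    by simp
  have f: "base_change (\<lambda>p. poly p r) S i \<in> forms UNIV 4" for r i
    using forms_base_change[OF comm_ring_hom_poly[of r] _ S(1)[of i], of UNIV] by (simp add: base_change_def)
  have w: "wedge (base_change (\<lambda>p. poly p r) S) m = poly (z m) r" if "m < 5" for r m
    using wedge_base_change[OF comm_ring_hom_poly[of r], of S m] S(2)[OF that] by simp
  have z01: "poly (z m) 0 = poly ([a, b, c, d, e] ! m) p" "poly (z m) 1 = poly ([a, b, c, d, e] ! m) q" for m
    by (simp_all add: z_def poly_pcompose g_def)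
  have "wedge_tuple (base_change (\<lambda>p. poly p 0) S) = (x0, x1, x2, x3, x4)"
    "wedge_tuple (base_change (\<lambda>p. poly p 1) S) = (y0, y1, y2, y3, y4)"
    using 1 by (simp_all add: w z01 eval_nat_numeral)
  thus ?thesis using iso f by blast
qed

text \<open>Lifts of consecutive steps share the wedge at the common end but not the sections;
  \<open>isotopic_if_same_wedge\<close> joins them.\<close>

lemma isotopic_if_hankel_path:
  fixes s t :: "4 \<Rightarrow> 'a::field poly poly"
  assumes two: "(2::'a) \<noteq> 0" and s: "\<And>i. s i \<in> forms UNIV 4" and hd: "wedge_hdet s \<noteq> 0"
    and P: "(wedge_tuple s, y) \<in> hankel_path\<^sup>*"
  shows "(\<forall>i. t i \<in> forms UNIV 4) \<Longrightarrow> wedge_tuple t = y \<Longrightarrow> (morphism_of s, morphism_of t) \<in> isotopic_rel"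
  using P
proof (induction arbitrary: t rule: rtrancl_induct)
  case base
  have "wedge t c = wedge s c" if "c < 5" for c
    using less_5_cases[OF that] base.prems(2) by auto
  thus ?case using isotopic_if_same_wedge[OF s _ _ hd] base.prems(1) by blast
next
  case (step y z)
  obtain s' t' where *: "\<And>i. s' i \<in> forms UNIV 4" "\<And>i. t' i \<in> forms UNIV 4" "wedge_tuple s' = y"
    "wedge_tuple t' = z" "(morphism_of s', morphism_of t') \<in> isotopy_rel"
  proof -
    obtain y0 y1 y2 y3 y4 where y: "y = (y0, y1, y2, y3, y4)" by (rule prod_cases5)
    obtain z0 z1 z2 z3 z4 where z: "z = (z0, z1, z2, z3, z4)" by (rule prod_cases5)
    show ?thesis using isotopy_if_hankel_path[OF step.hyps(2)[unfolded y z]] that unfolding y z by blast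
  qed
  have 1: "(morphism_of s, morphism_of s') \<in> isotopic_rel" using step.IH *(1,3) by blast
  have "wedge_hdet s = wedge_hdet t'"
    using hankel_path_isometric[OF two rtrancl_into_rtrancl[OF step.hyps(1,2)] refl *(4)[symmetric]]
    by (simp add: wedge_hdet_def)
  hence hd': "wedge_hdet t' \<noteq> 0" using hd by simp
  have "wedge t c = wedge t' c" if "c < 5" for c
    using less_5_cases[OF that] step.prems(2) *(4) by auto
  hence "(morphism_of t', morphism_of t) \<in> isotopic_rel"
    using isotopic_if_same_wedge[OF *(2) _ _ hd'] step.prems(1) by blast
  thus ?case using 1 *(5) unfolding isotopic_rel_def
    by (meson rtrancl_into_rtrancl rtrancl_trans)
qed

section \<open>Spanning sections and normal forms in low degree\<close>

text \<open>The obstruction argument uses coprimality of polynomials over the algebraic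
  closure.\<close>

instance alg_closure :: (field) field_gcd ..

text \<open>A monomial outside the span would be separated from it by a linear functional, obtained
  by extending a basis of the span.\<close>

lemma prod_span_if_no_functional:
  fixes s :: "4 \<Rightarrow> 'a::field poly poly"
  assumes s: "\<And>i. s i \<in> forms UNIV d" and j0: "j0 \<le> d"
    and functional: "\<And>x. \<exists>j\<le>d. x j \<noteq> 0 \<Longrightarrow> \<exists>i. (\<Sum>j\<le>d. form_coeff d (s i) j * x j) \<noteq> 0"
  shows "prod_span UNIV s 1 (fmono (d - j0) j0)"
proof (rule ccontr)
  assume notin: "\<not> prod_span UNIV s 1 (fmono (d - j0) j0)"
  let ?sc = "\<lambda>(c::'a) (p::'a poly poly). cst c * p"
  interpret vs: vector_space ?sc
    by unfold_locales (simp_all add: cst_add cst_mult algebra_simps)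
  interpret K: vector_space "(*) :: 'a \<Rightarrow> 'a \<Rightarrow> 'a"
    by unfold_locales (simp_all add: algebra_simps)
  interpret pair: vector_space_pair ?sc "(*) :: 'a \<Rightarrow> 'a \<Rightarrow> 'a" ..
  let ?m = "fmono (d - j0) j0 :: 'a poly poly"
  have "vs.subspace {p. prod_span UNIV s 1 p}"
    unfolding vs.subspace_def by (auto intro: prod_span_0 prod_span.add prod_span_scale)
  moreover have "range s \<subseteq> {p. prod_span UNIV s 1 p}"
    using prod_span_section[of UNIV s] by auto
  ultimately have "vs.span (range s) \<subseteq> {p. prod_span UNIV s 1 p}" by (intro vs.span_minimal)
  hence m: "?m \<notin> vs.span (range s)" using notin by auto
  obtain B where B: "B \<subseteq> range s" "vs.independent B" "range s \<subseteq> vs.span B"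
    by (rule vs.maximal_independent_subset)
  have mB: "?m \<notin> vs.span B" using m vs.span_mono[OF B(1)] by auto
  hence "?m \<notin> B" using vs.span_base by auto
  hence "vs.independent (insert ?m B)" using B(2) mB by (simp add: vs.independent_insert)
  from pair.linear_independent_extend[OF this, of "\<lambda>p. if p = ?m then 1 else 0"]
  obtain g where g: "Vector_Spaces.linear ?sc (*) g" "\<And>p. p \<in> insert ?m B \<Longrightarrow> g p = (if p = ?m then 1 else 0)"
    by blast
  interpret g: Vector_Spaces.linear ?sc "(*)" g by (rule g(1))
  have gB: "g p = 0" if "p \<in> vs.span B" for p
  proof (rule g.eq_0_on_span[OF _ that])
    fix p assume "p \<in> B"
    thus "g p = 0" using g(2)[of p] \<open>?m \<notin> B\<close> by auto
  qed
  define x where "x j = g (fmono (d - j) j)" for j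
  have "x j0 \<noteq> 0" using g(2)[of ?m] by (simp add: x_def)
  then obtain i where i: "(\<Sum>j\<le>d. form_coeff d (s i) j * x j) \<noteq> 0" using functional[of x] j0 by blast
  have "g (s i) = g (form_of d (form_coeff d (s i)))" using form_of_coeff[OF s] by simp
  also have "\<dots> = (\<Sum>j\<le>d. form_coeff d (s i) j * x j)"
    unfolding form_of_def g.sum x_def by (rule sum.cong[OF refl]) (rule g.scale)
  finally show False using gB[of "s i"] B(3) i by auto
qed

text \<open>The quadric is a kernel vector of the catalecticant matrix with d - 1 rows and 3
  columns. For d < 4 it is padded with zero rows, so its determinant vanishes in all cases.\<close>

lemma apolar_quadric:
  fixes x :: "nat \<Rightarrow> 'l::field"
  assumes "d = 2 \<or> d = 3 \<or> d = 4 \<and> hdet (x 0) (x 1) (x 2) (x 3) (x 4) = 0"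
  shows "\<exists>q0 q1 q2. (q0, q1, q2) \<noteq> (0, 0, 0) \<and>
    (\<forall>i. i + 2 \<le> d \<longrightarrow> q0 * x i + q1 * x (i + 1) + q2 * x (i + 2) = 0)"
proof -
  define M where "M = mat 3 3 (\<lambda>(i, j). if i + 2 \<le> d then x (i + j) else 0)"
  have M: "M \<in> carrier_mat 3 3" by (simp add: M_def)
  have "det M = 0"
  proof (cases "d = 4")
    case True
    hence "det M = hdet (x 0) (x 1) (x 2) (x 3) (x 4)"
      unfolding det_3[OF M] by (simp add: M_def hdet_def algebra_simps eval_nat_numeral)
    thus ?thesis using assms True by auto
  next
    case False
    thus ?thesis unfolding det_3[OF M] using assms by (auto simp: M_def)
  qed
  then obtain v where v: "v \<in> carrier_vec 3" "v \<noteq> 0\<^sub>v 3" "M *\<^sub>v v = 0\<^sub>v 3"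
    using det_0_iff_vec_prod_zero_field[OF M] by blast
  have "v $ 0 * x i + v $ 1 * x (i + 1) + v $ 2 * x (i + 2) = 0" if "i + 2 \<le> d" for i
  proof -
    have i: "i < 3" using that assms by auto
    have "0 = (M *\<^sub>v v) $ i" using v(3) i by simp
    also have "\<dots> = (\<Sum>j\<in>{0..<3}. M $$ (i, j) * v $ j)" using M v(1) i by (simp add: scalar_prod_def)
    also have "\<dots> = x i * v $ 0 + x (i + 1) * v $ 1 + x (i + 2) * v $ 2"
      unfolding sum_3 using i that by (simp add: M_def)
    finally show ?thesis by (simp add: mult.commute)
  qed
  moreover have "(v $ 0, v $ 1, v $ 2) \<noteq> (0, 0, 0)"
  proof
    assume *: "(v $ 0, v $ 1, v $ 2) = (0, 0, 0)"
    have "v = 0\<^sub>v 3"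
    proof (rule eq_vecI)
      fix i assume "i < dim_vec (0\<^sub>v 3 :: 'l vec)"
      hence "i < 3" by simp
      from less_3_cases[OF this] show "v $ i = 0\<^sub>v 3 $ i" using * by (elim disjE) simp_all
    qed (use v(1) in simp)
    thus False using v(2) by simp
  qed
  ultimately show ?thesis by blast
qed

lemma closed_embedding_functional:
  fixes s :: "4 \<Rightarrow> 'f::field poly poly" and h :: "'f \<Rightarrow> 'l::field_gcd"
  assumes "closed_embedding F d s" "semiring_set F" "comm_ring_hom h"
    and "d = 2 \<or> d = 3 \<or> d = 4 \<and> hdet (x 0) (x 1) (x 2) (x 3) (x 4) = 0" and "\<exists>j\<le>d. x j \<noteq> 0"
  shows "\<exists>i. (\<Sum>j\<le>d. h (form_coeff d (s i) j) * x j) \<noteq> 0"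
proof (rule ccontr)
  assume "\<nexists>i. (\<Sum>j\<le>d. h (form_coeff d (s i) j) * x j) \<noteq> 0"
  hence van: "\<And>i. (\<Sum>j\<le>d. h (form_coeff d (s i) j) * x j) = 0" by blast
  obtain q0 q1 q2 where "(q0, q1, q2) \<noteq> (0, 0, 0)"
    "\<And>i. i + 2 \<le> d \<Longrightarrow> q0 * x i + q1 * x (i + 1) + q2 * x (i + 2) = 0"
    using apolar_quadric[OF assms(4)] by blast
  from closed_embedding_functional_rank[OF assms(1-3) _ assms(5) van this] show False
    using assms(4) by auto
qed

text \<open>On linear forms a nonzero functional is evaluation at a point, which would be a common
  zero of the sections.\<close>

lemma closed_embedding_1_functional:
  fixes s :: "4 \<Rightarrow> 'f::field poly poly"
  assumes "closed_embedding UNIV 1 s" "\<exists>j\<le>1. x j \<noteq> 0"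
  shows "\<exists>i. (\<Sum>j\<le>1. form_coeff 1 (s i) j * x j) \<noteq> 0"
proof (rule ccontr)
  assume "\<nexists>i. (\<Sum>j\<le>1. form_coeff 1 (s i) j * x j) \<noteq> 0"
  hence van: "form_coeff 1 (s i) 0 * x 0 + form_coeff 1 (s i) 1 * x 1 = 0" for i by simp
  have s: "\<And>i. s i \<in> forms UNIV 1" and gen: "generating_sections UNIV 1 s"
    using assms(1) by (auto simp: closed_embedding_def generating_sections_def)
  obtain N where N: "forms UNIV N \<subseteq> {\<Sum>i\<in>UNIV. c i * s i | c. range c \<subseteq> bivariate UNIV}"
    using gen unfolding generating_sections_def by blast
  have hid: "comm_ring_hom (\<lambda>a::'f. a)" by unfold_locales simp_all
  let ?e = "eval_form (\<lambda>a. a) [:x 0:] [:x 1:]"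
  interpret e: comm_ring_hom ?e by (rule comm_ring_hom_eval_form[OF hid])
  have "?e (s i) = [:form_coeff 1 (s i) 0 * x 0 + form_coeff 1 (s i) 1 * x 1:]" for i
    unfolding eval_form_forms[OF hid s] by (simp add: mult.commute)
  hence es: "?e (s i) = 0" for i unfolding van by simp
  have "?e f = 0" if f: "f \<in> forms UNIV N" for f
  proof -
    obtain c where "f = (\<Sum>i\<in>UNIV. c i * s i)" using N f by blast
    thus ?thesis by (simp only: e.hom_sum e.hom_mult es mult_zero_right sum.neutral_const)
  qed
  from this[of "fmono N 0"] this[of "fmono 0 N"] have "[:x 0:] ^ N = 0" "[:x 1:] ^ N = 0"
    using forms_fmono'[of UNIV N 0 N] forms_fmono'[of UNIV 0 N N] by (simp_all add: eval_form_fmono[OF hid])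
  hence "x 0 = 0" "x 1 = 0" by simp_all
  moreover obtain j where "j \<le> 1" "x j \<noteq> 0" using assms(2) by blast
  ultimately show False by (cases j) auto
qed

lemma closed_embedding_spans:
  fixes s :: "4 \<Rightarrow> 'a::field poly poly"
  assumes emb: "closed_embedding UNIV d s" and d: "d \<in> {1, 2, 3}" and f: "f \<in> forms UNIV d"
  shows "prod_span UNIV s 1 f"
proof (rule prod_span_forms[OF semiring_set_UNIV _ f])
  have s: "\<And>i. s i \<in> forms UNIV d"
    using emb by (auto simp: closed_embedding_def generating_sections_def)
  fix i j assume ij: "i + j = d"
  have "prod_span UNIV s 1 (fmono (d - j) j)"
  proof (rule prod_span_if_no_functional[OF s])
    fix x :: "nat \<Rightarrow> 'a" assume x: "\<exists>j\<le>d. x j \<noteq> 0"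
    show "\<exists>i. (\<Sum>j\<le>d. form_coeff d (s i) j * x j) \<noteq> 0"
    proof (cases "d = 1")
      case True
      thus ?thesis using closed_embedding_1_functional[of s x] emb x by simp
    next
      case False
      \<comment> \<open>The last alternative cannot occur here; it keeps the shape required by
        \<open>closed_embedding_functional\<close>.\<close>
      hence "d = 2 \<or> d = 3 \<or> d = 4 \<and> hdet (to_ac (x 0)) (to_ac (x 1)) (to_ac (x 2)) (to_ac (x 3)) (to_ac (x 4)) = 0"
        using d by auto
      moreover have "\<exists>j\<le>d. to_ac (x j) \<noteq> 0" using x by simp
      ultimately obtain i where "(\<Sum>j\<le>d. to_ac (form_coeff d (s i) j) * to_ac (x j)) \<noteq> 0"
        using closed_embedding_functional[where x = "\<lambda>j. to_ac (x j)", OF emb semiring_set_UNIV comm_ring_hom_to_ac]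
        by blast
      moreover have "(\<Sum>j\<le>d. to_ac (form_coeff d (s i) j) * to_ac (x j)) = to_ac (\<Sum>j\<le>d. form_coeff d (s i) j * x j)"
        by (simp add: to_ac_sum)
      ultimately show ?thesis by auto
    qed
  qed (use ij in simp)
  thus "prod_span UNIV s 1 (fmono i j)" using ij by auto
qed

lemma closed_embedding_forms: "closed_embedding F d s \<Longrightarrow> s i \<in> forms F d"
  by (simp add: closed_embedding_def generating_sections_def)

lemma generically_spanning_if_spans:
  assumes "\<And>i. s i \<in> forms UNIV d" "\<And>f. f \<in> forms UNIV d \<Longrightarrow> prod_span UNIV s 1 f"
  shows "generically_spanning UNIV d s"
  unfolding generically_spanning_def using assms forms_fmono'[of UNIV]
  by (intro conjI allI exI[of _ 1]) auto

lemma sym_row_steps: "(s, t) \<in> row_step\<^sup>* \<Longrightarrow> (t, s) \<in> row_step\<^sup>*"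
proof (rule symD[OF sym_rtrancl])
  have "row_add (- c) i j (row_add c i j s) = s" if "i \<noteq> j" for c i j and s :: "4 \<Rightarrow> 'a poly poly"
    using that by (auto simp: row_add_def fun_eq_iff cst_minus)
  thus "sym (row_step :: ((4 \<Rightarrow> 'a poly poly) \<times> _) set)"
    unfolding sym_def row_step_def by (auto; metis)
qed

section \<open>Standard monomial sections\<close>

definition index4 :: "4 \<Rightarrow> nat" where
  "index4 i = (if i = 0 then 0 else if i = 1 then 1 else if i = 2 then 2 else 3)"

definition standard_sections :: "nat \<Rightarrow> 4 \<Rightarrow> 'r::comm_ring_1 poly poly" where
  "standard_sections d i = (if index4 i \<le> d then fmono (d - index4 i) (index4 i) else 0)"

lemma index4_simps [simp]: "index4 0 = 0" "index4 1 = 1" "index4 2 = 2" "index4 3 = 3"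
  by (simp_all add: index4_def)

lemma index4_eq_iff: "index4 i = index4 j \<longleftrightarrow> i = j"
proof -
  have "i \<in> {0, 1, 2, 3}" "j \<in> {0, 1, 2, 3}" using UNIV_4 by blast+
  thus ?thesis by auto
qed

lemma form_coeff_standard:
  assumes "l \<le> d"
  shows "form_coeff d (standard_sections d i :: 'r::comm_ring_1 poly poly) l = (if index4 i = l then 1 else 0)"
  using assms by (auto simp: standard_sections_def form_coeff_fmono)

lemma standard_sections_forms: "standard_sections d i \<in> forms UNIV d"
  by (auto simp: standard_sections_def intro!: forms_fmono' forms_0)

lemma form_coeff_standard_sum:
  assumes "index4 i \<le> d"
  shows "form_coeff d (\<Sum>k\<in>J. cst (c k) * standard_sections d k) (index4 i) =
    (if i \<in> J then c i else (0::'r::comm_ring_1))"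
proof -
  have "form_coeff d (\<Sum>k\<in>J. cst (c k) * standard_sections d k) (index4 i) =
      (\<Sum>k\<in>J. if k = i then c i else 0)"
    unfolding form_coeff_sum
    by (rule sum.cong) (auto simp: form_coeff_standard[OF assms] index4_eq_iff)
  thus ?thesis by simp
qed

lemma standard_sections_indep:
  assumes "index4 i \<le> d" "i \<notin> J"
  shows "standard_sections d i \<noteq> (\<Sum>k\<in>J. cst (c k) * standard_sections d k :: 'r::comm_ring_1 poly poly)"
proof
  assume *: "standard_sections d i = (\<Sum>k\<in>J. cst (c k) * standard_sections d k :: 'r poly poly)"
  show False
    using arg_cong[OF *, of "\<lambda>p. form_coeff d p (index4 i)"] assms
    by (simp add: form_coeff_standard_sum form_coeff_standard)
qed

text \<open>At most three monomials have to be placed, so each placement has a spare row and no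
  scalar is left over. The remaining rows are combinations of the placed ones and can be
  cleared.\<close>

lemma row_steps_standard:
  fixes s :: "4 \<Rightarrow> 'a::field poly poly"
  assumes s: "\<And>i. s i \<in> forms UNIV d" and span: "\<And>f. f \<in> forms UNIV d \<Longrightarrow> prod_span UNIV s 1 f"
    and d: "d = 1 \<or> d = 2"
  shows "(s, standard_sections d) \<in> row_step\<^sup>*"
proof -
  let ?w = "standard_sections d :: 4 \<Rightarrow> 'a poly poly"
  have sp: "prod_span UNIV t 1 (?w i)" if "(s, t) \<in> row_step\<^sup>*" for t i
    by (rule row_steps_span[OF that span[OF standard_sections_forms]])
  have fm: "t i \<in> forms UNIV d" if "(s, t) \<in> row_step\<^sup>*" for t i
    using row_steps_isotopic[OF that _ generically_spanning_if_spans[OF s span]] d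
    by (auto simp: generically_spanning_def)
  have "\<exists>t. (s, t) \<in> row_step\<^sup>* \<and> (\<forall>k\<in>insert 0 {}. t k = ?w k)"
    by (rule row_steps_extend[where j = 1, OF sp[OF rtrancl_refl] _ _ _ _ standard_sections_indep]) simp_all
  then obtain t0 where t0: "(s, t0) \<in> row_step\<^sup>*" "t0 0 = ?w 0" by blast
  have "\<exists>t. (t0, t) \<in> row_step\<^sup>* \<and> (\<forall>k\<in>insert 1 {0}. t k = ?w k)"
    by (rule row_steps_extend[where j = 2, OF sp[OF t0(1)] _ _ _ _ standard_sections_indep])
       (use t0(2) d in auto)
  then obtain t1 where t1: "(t0, t1) \<in> row_step\<^sup>*" "t1 0 = ?w 0" "t1 1 = ?w 1" by blast
  have st1: "(s, t1) \<in> row_step\<^sup>*" by (rule rtrancl_trans[OF t0(1) t1(1)])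
  have clear: "(t, t(i := 0)) \<in> row_step\<^sup>*"
    if t: "(s, t) \<in> row_step\<^sup>*" and J: "\<And>k. index4 k \<le> d \<Longrightarrow> t k = ?w k" and i: "d < index4 i" for t i
  proof (rule row_steps_clear[where A = "{k. index4 k \<le> d}"])
    have "t i = (\<Sum>k\<in>{k. index4 k \<le> d}. cst (form_coeff d (t i) (index4 k)) * ?w k)"
    proof (rule forms_eqI[OF fm[OF t]])
      show "(\<Sum>k\<in>{k. index4 k \<le> d}. cst (form_coeff d (t i) (index4 k)) * ?w k) \<in> forms UNIV d"
        by (intro forms_sum forms_cst_mult standard_sections_forms) auto
      fix l assume l: "l \<le> d"
      hence "l = 0 \<or> l = 1 \<or> l = 2" using d by auto
      hence "index4 (of_nat l) = l" by (elim disjE) simp_all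
      thus "form_coeff d (t i) l =
          form_coeff d (\<Sum>k\<in>{k. index4 k \<le> d}. cst (form_coeff d (t i) (index4 k)) * ?w k) l"
        using form_coeff_standard_sum[of "of_nat l" d "\<lambda>k. form_coeff d (t i) (index4 k)" "{k. index4 k \<le> d}"] l
        by simp
    qed
    also have "\<dots> = (\<Sum>k\<in>{k. index4 k \<le> d}. cst (form_coeff d (t i) (index4 k)) * t k)"
      by (rule sum.cong) (simp_all add: J)
    finally show "t i = (\<Sum>k\<in>{k. index4 k \<le> d}. cst (form_coeff d (t i) (index4 k)) * t k)" .
  qed (use i in simp)
  have all4: "P k" if "P 0" "P 1" "P 2" "P 3" for P and k :: 4
  proof -
    have "k \<in> {0, 1, 2, 3}" using UNIV_4 by blast
    thus ?thesis using that by auto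
  qed
  show ?thesis
    using d
  proof
    assume d: "d = 1"
    have J: "index4 k \<le> d \<longrightarrow> t1 k = ?w k" for k by (rule all4) (use t1 d in simp_all)
    have 2: "(t1, t1(2 := 0)) \<in> row_step\<^sup>*" by (rule clear[OF st1]) (use J d in auto)
    have st2: "(s, t1(2 := 0)) \<in> row_step\<^sup>*" by (rule rtrancl_trans[OF st1 2])
    have 3: "(t1(2 := 0), (t1(2 := 0))(3 := 0)) \<in> row_step\<^sup>*"
      by (rule clear[OF st2]) (use J d in auto)
    have "((t1(2 := 0))(3 := 0)) k = ?w k" for k
      by (rule all4) (use t1 d in \<open>simp_all add: standard_sections_def\<close>)
    hence "(t1(2 := 0))(3 := 0) = ?w" by blast
    thus ?thesis using rtrancl_trans[OF st2 3] by simp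
  next
    assume d: "d = 2"
    have "\<exists>t. (t1, t) \<in> row_step\<^sup>* \<and> (\<forall>k\<in>insert 2 {0, 1}. t k = ?w k)"
      by (rule row_steps_extend[where j = 3, OF sp[OF st1] _ _ _ _ standard_sections_indep])
         (use t1 d in auto)
    then obtain t2 where t2: "(t1, t2) \<in> row_step\<^sup>*" "t2 0 = ?w 0" "t2 1 = ?w 1" "t2 2 = ?w 2" by blast
    have st2: "(s, t2) \<in> row_step\<^sup>*" by (rule rtrancl_trans[OF st1 t2(1)])
    have J: "index4 k \<le> d \<longrightarrow> t2 k = ?w k" for k by (rule all4) (use t2 d in simp_all)
    have 3: "(t2, t2(3 := 0)) \<in> row_step\<^sup>*" by (rule clear[OF st2]) (use J d in auto)
    have "(t2(3 := 0)) k = ?w k" for k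
      by (rule all4) (use t2 d in \<open>simp_all add: standard_sections_def\<close>)
    hence "t2(3 := 0) = ?w" by blast
    thus ?thesis using rtrancl_trans[OF st2 3] by simp
  qed
qed

lemma isotopic_degree_le_2:
  fixes \<psi> \<psi>' :: "(4 \<Rightarrow> 'a::field poly poly) set"
  assumes d: "d \<in> {1, 2}" and "\<psi> \<in> embeddings d" "\<psi>' \<in> embeddings d"
  shows "(\<psi>, \<psi>') \<in> isotopic_rel"
proof -
  obtain s t where s: "\<psi> = morphism_of s" "closed_embedding UNIV d s"
    and t: "\<psi>' = morphism_of t" "closed_embedding UNIV d t"
    using assms by (auto simp: embeddings_def)
  have d': "d = 1 \<or> d = 2" "d \<in> {1, 2, 3}" "d > 0" using d by auto
  note S = row_steps_standard[OF closed_embedding_forms[OF s(2)] closed_embedding_spans[OF s(2) d'(2)] d'(1)]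
  note T = row_steps_standard[OF closed_embedding_forms[OF t(2)] closed_embedding_spans[OF t(2) d'(2)] d'(1)]
  from row_steps_isotopic[OF rtrancl_trans[OF S sym_row_steps[OF T]] d'(3)
      generically_spanning_if_spans[OF closed_embedding_forms[OF s(2)] closed_embedding_spans[OF s(2) d'(2)]]]
  show ?thesis using s t by simp
qed

section \<open>Invariants of embeddings\<close>

lemma mem_morphism_of: "t \<in> morphism_of s \<longleftrightarrow> (\<exists>c. c \<noteq> 0 \<and> t = (\<lambda>i. cst c * s i))"
  by (auto simp: morphism_of_def smult_const_eq_cst)

lemma morphism_of_eqD:
  assumes "morphism_of s = morphism_of t"
  shows "\<exists>c. c \<noteq> 0 \<and> t = (\<lambda>i. cst c * s i)"
proof -
  have "t \<in> morphism_of t" unfolding mem_morphism_of by (rule exI[of _ 1]) simp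
  thus ?thesis using assms unfolding mem_morphism_of[symmetric] by simp
qed

lemma morphism_of_scale:
  assumes "c \<noteq> 0"
  shows "morphism_of (\<lambda>i. cst c * s i) = morphism_of s"
proof (rule equalityI; rule subsetI)
  fix t assume "t \<in> morphism_of (\<lambda>i. cst c * s i)"
  then obtain b where b: "b \<noteq> 0" "t = (\<lambda>i. cst b * (cst c * s i))" by (auto simp: mem_morphism_of)
  hence "t = (\<lambda>i. cst (b * c) * s i)" by (simp add: cst_mult mult.assoc)
  thus "t \<in> morphism_of s" using b(1) assms unfolding mem_morphism_of by (intro exI[of _ "b * c"]) simp
next
  fix t assume "t \<in> morphism_of s"
  then obtain b where b: "b \<noteq> 0" "t = (\<lambda>i. cst b * s i)" by (auto simp: mem_morphism_of)
  have "cst (b / c) * cst c = cst b" using assms by (simp add: cst_mult[symmetric])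
  hence "t = (\<lambda>i. cst (b / c) * (cst c * s i))" using b(2) by (simp add: mult.assoc[symmetric])
  thus "t \<in> morphism_of (\<lambda>i. cst c * s i)"
    using b(1) assms unfolding mem_morphism_of by (intro exI[of _ "b / c"]) simp
qed

lemma closed_embedding_nonzero:
  assumes "closed_embedding F d s" "semiring_set F"
  shows "\<exists>i. s i \<noteq> 0"
proof (rule ccontr)
  assume s: "\<nexists>i. s i \<noteq> 0"
  obtain N where N: "forms F N \<subseteq> {\<Sum>i\<in>UNIV. c i * s i | c. range c \<subseteq> bivariate F}"
    using assms(1) by (auto simp: closed_embedding_def generating_sections_def)
  have "fmono N 0 \<in> forms F N" by (rule forms_fmono'[OF assms(2)]) simp
  hence "fmono N 0 \<in> {\<Sum>i\<in>UNIV. c i * s i | c. range c \<subseteq> bivariate F}" using N by blast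
  hence "fmono N 0 = (0 :: 'a poly poly)" using s by auto
  hence "coeff (coeff (fmono N 0 :: 'a poly poly) 0) N = 0" by simp
  thus False by (simp add: coeff_fmono)
qed

lemma forms_degree_unique:
  assumes "f \<in> forms R d" "f \<in> forms R' e" "f \<noteq> 0"
  shows "d = e"
proof -
  obtain j where "coeff f j \<noteq> 0" using assms(3) by (metis leading_coeff_0_iff)
  then obtain i where "coeff (coeff f j) i \<noteq> 0" by (metis leading_coeff_0_iff)
  thus ?thesis using assms(1,2) by (auto simp: forms_def)
qed

lemma embeddings_degree:
  fixes s :: "4 \<Rightarrow> 'a::field poly poly"
  assumes "morphism_of s \<in> embeddings d" "\<And>i. s i \<in> forms UNIV e"
  shows "d = e"
proof -
  obtain t where t: "morphism_of s = morphism_of t" "closed_embedding UNIV d t"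
    using assms(1) by (auto simp: embeddings_def)
  obtain c where c: "t = (\<lambda>i. cst c * s i)" using morphism_of_eqD[OF t(1)] by blast
  obtain i where i: "t i \<noteq> 0" using closed_embedding_nonzero[OF t(2) semiring_set_UNIV] by blast
  have "t i \<in> forms UNIV e" unfolding c by (intro forms_cst_mult assms(2)) simp_all
  thus ?thesis using forms_degree_unique[OF closed_embedding_forms[OF t(2)] _ i] by blast
qed

text \<open>The definition leaves the degrees of the path and of its ends independent. They agree
  since a nonzero form has only one degree.\<close>

lemma isotopy_relE:
  assumes "(\<psi>, \<psi>') \<in> isotopy_rel" "\<psi> \<in> embeddings d"
  obtains S where "isotopy d S" "\<psi> = morphism_of (base_change (\<lambda>p. poly p 0) S)"
    "\<psi>' = morphism_of (base_change (\<lambda>p. poly p 1) S)" "\<psi>' \<in> embeddings d"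
proof -
  obtain e e' S where S: "isotopy e' S" "\<psi> = morphism_of (base_change (\<lambda>p. poly p 0) S)"
    "\<psi>' = morphism_of (base_change (\<lambda>p. poly p 1) S)" "\<psi>' \<in> embeddings e"
    using assms(1) unfolding isotopy_rel_def by blast
  have "\<And>i. S i \<in> forms UNIV e'" using S(1) by (auto simp: isotopy_def generating_sections_def)
  hence f: "base_change (\<lambda>p. poly p r) S i \<in> forms UNIV e'" for r i
    unfolding base_change_def by (intro forms_base_change[OF comm_ring_hom_poly]) auto
  have "d = e'"
    using embeddings_degree[where s = "base_change (\<lambda>p. poly p 0) S", OF _ f] assms(2) S(2) by simp
  moreover have "e = e'"
    using embeddings_degree[where s = "base_change (\<lambda>p. poly p 1) S", OF _ f] S(3,4) by simp
  ultimately show ?thesis using that S by blast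
qed

lemma isotopic_embeddings:
  "(\<psi>, \<psi>') \<in> isotopic_rel \<Longrightarrow> \<psi> \<in> embeddings d \<Longrightarrow> \<psi>' \<in> embeddings d"
  unfolding isotopic_rel_def
  by (induction rule: rtrancl_induct) (auto elim: isotopy_relE)

lemma isotopic_invariant:
  assumes step: "\<And>S. isotopy d S \<Longrightarrow> g (morphism_of (base_change (\<lambda>p. poly p 0) S)) =
      g (morphism_of (base_change (\<lambda>p. poly p 1) S))"
    and "(\<psi>, \<psi>') \<in> isotopic_rel" "\<psi> \<in> embeddings d"
  shows "g \<psi> = g \<psi>'"
  using assms(2) unfolding isotopic_rel_def
proof (induction rule: rtrancl_induct)
  case (step \<chi> \<chi>')
  have "\<chi> \<in> embeddings d"
    using isotopic_embeddings[of \<psi> \<chi> d] step.hyps(1) assms(3) by (simp add: isotopic_rel_def)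
  then obtain S where "isotopy d S" "\<chi> = morphism_of (base_change (\<lambda>p. poly p 0) S)"
    "\<chi>' = morphism_of (base_change (\<lambda>p. poly p 1) S)"
    using step.hyps(2) by (elim isotopy_relE)
  thus ?case using assms(1) step.IH by simp
qed simp

text \<open>Turns non-degeneracy on all closed fibres into constancy along the affine line.\<close>

lemma polynomial_const_if_no_root:
  fixes p :: "'a::field poly"
  assumes "\<And>\<alpha>. eval_ac \<alpha> p \<noteq> 0"
  obtains \<delta> where "\<delta> \<noteq> 0" "p = [:\<delta>:]"
proof -
  have "degree p = 0"
  proof (rule ccontr)
    assume "degree p \<noteq> 0"
    hence "degree (map_poly to_ac p) > 0" by (simp add: degree_map_poly)
    from alg_closed_imp_poly_has_root[OF this] show False using assms by (auto simp: eval_ac_def)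
  qed
  then obtain \<delta> where "p = [:\<delta>:]" by (rule degree_eq_zeroE)
  moreover have "\<delta> \<noteq> 0" using assms[of 0] \<open>p = [:\<delta>:]\<close> by (auto simp: eval_ac_def)
  ultimately show ?thesis using that by blast
qed

text \<open>A kernel vector of the singular wedge matrix: the first four rows say that it kills the
  sections, the last one that its k-th value is 0.\<close>

lemma wedge_0_functional:
  fixes s :: "4 \<Rightarrow> 'a::field poly poly"
  assumes "wedge s k = 0" "k < 5"
  obtains x where "x k = 0" "\<exists>c\<le>4. x c \<noteq> 0" "\<And>i. (\<Sum>c\<le>4. form_coeff 4 (s i) c * x c) = 0"
proof -
  define A where "A = wedge_mat s (\<lambda>c. if c = k then 1 else 0)"
  have A: "A \<in> carrier_mat 5 5" by (simp add: A_def)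
  have "det A = 0" using assms(1) by (simp add: A_def wedge_def)
  then obtain v where v: "v \<in> carrier_vec 5" "v \<noteq> 0\<^sub>v 5" "A *\<^sub>v v = 0\<^sub>v 5"
    using det_0_iff_vec_prod_zero_field[OF A] by blast
  have Av: "(\<Sum>c<5. A $$ (r, c) * v $ c) = 0" if "r < 5" for r
  proof -
    have "(A *\<^sub>v v) $ r = 0" using v(3) that by simp
    thus ?thesis using A v(1) that by (simp add: scalar_prod_def atLeast0LessThan)
  qed
  have set: "{..<5} = {..4::nat}" by auto
  have "(\<Sum>c<5. if c = k then v $ c else 0) = (\<Sum>c<5. A $$ (4, c) * v $ c)"
    by (rule sum.cong) (simp_all add: A_def wedge_mat_def)
  hence 1: "v $ k = 0" using Av[of 4] assms(2) by simp
  have "\<exists>c<5. v $ c \<noteq> 0"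
  proof (rule ccontr)
    assume "\<not> (\<exists>c<5. v $ c \<noteq> 0)"
    hence "v = 0\<^sub>v 5" using v(1) by (intro eq_vecI) auto
    thus False using v(2) by simp
  qed
  hence 2: "\<exists>c\<le>4. v $ c \<noteq> 0" using set by auto
  have 3: "(\<Sum>c\<le>4. form_coeff 4 (s i) c * v $ c) = 0" for i
  proof -
    obtain r where r: "r < 4" "of_nat r = i" using ex_of_nat_4 by blast
    have "(\<Sum>c<5. form_coeff 4 (s i) c * v $ c) = (\<Sum>c<5. A $$ (r, c) * v $ c)"
      by (rule sum.cong) (use r in \<open>simp_all add: A_def wedge_mat_def\<close>)
    thus ?thesis using Av[of r] r(1) by (simp add: set)
  qed
  show ?thesis by (rule that[of "\<lambda>c. v $ c", OF 1 2 3])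
qed

lemma comm_ring_hom_ident: "comm_ring_hom (\<lambda>x. x)"
  by unfold_locales simp_all

text \<open>
  The determinant of the coefficient matrix of four cubic forms, up to sign: multiplication by
  \<open>v\<close> embeds the cubic forms into the quartic forms without \<open>u\<^sup>4\<close>.
\<close>
definition cubic_det :: "(4 \<Rightarrow> 'r::comm_ring_1 poly poly) \<Rightarrow> 'r" where
  "cubic_det s = wedge (\<lambda>i. s i * fmono 0 1) 0"

lemma form_coeff_shift:
  fixes f :: "'a::comm_ring_1 poly poly"
  shows "form_coeff 4 (f * fmono 0 1) c = (if c = 0 then 0 else form_coeff 3 f (c - 1))"
proof -
  have "fmono 0 (Suc 0) = (monom 1 (Suc 0) :: 'a poly poly)" by (simp add: fmono_def)
  thus ?thesis
    by (cases c) (simp_all add: form_coeff_def mult.commute[of f "monom 1 (Suc 0)"] coeff_monom_mult)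
qed

lemma cubic_det_row_steps: "(s, t) \<in> row_step\<^sup>* \<Longrightarrow> cubic_det t = cubic_det s"
proof (induction rule: rtrancl_induct)
  case (step t u)
  then obtain c i j where u: "u = row_add c i j t" "i \<noteq> j" by (auto simp: row_step_def)
  have "(\<lambda>k. u k * fmono 0 1) = row_add c i j (\<lambda>k. t k * fmono 0 1)"
    by (auto simp: u row_add_def fun_eq_iff algebra_simps)
  thus ?case using step.IH wedge_row_add[OF u(2), of c "\<lambda>k. t k * fmono 0 1" 0]
    by (simp add: cubic_det_def del: One_nat_def)
qed simp

lemma cubic_det_row_scale: "cubic_det (s(i := cst a * s i)) = a * cubic_det s"
proof -
  have "(\<lambda>k. (s(i := cst a * s i)) k * fmono 0 1) =
      (\<lambda>k. s k * fmono 0 1)(i := cst a * (s i * fmono 0 1))"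
    by (auto simp: fun_eq_iff)
  thus ?thesis using wedge_row_scale[of "\<lambda>k. s k * fmono 0 1" i a 0] by (simp add: cubic_det_def)
qed

lemma cubic_det_scale: "cubic_det (\<lambda>i. cst a * s i) = a ^ 4 * cubic_det s"
  using wedge_scale[of a "\<lambda>k. s k * fmono 0 1" 0] by (simp add: cubic_det_def mult.assoc)

lemma cubic_det_base_change:
  assumes "comm_ring_hom h"
  shows "cubic_det (base_change h s) = h (cubic_det s)"
proof -
  interpret h: comm_ring_hom h by fact
  interpret hp: map_poly_comm_ring_hom h ..
  interpret hpp: map_poly_comm_ring_hom "map_poly h" ..
  have "(\<lambda>i. base_change h s i * fmono 0 1) = base_change h (\<lambda>i. s i * fmono 0 1)"
    by (simp add: base_change_def hpp.hom_mult map_fmono)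
  thus ?thesis using wedge_base_change[OF assms] by (simp add: cubic_det_def)
qed

lemma form_coeff_base_change:
  "comm_ring_hom h \<Longrightarrow> form_coeff d (base_change h s i) j = h (form_coeff d (s i) j)"
proof -
  assume "comm_ring_hom h"
  then interpret comm_ring_hom h .
  show ?thesis by (simp add: form_coeff_def base_change_def coeff_map_poly)
qed

text \<open>A zero determinant yields a functional on quartics that vanishes at u^4 and kills v
  times the sections. Shifted by one index it is a nonzero functional on cubics that kills the
  sections, which is obstructed.\<close>

lemma closed_embedding_cubic_det:
  fixes s :: "4 \<Rightarrow> 'f::field poly poly" and h :: "'f \<Rightarrow> 'l::field_gcd"
  assumes "closed_embedding F 3 s" "semiring_set F" "comm_ring_hom h"
  shows "cubic_det s \<noteq> 0"
proof
  assume 0: "cubic_det s = 0"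
  interpret h: comm_ring_hom h by (rule assms(3))
  have "cubic_det (base_change h s) = 0" by (simp add: cubic_det_base_change[OF assms(3)] 0)
  then obtain x where x: "x 0 = 0" "\<exists>c\<le>4. x c \<noteq> 0"
    "\<And>i. (\<Sum>c\<le>4. form_coeff 4 (base_change h s i * fmono 0 1) c * x c) = 0"
    unfolding cubic_det_def by (rule wedge_0_functional) simp_all
  have split: "{..4::nat} = insert 0 (Suc ` {..3})"
    using atMost_Suc_eq_insert_0[of 3] by simp
  have "\<exists>c\<in>{..4}. x c \<noteq> 0" using x(2) by auto
  hence "\<exists>j\<le>3. x (Suc j) \<noteq> 0" using x(1) unfolding split by auto
  from closed_embedding_functional[where x = "\<lambda>j. x (Suc j)", OF assms _ this]
  obtain i where i: "(\<Sum>j\<le>3. h (form_coeff 3 (s i) j) * x (Suc j)) \<noteq> 0" by auto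
  have "(\<Sum>c\<le>4. form_coeff 4 (base_change h s i * fmono 0 1) c * x c) =
      (\<Sum>j\<le>3. h (form_coeff 3 (s i) j) * x (Suc j))"
    unfolding split
    by (simp add: sum.reindex form_coeff_shift form_coeff_base_change[OF assms(3)] del: One_nat_def)
  thus False using x(3) i by simp
qed

lemma isotopy_cubic_det:
  assumes "isotopy 3 S"
  shows "cubic_det (base_change (\<lambda>p. poly p 0) S) = cubic_det (base_change (\<lambda>p. poly p 1) S)"
proof -
  have "eval_ac \<alpha> (cubic_det S) \<noteq> 0" for \<alpha>
    using closed_embedding_cubic_det[OF _ semiring_set_residue_field comm_ring_hom_ident] assms
    unfolding isotopy_def cubic_det_base_change[OF comm_ring_hom_eval_ac, symmetric] by blast
  then obtain \<delta> where "cubic_det S = [:\<delta>:]" by (rule polynomial_const_if_no_root)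
  thus ?thesis by (simp add: cubic_det_base_change[OF comm_ring_hom_poly])
qed

section \<open>Embeddings of degree three\<close>

lemma cubic_sections_row_steps:
  fixes s :: "4 \<Rightarrow> 'a::field poly poly"
  assumes "\<And>f. f \<in> forms UNIV 3 \<Longrightarrow> prod_span UNIV s 1 f"
  shows "\<exists>a. a \<noteq> 0 \<and> (s, (standard_sections 3)(3 := cst a * standard_sections 3 3)) \<in> row_step\<^sup>*"
proof (rule row_steps_basis)
  fix i show "prod_span UNIV s 1 (standard_sections 3 i)"
    by (rule assms[OF standard_sections_forms])
next
  fix c assume 0: "(\<Sum>k\<in>UNIV. cst (c k) * standard_sections 3 k) = (0 :: 'a poly poly)"
  show "\<forall>k. c k = 0"
  proof
    fix k
    have "index4 k \<le> 3" by (simp add: index4_def)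
    from form_coeff_standard_sum[OF this, of c UNIV] show "c k = 0" unfolding 0 by simp
  qed
qed

lemma prod_span_scaled_sections:
  fixes s :: "4 \<Rightarrow> 'a::field poly poly"
  assumes "\<And>i. c i \<noteq> 0" "prod_span UNIV s k f"
  shows "prod_span UNIV (\<lambda>i. cst (c i) * s i) k f"
proof (rule prod_span_trans[OF _ _ assms(2)])
  fix i
  have "prod_span UNIV (\<lambda>i. cst (c i) * s i) 1 (cst (1 / c i) * (cst (c i) * s i))"
    by (rule prod_span_scale[OF _ _ prod_span_section]) simp_all
  moreover have "cst (1 / c i) * (cst (c i) * s i) = s i"
    using assms(1) by (simp add: mult.assoc[symmetric] cst_mult[symmetric])
  ultimately show "prod_span UNIV (\<lambda>i. cst (c i) * s i) 1 (s i)" by simp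
qed simp

text \<open>Multiplying all of s by \<open>c\<close> keeps the morphism and brings its determinant
  to that of t. Both then reduce to the same normal form, whose scalar is determined by the
  determinant.\<close>

lemma cubic_isotopic_if_cubic_det_eq:
  fixes s t :: "4 \<Rightarrow> 'a::field poly poly"
  assumes s: "closed_embedding UNIV 3 s" and t: "closed_embedding UNIV 3 t"
    and eq: "cubic_det t = c ^ 4 * cubic_det s" and c: "c \<noteq> 0"
  shows "(morphism_of s, morphism_of t) \<in> isotopic_rel"
proof -
  let ?w = "\<lambda>a. (standard_sections 3 :: 4 \<Rightarrow> 'a poly poly)(3 := cst a * standard_sections 3 3)"
  let ?r = "\<lambda>i. cst c * s i"
  have span: "prod_span UNIV s 1 f" "prod_span UNIV t 1 f" if "f \<in> forms UNIV 3" for f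
    using closed_embedding_spans[OF s _ that] closed_embedding_spans[OF t _ that] by simp_all
  have span_r: "prod_span UNIV ?r 1 f" if "f \<in> forms UNIV 3" for f
    by (rule prod_span_scaled_sections[OF c span(1)[OF that]])
  obtain a where a: "a \<noteq> 0" "(?r, ?w a) \<in> row_step\<^sup>*" using cubic_sections_row_steps[OF span_r] by blast
  obtain b where b: "b \<noteq> 0" "(t, ?w b) \<in> row_step\<^sup>*" using cubic_sections_row_steps[OF span(2)] by blast
  have "cubic_det ?r = a * cubic_det (standard_sections 3)"
    using cubic_det_row_steps[OF a(2)] by (simp add: cubic_det_row_scale)
  moreover have "cubic_det t = b * cubic_det (standard_sections 3)"
    using cubic_det_row_steps[OF b(2)] by (simp add: cubic_det_row_scale)
  moreover have "cubic_det t \<noteq> 0"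
    by (rule closed_embedding_cubic_det[OF t semiring_set_UNIV comm_ring_hom_to_ac])
  ultimately have "a = b" using eq by (simp add: cubic_det_scale)
  hence steps: "(?r, t) \<in> row_step\<^sup>*" using rtrancl_trans[OF a(2)] sym_row_steps[OF b(2)] by simp
  have "generically_spanning UNIV 3 ?r"
    by (rule generically_spanning_if_spans[OF _ span_r])
       (auto intro!: forms_cst_mult closed_embedding_forms[OF s])
  from row_steps_isotopic[OF steps _ this] show ?thesis
    using morphism_of_scale[OF c, of s] by simp
qed

lemma ex_cubic_sections:
  assumes "a \<noteq> (0::'a::field)"
  shows "\<exists>s. closed_embedding UNIV 3 s \<and> cubic_det s = a"
proof -
  let ?e = "standard_sections 3 :: 4 \<Rightarrow> 'a poly poly"
  have emb: "closed_embedding UNIV 3 (\<lambda>i. cst (c i) * ?e i)" if c: "\<And>i. c i \<noteq> 0" for c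
  proof (rule generically_spanning_closed_embedding[OF semiring_set_UNIV _ generically_spanning_if_spans])
    show "cst (c i) * ?e i \<in> forms UNIV 3" for i
      by (intro forms_cst_mult standard_sections_forms) simp_all
    fix f :: "'a poly poly" assume f: "f \<in> forms UNIV 3"
    show "prod_span UNIV (\<lambda>i. cst (c i) * ?e i) 1 f"
    proof (rule prod_span_scaled_sections[OF c prod_span_forms[OF semiring_set_UNIV _ f]])
      fix i j :: nat assume ij: "i + j = 3"
      hence "j = 0 \<or> j = 1 \<or> j = 2 \<or> j = 3" by arith
      hence "index4 (of_nat j) = j" by (elim disjE) simp_all
      moreover have "i = 3 - j" using ij by simp
      ultimately have "?e (of_nat j) = fmono i j" using ij by (simp add: standard_sections_def)
      thus "prod_span UNIV ?e 1 (fmono i j)"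
        using prod_span_section[OF semiring_set_UNIV, of ?e "of_nat j"] by simp
    qed
  qed simp
  have 0: "cubic_det ?e \<noteq> 0"
    using closed_embedding_cubic_det[OF emb[of "\<lambda>_. 1"] semiring_set_UNIV comm_ring_hom_to_ac] by simp
  \<comment> \<open>One scaled monomial is enough to adjust the determinant.\<close>
  define c where "c i = (if i = 3 then a / cubic_det ?e else 1)" for i :: 4
  have "(\<lambda>i. cst (c i) * ?e i) = ?e(3 := cst (a / cubic_det ?e) * ?e 3)"
    by (auto simp: c_def fun_eq_iff)
  hence "cubic_det (\<lambda>i. cst (c i) * ?e i) = a" using 0 by (simp add: cubic_det_row_scale)
  moreover have "c i \<noteq> 0" for i using 0 assms by (simp add: c_def)
  ultimately show ?thesis using emb[of c] by blast
qed

text \<open>Stated for a relation that may reach beyond \<open>A\<close>: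
  \<open>isotopic_rel\<close> concerns embeddings of all degrees. The classes of elements of
  \<open>A\<close> are the fibres of \<open>g\<close>.\<close>

lemma bij_betw_quotient:
  assumes closed: "\<And>x y. x \<in> A \<Longrightarrow> (x, y) \<in> r \<Longrightarrow> y \<in> A"
    and iff: "\<And>x y. x \<in> A \<Longrightarrow> y \<in> A \<Longrightarrow> (x, y) \<in> r \<longleftrightarrow> g x = g y"
  shows "bij_betw (\<lambda>C. the_elem (g ` C)) (A // r) (g ` A)"
proof -
  have img: "r `` {x} = {y \<in> A. g y = g x}" if x: "x \<in> A" for x
  proof (rule equalityI; rule subsetI)
    fix y assume "y \<in> r `` {x}"
    hence xy: "(x, y) \<in> r" by simp
    have "y \<in> A" by (rule closed[OF x xy])
    thus "y \<in> {y \<in> A. g y = g x}" using iff[OF x] xy by simp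
  next
    fix y assume "y \<in> {y \<in> A. g y = g x}"
    thus "y \<in> r `` {x}" using iff[OF x] by simp
  qed
  have el: "the_elem (g ` (r `` {x})) = g x" if x: "x \<in> A" for x
  proof -
    have "g ` {y \<in> A. g y = g x} = {g x}" using x by auto
    thus ?thesis unfolding img[OF x] by simp
  qed
  have quot: "A // r = (\<lambda>x. r `` {x}) ` A" by (auto simp: quotient_def)
  show ?thesis
    unfolding bij_betw_def
  proof
    show "inj_on (\<lambda>C. the_elem (g ` C)) (A // r)"
    proof (rule inj_onI)
      fix C D assume "C \<in> A // r" "D \<in> A // r" and eq: "the_elem (g ` C) = the_elem (g ` D)"
      then obtain x y where xy: "x \<in> A" "C = r `` {x}" "y \<in> A" "D = r `` {y}"
        unfolding quot by blast
      hence "g x = g y" using eq el by simp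
      thus "C = D" using xy img by simp
    qed
    show "(\<lambda>C. the_elem (g ` C)) ` (A // r) = g ` A"
      unfolding quot image_image by (rule image_cong[OF refl el])
  qed
qed

lemma the_elem_morphism_of:
  assumes "\<And>c. c \<noteq> 0 \<Longrightarrow> g (\<lambda>i. cst c * s i) = g s"
  shows "the_elem (g ` morphism_of s) = g s"
proof -
  have "s \<in> morphism_of s" unfolding mem_morphism_of by (rule exI[of _ 1]) simp
  hence "g s \<in> g ` morphism_of s" by (rule imageI)
  moreover have "y = g s" if y: "y \<in> g ` morphism_of s" for y
  proof -
    obtain c where "c \<noteq> 0" "y = g (\<lambda>i. cst c * s i)" using y by (auto simp: mem_morphism_of)
    thus ?thesis using assms by simp
  qed
  ultimately have "g ` morphism_of s = {g s}" by blast
  thus ?thesis by simp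
qed

lemma isotopy_classes_degree_3:
  "\<exists>f. bij_betw f ((embeddings 3 :: (4 \<Rightarrow> 'a::field poly poly) set set) // isotopic_rel)
     (carrier (power_class_group 4 :: 'a set monoid))"
proof -
  define g :: "(4 \<Rightarrow> 'a poly poly) set \<Rightarrow> 'a set" where
    "g \<psi> = the_elem ((\<lambda>s. power_class 4 (cubic_det s)) ` \<psi>)" for \<psi>
  have g: "g (morphism_of s) = power_class 4 (cubic_det s)" for s
    unfolding g_def
  proof (rule the_elem_morphism_of)
    fix c :: 'a assume "c \<noteq> 0"
    hence "power_class 4 (cubic_det s) = power_class 4 (cubic_det (\<lambda>i. cst c * s i))"
      unfolding power_class_eq_iff cubic_det_scale by blast
    thus "power_class 4 (cubic_det (\<lambda>i. cst c * s i)) = power_class 4 (cubic_det s)" ..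
  qed
  have "bij_betw (\<lambda>C. the_elem (g ` C)) (embeddings 3 // isotopic_rel) (g ` embeddings 3)"
  proof (rule bij_betw_quotient)
    fix \<psi> \<psi>' :: "(4 \<Rightarrow> 'a poly poly) set" assume \<psi>: "\<psi> \<in> embeddings 3"
    show "(\<psi>, \<psi>') \<in> isotopic_rel \<Longrightarrow> \<psi>' \<in> embeddings 3" by (rule isotopic_embeddings[OF _ \<psi>])
    assume \<psi>': "\<psi>' \<in> embeddings 3"
    show "(\<psi>, \<psi>') \<in> isotopic_rel \<longleftrightarrow> g \<psi> = g \<psi>'"
    proof
      assume iso: "(\<psi>, \<psi>') \<in> isotopic_rel"
      show "g \<psi> = g \<psi>'"
        by (rule isotopic_invariant[OF _ iso \<psi>]) (simp only: g isotopy_cubic_det)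
    next
      assume eq: "g \<psi> = g \<psi>'"
      obtain s t where "\<psi> = morphism_of s" "closed_embedding UNIV 3 s"
        "\<psi>' = morphism_of t" "closed_embedding UNIV 3 t"
        using \<psi> \<psi>' by (auto simp: embeddings_def)
      thus "(\<psi>, \<psi>') \<in> isotopic_rel"
        using eq cubic_isotopic_if_cubic_det_eq[of s t] by (auto simp: g power_class_eq_iff)
    qed
  qed
  moreover have "g ` embeddings 3 = carrier (power_class_group 4)"
  proof (rule equalityI; rule subsetI)
    fix x assume "x \<in> g ` embeddings 3"
    then obtain s where s: "closed_embedding UNIV 3 s" "x = g (morphism_of s)"
      by (auto simp: embeddings_def)
    have "cubic_det s \<noteq> 0"
      by (rule closed_embedding_cubic_det[OF s(1) semiring_set_UNIV comm_ring_hom_to_ac])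
    thus "x \<in> carrier (power_class_group 4)"
      unfolding s(2) g carrier_power_class_group by blast
  next
    fix x :: "'a set" assume "x \<in> carrier (power_class_group 4)"
    then obtain a where a: "x = power_class 4 a" "a \<noteq> 0" unfolding carrier_power_class_group by blast
    obtain s where "closed_embedding UNIV 3 s" "cubic_det s = a" using ex_cubic_sections[OF a(2)] by blast
    thus "x \<in> g ` embeddings 3"
      using g[of s] a(1) by (auto simp: embeddings_def image_iff)
  qed
  ultimately show ?thesis by auto
qed

section \<open>The writhe\<close>

text \<open>Along the line the determinant is a cubic polynomial in \<tau> with leading coefficient
  the determinant of z.\<close>

lemma hdet_eq_0_on_line:
  fixes y z :: "nat \<Rightarrow> 'l::alg_closed_field"
  assumes "hdet (z 0) (z 1) (z 2) (z 3) (z 4) \<noteq> 0"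
  shows "\<exists>\<tau>. hdet (y 0 + \<tau> * z 0) (y 1 + \<tau> * z 1) (y 2 + \<tau> * z 2) (y 3 + \<tau> * z 3) (y 4 + \<tau> * z 4) = 0"
proof -
  define p where "p = hdet [:y 0, z 0:] [:y 1, z 1:] [:y 2, z 2:] [:y 3, z 3:] [:y 4, z 4:]"
  have "coeff p 3 = hdet (z 0) (z 1) (z 2) (z 3) (z 4)"
    by (simp add: p_def hdet_def numeral_poly numeral_3_eq_3 algebra_simps)
  hence "3 \<le> degree p" using assms by (intro le_degree) simp
  hence "degree p > 0" by simp
  from alg_closed_imp_poly_has_root[OF this] obtain \<tau> where "poly p \<tau> = 0" by blast
  thus ?thesis unfolding p_def poly_hdet by auto
qed

text \<open>
  If the wedge product of the sections is zero, then the functionals that vanish on them form a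
  space of dimension at least two, which meets the cubic hypersurface of degenerate functionals.
\<close>
lemma closed_embedding_wedge_hdet:
  fixes s :: "4 \<Rightarrow> 'f::field poly poly" and h :: "'f \<Rightarrow> 'l::{alg_closed_field, field_gcd}"
  assumes "closed_embedding F 4 s" "semiring_set F" "comm_ring_hom h"
  shows "wedge_hdet s \<noteq> 0"
proof
  assume 0: "wedge_hdet s = 0"
  interpret h: comm_ring_hom h by (rule assms(3))
  define t where "t = base_change h s"
  have wt: "wedge t c = h (wedge s c)" for c unfolding t_def by (rule wedge_base_change[OF assms(3)])
  have coeff_t: "form_coeff 4 (t i) c = h (form_coeff 4 (s i) c)" for i c
    unfolding t_def by (rule form_coeff_base_change[OF assms(3)])
  have nondeg: "hdet (x 0) (x 1) (x 2) (x 3) (x 4) \<noteq> 0"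
    if "\<exists>c\<le>4. x c \<noteq> 0" "\<And>i. (\<Sum>c\<le>4. form_coeff 4 (t i) c * x c) = 0" for x
  proof
    assume "hdet (x 0) (x 1) (x 2) (x 3) (x 4) = 0"
    with closed_embedding_functional[where x = x, OF assms _ that(1)]
    obtain i where "(\<Sum>c\<le>4. h (form_coeff 4 (s i) c) * x c) \<noteq> 0" by auto
    thus False using that(2)[of i] by (simp add: coeff_t)
  qed
  have set: "{..<5} = {..4::nat}" by auto
  show False
  proof (cases "\<exists>c\<le>4. wedge t c \<noteq> 0")
    case True
    have "(\<Sum>c\<le>4. form_coeff 4 (t i) c * wedge t c) = 0" for i
      using wedge_vanishes[of t i] by (simp add: set)
    from nondeg[OF True this] have "wedge_hdet t \<noteq> 0" by (simp add: wedge_hdet_def)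
    moreover have "wedge_hdet t = h (wedge_hdet s)"
      unfolding wedge_hdet_def wt by (rule hdet_wedge_base_change[OF assms(3)])
    ultimately show False using 0 by simp
  next
    case False
    hence w: "wedge t c = 0" if "c \<le> 4" for c using that by blast
    have "wedge t 0 = 0" by (rule w) simp
    then obtain y where y: "\<exists>c\<le>4. y c \<noteq> 0" "\<And>i. (\<Sum>c\<le>4. form_coeff 4 (t i) c * y c) = 0"
      by (rule wedge_0_functional) simp_all
    obtain k where k: "k \<le> 4" "y k \<noteq> 0" using y(1) by blast
    have "k < 5" using k(1) by simp
    \<comment> \<open>A second functional with value 0 where y is nonzero, so the two are
      independent.\<close>
    obtain z where z: "z k = 0" "\<exists>c\<le>4. z c \<noteq> 0"
      "\<And>i. (\<Sum>c\<le>4. form_coeff 4 (t i) c * z c) = 0"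
      by (rule wedge_0_functional[OF w[OF k(1)] \<open>k < 5\<close>], rule that)
    from hdet_eq_0_on_line[OF nondeg[OF z(2,3)], of y] obtain \<tau> where
      \<tau>: "hdet (y 0 + \<tau> * z 0) (y 1 + \<tau> * z 1) (y 2 + \<tau> * z 2) (y 3 + \<tau> * z 3) (y 4 + \<tau> * z 4) = 0"
      by blast
    \<comment> \<open>The k-th value is that of y, whatever \<tau> is.\<close>
    have 1: "\<exists>c\<le>4. y c + \<tau> * z c \<noteq> 0" using k z(1) by (intro exI[of _ k]) simp
    have 2: "(\<Sum>c\<le>4. form_coeff 4 (t i) c * (y c + \<tau> * z c)) = 0" for i
    proof -
      have "(\<Sum>c\<le>4. form_coeff 4 (t i) c * (y c + \<tau> * z c)) =
          (\<Sum>c\<le>4. form_coeff 4 (t i) c * y c) + \<tau> * (\<Sum>c\<le>4. form_coeff 4 (t i) c * z c)"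
        unfolding sum_distrib_left sum.distrib[symmetric]
        by (rule sum.cong) (simp_all add: algebra_simps)
      thus ?thesis by (simp only: y(2) z(3)) simp
    qed
    from nondeg[OF 1 2] \<tau> show False by simp
  qed
qed

lemma wedge_hdet_base_change:
  "comm_ring_hom h \<Longrightarrow> wedge_hdet (base_change h s) = h (wedge_hdet s)"
  unfolding wedge_hdet_def wedge_base_change by (rule hdet_wedge_base_change)

lemma wedge_hdet_scale: "wedge_hdet (\<lambda>i. cst c * s i) = c ^ 12 * wedge_hdet s"
proof -
  have "hdet (x * a0) (x * a1) (x * a2) (x * a3) (x * a4) = x ^ 3 * hdet a0 a1 a2 a3 a4"
    for x a0 a1 a2 a3 a4 :: 'a
    by (simp add: hdet_def power3_eq_cube algebra_simps)
  moreover have "(c ^ 4) ^ 3 = c ^ 12" by (simp add: power_mult[symmetric])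
  ultimately show ?thesis by (simp add: wedge_hdet_def wedge_scale)
qed

section \<open>The writhe in terms of Hankel matrices\<close>

lemma hankel_entry:
  assumes "i < 3" "j < 3"
  shows "hankel (f 0) (f 1) (f 2) (f 3) (f 4) $$ (i, j) = f (i + j)"
  using less_3_cases[OF assms(1)] less_3_cases[OF assms(2)]
  by (elim disjE) (simp_all add: hankel_def eval_nat_numeral)

abbreviation wedge_hankel :: "(4 \<Rightarrow> 'r::comm_ring_1 poly poly) \<Rightarrow> 'r mat" where
  "wedge_hankel s \<equiv> hankel (wedge s 0) (wedge s 1) (wedge s 2) (wedge s 3) (wedge s 4)"

lemma writhe_matrix_eq: "writhe_matrix s = wedge_hankel s"
proof (rule eq_matI)
  fix i j assume "i < dim_row (wedge_hankel s)" "j < dim_col (wedge_hankel s)"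
  hence ij: "i < 3" "j < 3" by (simp_all add: hankel_def)
  show "writhe_matrix s $$ (i, j) = wedge_hankel s $$ (i, j)"
    using ij by (simp only: hankel_entry[OF ij]) (simp add: writhe_matrix_def writhe_coord_eq_wedge)
qed (simp_all add: writhe_matrix_def hankel_def)

lemma det_wedge_hankel: "det (wedge_hankel s) = wedge_hdet s"
  by (simp only: det_hankel wedge_hdet_def)

lemma sections_writhe_eq:
  "sections_writhe s = (gw_class (wedge_hankel s), power_class 12 (wedge_hdet s))"
  by (simp only: sections_writhe_def writhe_matrix_eq det_wedge_hankel)

lemma wedge_hankel_symmetric_form: "wedge_hdet s \<noteq> 0 \<Longrightarrow> wedge_hankel s \<in> symmetric_forms"
  unfolding wedge_hdet_def by (rule hankel_symmetric_form)

text \<open>All entries are multiplied by c^4, the square of c^2, so the basis scaled by c^2 is an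
  isometry.\<close>

lemma isometric_wedge_hankel_scale:
  fixes s :: "4 \<Rightarrow> 'a::field poly poly"
  assumes c: "c \<noteq> 0" and hd: "wedge_hdet s \<noteq> 0"
  shows "isometric (wedge_hankel s) (wedge_hankel (\<lambda>i. cst c * s i))"
proof -
  let ?t = "\<lambda>i. cst c * s i"
  have det: "det (wedge_hankel ?t) \<noteq> 0"
    using hd c by (simp add: det_wedge_hankel wedge_hdet_scale del: One_nat_def)
  have entry: "bil (wedge_hankel s) 3 (\<lambda>a. if a = i then c\<^sup>2 else 0) (\<lambda>a. if a = j then c\<^sup>2 else 0) =
      wedge_hankel ?t $$ (i, j)" if ij: "i < 3" "j < 3" for i j
  proof -
    have "bil (wedge_hankel s) 3 (\<lambda>a. if a = i then c\<^sup>2 else 0) (\<lambda>a. if a = j then c\<^sup>2 else 0) =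
        c\<^sup>2 * wedge_hankel s $$ (i, j) * c\<^sup>2"
      unfolding bil_def sum_3 using less_3_cases[OF ij(1)] less_3_cases[OF ij(2)]
      by (elim disjE) simp_all
    also have "\<dots> = c ^ 4 * wedge s (i + j)"
      unfolding hankel_entry[OF ij] by (simp add: algebra_simps eval_nat_numeral)
    also have "\<dots> = wedge_hankel ?t $$ (i, j)" unfolding hankel_entry[OF ij] by (rule wedge_scale[symmetric])
    finally show ?thesis .
  qed
  show ?thesis
    by (rule isometric_iff_bil[OF hankel_carrier hankel_carrier det, THEN iffD2])
       (intro exI[of _ "\<lambda>i a. if a = i then c\<^sup>2 else 0"] allI impI entry)
qed

lemma writhe_morphism_of:
  fixes s :: "4 \<Rightarrow> 'a::field poly poly"
  assumes two: "(2::'a) \<noteq> 0" and hd: "wedge_hdet s \<noteq> 0"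
  shows "writhe (morphism_of s) = sections_writhe s"
  unfolding writhe_def
proof (rule the_elem_morphism_of)
  fix c :: 'a assume c: "c \<noteq> 0"
  let ?t = "\<lambda>i. cst c * s i"
  have hdt: "wedge_hdet ?t \<noteq> 0" using hd c by (simp add: wedge_hdet_scale)
  have "gw_class (wedge_hankel s) = gw_class (wedge_hankel ?t)"
    unfolding gw_class_eq_iff[OF two wedge_hankel_symmetric_form[OF hd] wedge_hankel_symmetric_form[OF hdt]]
    by (rule isometric_wedge_hankel_scale[OF c hd])
  moreover have "power_class 12 (wedge_hdet s) = power_class 12 (wedge_hdet ?t)"
    unfolding power_class_eq_iff wedge_hdet_scale using c by blast
  ultimately show "sections_writhe ?t = sections_writhe s" by (simp only: sections_writhe_eq)
qed

lemma isotopy_writhe: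
  fixes S :: "4 \<Rightarrow> 'a::field poly poly poly"
  assumes two: "(2::'a) \<noteq> 0" and iso: "isotopy 4 S"
  shows "writhe (morphism_of (base_change (\<lambda>p. poly p 0) S)) =
    writhe (morphism_of (base_change (\<lambda>p. poly p 1) S))"
proof -
  have "eval_ac \<alpha> (wedge_hdet S) \<noteq> 0" for \<alpha>
    using closed_embedding_wedge_hdet[OF _ semiring_set_residue_field comm_ring_hom_ident] iso
    unfolding isotopy_def wedge_hdet_base_change[OF comm_ring_hom_eval_ac, symmetric] by blast
  then obtain \<delta> where \<delta>: "\<delta> \<noteq> 0" "wedge_hdet S = [:\<delta>:]" by (rule polynomial_const_if_no_root)
  have hd: "wedge_hdet (base_change (\<lambda>p. poly p r) S) = \<delta>" for r
    by (simp add: wedge_hdet_base_change[OF comm_ring_hom_poly] \<delta>(2))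
  have map: "map_mat (\<lambda>p. poly p r) (wedge_hankel S) = wedge_hankel (base_change (\<lambda>p. poly p r) S)" for r
    unfolding map_poly_hankel wedge_base_change[OF comm_ring_hom_poly] ..
  have "det (wedge_hankel S) = [:\<delta>:]" by (simp only: det_wedge_hankel \<delta>(2))
  from isometric_specializations[OF two hankel_carrier hankel_transpose this \<delta>(1), of 0 1]
  have "gw_class (wedge_hankel (base_change (\<lambda>p. poly p 0) S)) =
      gw_class (wedge_hankel (base_change (\<lambda>p. poly p 1) S))"
    unfolding map
    by (intro gw_class_eq_iff[OF two wedge_hankel_symmetric_form wedge_hankel_symmetric_form, THEN iffD2])
       (simp_all add: hd \<delta>(1))
  thus ?thesis using \<delta>(1) by (simp add: writhe_morphism_of[OF two] hd sections_writhe_eq)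
qed

lemma quartic_embeddingE:
  fixes \<psi> :: "(4 \<Rightarrow> 'a::field poly poly) set"
  assumes "\<psi> \<in> embeddings 4"
  obtains s where "\<psi> = morphism_of s" "\<And>i. s i \<in> forms UNIV 4" "wedge_hdet s \<noteq> 0"
proof -
  obtain s where s: "\<psi> = morphism_of s" "closed_embedding UNIV 4 s"
    using assms by (auto simp: embeddings_def)
  have "wedge_hdet s \<noteq> 0"
    by (rule closed_embedding_wedge_hdet[OF s(2) semiring_set_UNIV comm_ring_hom_to_ac])
  thus ?thesis by (rule that[OF s(1) closed_embedding_forms[OF s(2)]])
qed

lemma writhe_in_writhe_group:
  fixes \<psi> :: "(4 \<Rightarrow> 'a::field poly poly) set"
  assumes two: "(2::'a) \<noteq> 0" and "\<psi> \<in> embeddings 4"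
  shows "writhe \<psi> \<in> writhe_group"
proof -
  obtain s where s: "\<psi> = morphism_of s" "wedge_hdet s \<noteq> 0"
    using quartic_embeddingE[OF assms(2)] by metis
  have f: "wedge_hankel s \<in> symmetric_forms" by (rule wedge_hankel_symmetric_form[OF s(2)])
  have "gw_disc (gw_class (wedge_hankel s)) = power_class 2 (wedge_hdet s)"
    unfolding gw_disc_gw_class[OF f] det_wedge_hankel ..
  moreover have "to_square_class (power_class 12 (wedge_hdet s)) = power_class 2 (wedge_hdet s)"
    using to_square_class_power_class[of 6] by simp
  moreover have "power_class 12 (wedge_hdet s) \<in> carrier (power_class_group 12)"
    using s(2) unfolding carrier_power_class_group by blast
  ultimately show ?thesis
    unfolding s(1) writhe_morphism_of[OF two s(2)] sections_writhe_eq writhe_group_def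
    using gw_class_in_carrier[OF f] by simp
qed

text \<open>The determinants agree only up to c^12, whereas a path keeps the determinant.
  Multiplying s by \<open>c\<close> makes them equal without changing the morphism or the isometry
  class.\<close>

lemma isotopic_if_same_writhe:
  fixes s t :: "4 \<Rightarrow> 'a::field poly poly"
  assumes two: "(2::'a) \<noteq> 0" and s: "\<And>i. s i \<in> forms UNIV 4" "wedge_hdet s \<noteq> 0"
    and t: "\<And>i. t i \<in> forms UNIV 4" "wedge_hdet t \<noteq> 0"
    and eq: "sections_writhe s = sections_writhe t"
  shows "(morphism_of s, morphism_of t) \<in> isotopic_rel"
proof -
  have iso: "isometric (wedge_hankel s) (wedge_hankel t)"
    using eq gw_class_eq_iff[OF two wedge_hankel_symmetric_form[OF s(2)] wedge_hankel_symmetric_form[OF t(2)]]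
    by (simp add: sections_writhe_eq)
  have "power_class 12 (wedge_hdet s) = power_class 12 (wedge_hdet t)"
    using eq by (simp add: sections_writhe_eq)
  then obtain c where c: "c \<noteq> 0" "wedge_hdet t = c ^ 12 * wedge_hdet s"
    unfolding power_class_eq_iff by blast
  let ?r = "\<lambda>i. cst c * s i"
  have hr: "wedge_hdet ?r = wedge_hdet t" by (simp only: wedge_hdet_scale c(2))
  have r: "?r i \<in> forms UNIV 4" for i by (intro forms_cst_mult s) simp_all
  have "isometric (wedge_hankel ?r) (wedge_hankel t)"
    using isometric_trans[OF isometric_sym[OF isometric_wedge_hankel_scale[OF c(1) s(2)] hankel_carrier] iso
        hankel_carrier] .
  from hankel_path_if_isometric[OF two _ _ this, folded wedge_hdet_def]
  have path: "(wedge_tuple ?r, wedge_tuple t) \<in> hankel_path\<^sup>*" using hr t(2) by metis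
  have "wedge_hdet ?r \<noteq> 0" unfolding hr by (rule t(2))
  from isotopic_if_hankel_path[OF two r this path _ refl]
  have "(morphism_of ?r, morphism_of t) \<in> isotopic_rel" using t(1) by blast
  thus ?thesis using morphism_of_scale[OF c(1), of s] by simp
qed

theorem theoremD:
  assumes "CHAR('a::field) \<noteq> 2"
  shows
    "(\<forall>d \<in> {1, 2}. \<forall>\<psi> \<in> embeddings d. \<forall>\<psi>' \<in> embeddings d.
        (\<psi> :: (4 \<Rightarrow> 'a poly poly) set, \<psi>') \<in> isotopic_rel) \<and>
     (\<exists>f. bij_betw f ((embeddings 3 :: (4 \<Rightarrow> 'a poly poly) set set) // isotopic_rel)
        (carrier (power_class_group 4 :: 'a set monoid))) \<and>
     (writhe :: (4 \<Rightarrow> 'a poly poly) set \<Rightarrow> _) ` embeddings 4 \<subseteq> writhe_group \<and>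
     (\<forall>\<psi> \<in> embeddings 4. \<forall>\<psi>' \<in> embeddings 4.
        (\<psi> :: (4 \<Rightarrow> 'a poly poly) set, \<psi>') \<in> isotopic_rel \<longleftrightarrow> writhe \<psi> = writhe \<psi>')"
proof (intro conjI ballI)
  have two: "(2::'a) \<noteq> 0"
  proof
    assume "(2::'a) = 0"
    hence "of_nat 2 = (0::'a)" by simp
    hence "CHAR('a) dvd 2" by (simp only: of_nat_eq_0_iff_char_dvd)
    hence "CHAR('a) = 1" using assms two_is_prime_nat by (auto simp: prime_nat_iff)
    thus False using CHAR_not_1' by simp
  qed
  show "(\<psi>, \<psi>') \<in> isotopic_rel" if "d \<in> {1, 2}" "\<psi> \<in> embeddings d" "\<psi>' \<in> embeddings d"
    for d and \<psi> \<psi>' :: "(4 \<Rightarrow> 'a poly poly) set"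
    using that by (rule isotopic_degree_le_2)
  show "\<exists>f. bij_betw f ((embeddings 3 :: (4 \<Rightarrow> 'a poly poly) set set) // isotopic_rel)
      (carrier (power_class_group 4 :: 'a set monoid))"
    by (rule isotopy_classes_degree_3)
  show "(writhe :: (4 \<Rightarrow> 'a poly poly) set \<Rightarrow> _) ` embeddings 4 \<subseteq> writhe_group"
    using writhe_in_writhe_group[OF two] by blast
  fix \<psi> \<psi>' :: "(4 \<Rightarrow> 'a poly poly) set" assume \<psi>: "\<psi> \<in> embeddings 4" and \<psi>': "\<psi>' \<in> embeddings 4"
  show "(\<psi>, \<psi>') \<in> isotopic_rel \<longleftrightarrow> writhe \<psi> = writhe \<psi>'"
  proof
    assume iso: "(\<psi>, \<psi>') \<in> isotopic_rel"
    show "writhe \<psi> = writhe \<psi>'" by (rule isotopic_invariant[OF isotopy_writhe[OF two] iso \<psi>])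
  next
    assume eq: "writhe \<psi> = writhe \<psi>'"
    obtain s where s: "\<psi> = morphism_of s" "\<And>i. s i \<in> forms UNIV 4" "wedge_hdet s \<noteq> 0"
      using quartic_embeddingE[OF \<psi>] by metis
    obtain t where t: "\<psi>' = morphism_of t" "\<And>i. t i \<in> forms UNIV 4" "wedge_hdet t \<noteq> 0"
      using quartic_embeddingE[OF \<psi>'] by metis
    have "sections_writhe s = sections_writhe t"
      using eq unfolding s(1) t(1) writhe_morphism_of[OF two s(3)] writhe_morphism_of[OF two t(3)] .
    thus "(\<psi>, \<psi>') \<in> isotopic_rel" unfolding s(1) t(1)
      by (rule isotopic_if_same_writhe[OF two s(2,3) t(2,3)])
  qed
qed

end
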